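(* Let $G$ be a locally compact group with a compact normal subgroup $A$ such that $G/A$ is $\Pi$-procyclic. Then $G$ contains a closed $\Pi$-procyclic subgroup $H_\Pi$ such that $G=AH_\Pi$.
   Context: A topological group $B$ is periodic if it is locally compact, totally disconnected, and $\overline{\langle b\rangle}$ is compact for all $b\in B$. For a periodic locally compact abelian group $B$ and a prime $p$, the $p$-primary component $B_p$ is the set of $b\in B$ such that $\overline{\langle b\rangle}$ is a pro-$p$ group. $B$ is $\Pi$-procyclic if it is a periodic locally compact abelian group each of whose $p$-primary components is either a finite cyclic $p$-group (possibly trivial) or isomorphic to the $p$-adic integers $\mathbb{Z}_p$. *)

theory Defs
  imports "HOL-Analysis.Analysis" "HOL-Algebra.Algebra"
begin

definition topological_group :: "('a, 'b) monoid_scheme \<Rightarrow> 'a topology \<Rightarrow> bool" where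
  "topological_group G T \<longleftrightarrow> group G \<and> topspace T = carrier G \<and>
     continuous_map (prod_topology T T) T (\<lambda>(x, y). x \<otimes>\<^bsub>G\<^esub> y) \<and>
     continuous_map T T (\<lambda>x. inv\<^bsub>G\<^esub> x)"

definition locally_compact_group :: "('a, 'b) monoid_scheme \<Rightarrow> 'a topology \<Rightarrow> bool" where
  "locally_compact_group G T \<longleftrightarrow> topological_group G T \<and> Hausdorff_space T \<and> locally_compact_space T"

definition totally_disconnected_space :: "'a topology \<Rightarrow> bool" where
  "totally_disconnected_space T \<longleftrightarrow> (\<forall>x \<in> topspace T. connected_component_of_set T x = {x})"

definition periodic_group :: "('a, 'b) monoid_scheme \<Rightarrow> 'a topology \<Rightarrow> bool" where
  "periodic_group B T \<longleftrightarrow> locally_compact_group B T \<and> totally_disconnected_space T \<and>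
     (\<forall>b \<in> carrier B. compactin T (T closure_of (generate B {b})))"

definition pro_p_group :: "('a, 'b) monoid_scheme \<Rightarrow> 'a topology \<Rightarrow> nat \<Rightarrow> bool" where
  "pro_p_group K T p \<longleftrightarrow> topological_group K T \<and> compact_space T \<and> Hausdorff_space T \<and>
     totally_disconnected_space T \<and>
     (\<forall>N. N \<lhd> K \<and> openin T N \<longrightarrow> (\<exists>k. card (rcosets\<^bsub>K\<^esub> N) = p ^ k))"

definition primary_component :: "('a, 'b) monoid_scheme \<Rightarrow> 'a topology \<Rightarrow> nat \<Rightarrow> 'a set" where
  "primary_component B T p = {b \<in> carrier B.
     pro_p_group (B\<lparr>carrier := T closure_of (generate B {b})\<rparr>)
                 (subtopology T (T closure_of (generate B {b}))) p}"

text \<open>The p-adic integers as the inverse limit of the Z/p^n Z, with the (subspace of the)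
  product of discrete topologies.\<close>
definition Zp_carrier :: "nat \<Rightarrow> (nat \<Rightarrow> int) set" where
  "Zp_carrier p = {x. \<forall>n. 0 \<le> x n \<and> x n < int p ^ n \<and> x (Suc n) mod (int p ^ n) = x n}"

definition Zp :: "nat \<Rightarrow> (nat \<Rightarrow> int) monoid" where
  "Zp p = \<lparr>carrier = Zp_carrier p, mult = (\<lambda>x y n. (x n + y n) mod (int p ^ n)), one = (\<lambda>n. 0)\<rparr>"

definition Zp_topology :: "nat \<Rightarrow> (nat \<Rightarrow> int) topology" where
  "Zp_topology p = subtopology (product_topology (\<lambda>_. discrete_topology UNIV) UNIV) (Zp_carrier p)"

definition top_group_isomorphic ::
  "('a, 'c) monoid_scheme \<Rightarrow> 'a topology \<Rightarrow> ('b, 'd) monoid_scheme \<Rightarrow> 'b topology \<Rightarrow> bool" where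
  "top_group_isomorphic G T H S \<longleftrightarrow> (\<exists>f. f \<in> iso G H \<and> homeomorphic_map T S f)"

definition finite_cyclic_p_group :: "('a, 'b) monoid_scheme \<Rightarrow> nat \<Rightarrow> bool" where
  "finite_cyclic_p_group B p \<longleftrightarrow> finite (carrier B) \<and> (\<exists>k. card (carrier B) = p ^ k) \<and>
     (\<exists>g \<in> carrier B. carrier B = generate B {g})"

definition Pi_procyclic :: "('a, 'b) monoid_scheme \<Rightarrow> 'a topology \<Rightarrow> bool" where
  "Pi_procyclic B T \<longleftrightarrow> periodic_group B T \<and> comm_group B \<and>
     (\<forall>p::nat. Factorial_Ring.prime p \<longrightarrow>
        finite_cyclic_p_group (B\<lparr>carrier := primary_component B T p\<rparr>) p \<or>
        top_group_isomorphic (B\<lparr>carrier := primary_component B T p\<rparr>)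
          (subtopology T (primary_component B T p)) (Zp p) (Zp_topology p))"

definition quotient_topology :: "'a topology \<Rightarrow> 'b set \<Rightarrow> ('a \<Rightarrow> 'b) \<Rightarrow> 'b topology" where
  "quotient_topology T S f = topology (\<lambda>U. U \<subseteq> S \<and> openin T {x \<in> topspace T. f x \<in> U})"

definition quotient_group_topology :: "('a, 'b) monoid_scheme \<Rightarrow> 'a topology \<Rightarrow> 'a set \<Rightarrow> 'a set topology" where
  "quotient_group_topology G T A = quotient_topology T (rcosets\<^bsub>G\<^esub> A) (\<lambda>x. A #>\<^bsub>G\<^esub> x)"

end

theory Submission
  imports Defs "HOL-Analysis.Kronecker_Approximation_Theorem"
begin

text \<open>
  Write \<open>Q = G/A\<close>. It is the union of a tower of compact open subgroups \<open>Q\<^sub>0 \<subseteq> Q\<^sub>1 \<subseteq> \<dots>\<close>,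
  each topologically generated by a single element, where \<open>Q\<^sub>k\<^sub>+\<^sub>1/Q\<^sub>k\<close> is cyclic of order \<open>m\<^sub>k\<close> and every
  prime divides at most one \<open>m\<^sub>k\<close>. The elements of \<open>G\<close> lying over generators of \<open>Q\<^sub>k\<close> form nonempty compact
  sets mapped into each other by \<open>x \<mapsto> x^m\<^sub>k\<close>, so a compactness argument gives lifts with \<open>g\<^sub>k\<^sub>+\<^sub>1^m\<^sub>k = g\<^sub>k\<close>.

  The closure of \<open>\<langle>g\<^sub>k\<rangle>\<close> need not be totally disconnected. To repair this, let \<open>n\<close> run along a filter on the
  integers that converges to \<open>1\<close> modulo every positive integer while \<open>n\<theta>\<close> converges to a rational number modulo
  \<open>1\<close> for every real \<open>\<theta>\<close> (choose a basis of the reals over the rationals containing \<open>1\<close> and use Kronecker's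
  theorem). By Bogolyubov's lemma, which replaces Pontryagin duality here, \<open>g^n\<close> is close to the identity as soon as
  finitely many \<open>n\<theta>\<close> are close to integers. Hence \<open>d\<^sub>k = lim g\<^sub>k^n\<close> exists, is again a coherent system of lifts, and
  generates a profinite group. The union \<open>H\<close> of the closures of \<open>\<langle>d\<^sub>k\<rangle>\<close> meets the preimage of \<open>Q\<^sub>k\<close> exactly in
  the closure of \<open>\<langle>d\<^sub>k\<rangle>\<close>, which makes \<open>H\<close> closed and \<open>\<Pi>\<close>-procyclic.
\<close>

section \<open>Bohr sets of integers\<close>

text \<open>Neither commutativity of \<open>G\<close> nor any structure of \<open>A\<close> beyond
  compactness is available, so each correction takes place inside the closure of the powers of one
  element, which is abelian. If \<open>A\<close> contains a circle, a lift may carry an irrational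
  rotation, and this part has to be removed without disturbing the image in \<open>Q\<close> or the
  relations between the lifts. Limits of powers along one common filter respect both. Relations
  between powers pass through the continuous power maps. The image in \<open>Q\<close> does not
  move, since elements of \<open>Q\<close> have finite order modulo every open subgroup and
  \<open>n\<close> tends to 1 modulo that order. Rationality of the limits of
  \<open>n\<theta>\<close> gives, for each neighbourhood of the identity, some power of
  \<open>d_k\<close> all of whose powers lie in it. The two demands on the filter meet only at
  rational \<open>\<theta>\<close>, where the limit of \<open>n\<theta>\<close> is forced to be
  \<open>\<theta>\<close>. This is why 1 belongs to the basis: the remaining basis elements are
  independent of it and can be sent to 0 modulo 1.\<close>

lemma sum_roots_of_unity:
  fixes M :: nat and k :: int
  assumes "M > 0"
  shows "(\<Sum>\<xi><M. cis (2 * pi * of_int k * real \<xi> / real M)) = (if int M dvd k then of_nat M else 0)"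
proof -
  define w where "w = cis (2 * pi * of_int k / real M)"
  have pw: "cis (2 * pi * of_int k * real \<xi> / real M) = w ^ \<xi>" for \<xi>
    unfolding w_def Complex.DeMoivre by (simp add: field_simps)
  show ?thesis
  proof (cases "int M dvd k")
    case True
    then obtain j where "k = int M * j" by blast
    then have "w = 1" using assms
      by (simp add: w_def mult.assoc cis_multiple_2pi[simplified mult.assoc])
    then show ?thesis using True by (simp add: pw)
  next
    case False
    have "w \<noteq> 1"
    proof
      assume "w = 1"
      then have "cos (2 * pi * of_int k / real M) = 1"
        unfolding w_def by (metis cis.simps(1) one_complex.simps(1))
      then obtain j :: int where "2 * pi * of_int k / real M = of_int j * 2 * pi"
        unfolding cos_one_2pi_int by blast
      then have "real_of_int k = of_int (j * int M)" using assms by (simp add: field_simps)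
      then have "k = j * int M" by linarith
      with False show False by simp
    qed
    moreover have "w ^ M = 1"
    proof -
      have "w ^ M = cis (2 * pi * of_int k)" unfolding w_def Complex.DeMoivre using assms by simp
      then show ?thesis by simp
    qed
    ultimately show ?thesis using False by (simp add: pw geometric_sum)
  qed
qed

text \<open>Expand the number of representations \<open>n = a + b - c - d\<close> in characters modulo \<open>M\<close>; by Parseval, the
  frequencies outside the large spectrum \<open>\<Lambda>\<close> contribute at most half of the main term.\<close>

lemma bogolyubov_cyclic:
  fixes S :: "int set" and M K :: nat
  assumes "finite S" "S \<noteq> {}" and inj: "inj_on (\<lambda>x. x mod int M) S" and "M > 0"
    and K: "M \<le> K * card S"
  shows "\<exists>\<Lambda> \<subseteq> {..<M}. card \<Lambda> \<le> 2 * K\<^sup>2 \<and>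
    (\<forall>n::int. (\<forall>\<xi>\<in>\<Lambda>. cos (2 * pi * of_int n * real \<xi> / real M) \<ge> 0) \<longrightarrow>
       (\<exists>a\<in>S. \<exists>b\<in>S. \<exists>c\<in>S. \<exists>d\<in>S. int M dvd a + b - c - d - n))"
proof -
  define e where "e k \<xi> = cis (2 * pi * of_int k * real \<xi> / real M)" for k :: int and \<xi> :: nat
  have e_mult: "e j \<xi> * e k \<xi> = e (j + k) \<xi>" for j k \<xi>
    unfolding e_def cis_mult by (simp add: algebra_simps add_divide_distrib)
  have e_cnj: "cnj (e k \<xi>) = e (- k) \<xi>" for k \<xi>
    unfolding e_def cis_cnj by simp
  have e_sum: "(\<Sum>\<xi><M. e k \<xi>) = (if int M dvd k then of_nat M else 0)" for k
    unfolding e_def by (rule sum_roots_of_unity[OF \<open>M > 0\<close>])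
  define F where "F \<xi> = (\<Sum>a\<in>S. e a \<xi>)" for \<xi>
  define s where "s = real (card S)"
  have s: "s > 0" using assms by (simp add: s_def card_gt_0_iff)
  have K0: "K > 0" using K \<open>M > 0\<close> by (cases K) auto
  have MK: "real M \<le> real K * s" using K unfolding s_def by (metis of_nat_le_iff of_nat_mult)
  have F2: "of_real ((cmod (F \<xi>))\<^sup>2) = (\<Sum>a\<in>S. \<Sum>c\<in>S. e (a - c) \<xi>)" for \<xi>
  proof -
    have "of_real ((cmod (F \<xi>))\<^sup>2) = F \<xi> * cnj (F \<xi>)"
      by (rule complex_norm_square)
    also have "\<dots> = (\<Sum>a\<in>S. \<Sum>c\<in>S. e (a - c) \<xi>)"
      by (simp add: F_def sum_product e_cnj e_mult)
    finally show ?thesis .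
  qed
  have dvd_iff: "int M dvd a - c \<longleftrightarrow> a = c" if "a \<in> S" "c \<in> S" for a c
    using inj that by (auto simp: inj_on_def mod_eq_dvd_iff)
  have parseval: "(\<Sum>\<xi><M. (cmod (F \<xi>))\<^sup>2) = real M * s"
  proof -
    have "of_real (\<Sum>\<xi><M. (cmod (F \<xi>))\<^sup>2) = (\<Sum>\<xi><M. \<Sum>a\<in>S. \<Sum>c\<in>S. e (a - c) \<xi>)"
      unfolding of_real_sum F2 ..
    also have "\<dots> = (\<Sum>a\<in>S. \<Sum>\<xi><M. \<Sum>c\<in>S. e (a - c) \<xi>)"
      by (rule sum.swap)
    also have "\<dots> = (\<Sum>a\<in>S. \<Sum>c\<in>S. \<Sum>\<xi><M. e (a - c) \<xi>)"
      by (intro sum.cong refl sum.swap)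
    also have "\<dots> = (\<Sum>a\<in>S. \<Sum>c\<in>S. if c = a then of_nat M else 0)"
      unfolding e_sum by (intro sum.cong refl) (auto simp: dvd_iff)
    also have "\<dots> = of_real (real M * s)"
      using \<open>finite S\<close> by (simp add: s_def)
    finally show ?thesis using of_real_eq_iff by blast
  qed
  \<comment> \<open>The threshold serves two bounds at once. As \<open>M \<le> K * s\<close>,
    Parseval leaves at most \<open>2 * K\<^sup>2\<close> frequencies above it, and the frequencies
    below it contribute at most \<open>s\<^sup>2 / (2 * K) * (M * s) \<le> s^4 / 2\<close> to the
    fourth moment.\<close>
  define \<Lambda> where "\<Lambda> = {\<xi>\<in>{..<M}. (cmod (F \<xi>))\<^sup>2 \<ge> s\<^sup>2 / (2 * real K)}"
  have fin: "finite \<Lambda>" and sub: "\<Lambda> \<subseteq> {..<M}" by (auto simp: \<Lambda>_def)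
  have "real (card \<Lambda>) * (s\<^sup>2 / (2 * real K)) \<le> (\<Sum>\<xi>\<in>\<Lambda>. (cmod (F \<xi>))\<^sup>2)"
    by (rule order_trans[OF _ sum_bounded_below[of \<Lambda> "s\<^sup>2 / (2 * real K)"]]) (auto simp: \<Lambda>_def)
  also have "\<dots> \<le> (\<Sum>\<xi><M. (cmod (F \<xi>))\<^sup>2)"
    by (rule sum_mono2) (use sub in auto)
  also have "\<dots> \<le> real K * s\<^sup>2" unfolding parseval using MK s by (simp add: power2_eq_square)
  finally have "real (card \<Lambda>) * s\<^sup>2 \<le> 2 * (real K)\<^sup>2 * s\<^sup>2"
    using K0 by (simp add: field_simps power2_eq_square)
  then have "real (card \<Lambda>) \<le> 2 * (real K)\<^sup>2" using s by simp
  also have "\<dots> = real (2 * K\<^sup>2)" by simp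
  finally have card: "card \<Lambda> \<le> 2 * K\<^sup>2" by linarith
  have "\<exists>a\<in>S. \<exists>b\<in>S. \<exists>c\<in>S. \<exists>d\<in>S. int M dvd a + b - c - d - n"
    if n: "\<forall>\<xi>\<in>\<Lambda>. cos (2 * pi * of_int n * real \<xi> / real M) \<ge> 0" for n
  proof (rule ccontr)
    assume neg: "\<not> ?thesis"
    have F4: "of_real ((cmod (F \<xi>))^4) = (\<Sum>a\<in>S. \<Sum>c\<in>S. \<Sum>b\<in>S. \<Sum>d\<in>S. e (a - c + (b - d)) \<xi>)" for \<xi>
    proof -
      have "of_real ((cmod (F \<xi>))^4) = complex_of_real ((cmod (F \<xi>))\<^sup>2) * of_real ((cmod (F \<xi>))\<^sup>2)"
        by (simp flip: of_real_mult power_add)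
      also have "\<dots> = (\<Sum>a\<in>S. \<Sum>c\<in>S. \<Sum>b\<in>S. \<Sum>d\<in>S. e (a - c + (b - d)) \<xi>)"
        unfolding F2 by (simp add: sum_distrib_left sum_distrib_right e_mult)
          (simp add: sum_distrib_left sum_distrib_right e_mult add.commute)
      finally show ?thesis .
    qed
    \<comment> \<open>This sum is \<open>M\<close> times the number of representations of
      \<open>n\<close> modulo \<open>M\<close>, hence zero under the negated claim. Frequency 0
      alone contributes \<open>s^4\<close>, the rest of \<open>\<Lambda>\<close> is nonnegative by
      the choice of \<open>n\<close>, and the small frequencies cannot cancel this.\<close>
    have "(\<Sum>\<xi><M. of_real ((cmod (F \<xi>))^4) * e (- n) \<xi>)
       = (\<Sum>\<xi><M. \<Sum>a\<in>S. \<Sum>c\<in>S. \<Sum>b\<in>S. \<Sum>d\<in>S. e (a - c + (b - d) - n) \<xi>)"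
      unfolding F4 by (simp add: sum_distrib_right e_mult)
    also have "\<dots> = (\<Sum>a\<in>S. \<Sum>\<xi><M. \<Sum>c\<in>S. \<Sum>b\<in>S. \<Sum>d\<in>S. e (a - c + (b - d) - n) \<xi>)"
      by (rule sum.swap)
    also have "\<dots> = (\<Sum>a\<in>S. \<Sum>c\<in>S. \<Sum>\<xi><M. \<Sum>b\<in>S. \<Sum>d\<in>S. e (a - c + (b - d) - n) \<xi>)"
      by (intro sum.cong refl sum.swap)
    also have "\<dots> = (\<Sum>a\<in>S. \<Sum>c\<in>S. \<Sum>b\<in>S. \<Sum>\<xi><M. \<Sum>d\<in>S. e (a - c + (b - d) - n) \<xi>)"
      by (intro sum.cong refl sum.swap)
    also have "\<dots> = (\<Sum>a\<in>S. \<Sum>c\<in>S. \<Sum>b\<in>S. \<Sum>d\<in>S. \<Sum>\<xi><M. e (a - c + (b - d) - n) \<xi>)"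
      by (intro sum.cong refl sum.swap)
    also have "\<dots> = 0"
    proof (rule sum.neutral, rule ballI, rule sum.neutral, rule ballI, rule sum.neutral, rule ballI, rule sum.neutral, rule ballI)
      fix a c b d assume "a \<in> S" "c \<in> S" "b \<in> S" "d \<in> S"
      then have "\<not> int M dvd a + b - c - d - n" using neg by blast
      moreover have "a - c + (b - d) - n = a + b - c - d - n" by simp
      ultimately show "(\<Sum>\<xi><M. e (a - c + (b - d) - n) \<xi>) = 0"
        by (simp only: e_sum if_False)
    qed
    finally have "Re (\<Sum>\<xi><M. of_real ((cmod (F \<xi>))^4) * e (- n) \<xi>) = 0" by simp
    then have zero: "(\<Sum>\<xi><M. (cmod (F \<xi>))^4 * cos (2 * pi * of_int n * real \<xi> / real M)) = 0"
      by (simp add: e_def)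
    have F0: "cmod (F 0) = s" by (simp add: F_def e_def s_def)
    have in0: "0 \<in> \<Lambda>"
    proof -
      have "s\<^sup>2 / (2 * real K) \<le> s\<^sup>2 / 1" using K0 by (intro divide_left_mono) auto
      then show ?thesis using \<open>M > 0\<close> by (simp add: \<Lambda>_def F0)
    qed
    have "s^4 \<le> (\<Sum>\<xi>\<in>\<Lambda>. (cmod (F \<xi>))^4 * cos (2 * pi * of_int n * real \<xi> / real M))"
      using member_le_sum[of 0 \<Lambda> "\<lambda>\<xi>. (cmod (F \<xi>))^4 * cos (2 * pi * of_int n * real \<xi> / real M)"]
        in0 n fin by (simp add: F0)
    moreover have "(\<Sum>\<xi>\<in>{..<M} - \<Lambda>. (cmod (F \<xi>))^4 * cos (2 * pi * of_int n * real \<xi> / real M)) \<ge> - (s^4 / 2)"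
    proof -
      have "(\<Sum>\<xi>\<in>{..<M} - \<Lambda>. (cmod (F \<xi>))^4 * cos (2 * pi * of_int n * real \<xi> / real M))
          \<ge> (\<Sum>\<xi>\<in>{..<M} - \<Lambda>. - (s\<^sup>2 / (2 * real K) * (cmod (F \<xi>))\<^sup>2))"
      proof (rule sum_mono)
        fix \<xi> assume "\<xi> \<in> {..<M} - \<Lambda>"
        then have le: "(cmod (F \<xi>))\<^sup>2 \<le> s\<^sup>2 / (2 * real K)" by (auto simp: \<Lambda>_def)
        have "(cmod (F \<xi>))^4 = (cmod (F \<xi>))\<^sup>2 * (cmod (F \<xi>))\<^sup>2" by (simp flip: power_add)
        also have "\<dots> \<le> s\<^sup>2 / (2 * real K) * (cmod (F \<xi>))\<^sup>2"
          by (rule mult_right_mono[OF le]) simp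
        finally have 1: "(cmod (F \<xi>))^4 \<le> s\<^sup>2 / (2 * real K) * (cmod (F \<xi>))\<^sup>2" .
        have "(cmod (F \<xi>))^4 * cos (2 * pi * of_int n * real \<xi> / real M) \<ge> (cmod (F \<xi>))^4 * (-1)"
          by (rule mult_left_mono) auto
        with 1 show "- (s\<^sup>2 / (2 * real K) * (cmod (F \<xi>))\<^sup>2)
           \<le> (cmod (F \<xi>))^4 * cos (2 * pi * of_int n * real \<xi> / real M)" by linarith
      qed
      moreover have "(\<Sum>\<xi>\<in>{..<M} - \<Lambda>. s\<^sup>2 / (2 * real K) * (cmod (F \<xi>))\<^sup>2) \<le> s^4 / 2"
      proof -
        have "(\<Sum>\<xi>\<in>{..<M} - \<Lambda>. s\<^sup>2 / (2 * real K) * (cmod (F \<xi>))\<^sup>2)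
            \<le> (\<Sum>\<xi><M. s\<^sup>2 / (2 * real K) * (cmod (F \<xi>))\<^sup>2)"
          by (rule sum_mono2) auto
        also have "\<dots> = s\<^sup>2 / (2 * real K) * (real M * s)"
          by (simp only: parseval flip: sum_distrib_left)
        also have "\<dots> \<le> s\<^sup>2 / (2 * real K) * (real K * s * s)"
          using MK s by (intro mult_left_mono mult_right_mono) auto
        also have "\<dots> = s^4 / 2" using K0 by (simp add: power2_eq_square power4_eq_xxxx)
        finally show ?thesis .
      qed
      ultimately show ?thesis by (simp add: sum_negf)
    qed
    moreover have "s^4 > 0" using s by simp
    moreover have "u > 0" if "t \<le> v" "- (t / 2) \<le> w" "0 < t" "u = w + v" for t u v w :: real
      using that by linarith
    ultimately have "(\<Sum>\<xi><M. (cmod (F \<xi>))^4 * cos (2 * pi * of_int n * real \<xi> / real M)) > 0"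
      using sum.subset_diff[OF sub] by blast
    with zero show False by simp
  qed
  with card sub show ?thesis by blast
qed

text \<open>The cyclic version is applied to \<open>S\<close> cut down to a window of length about
  \<open>N\<close>, with a modulus large enough to exclude wrap-around. The number of frequencies is
  bounded in terms of \<open>T\<close> alone, so compactness of a cube yields limit frequencies that
  work for every \<open>n\<close>.\<close>

lemma bogolyubov_int:
  fixes S T :: "int set"
  assumes "finite T" and cover: "\<And>n. \<exists>a\<in>T. n - a \<in> S"
  shows "\<exists>\<Theta>::real set. finite \<Theta> \<and> (\<forall>n::int. (\<forall>\<theta>\<in>\<Theta>. cos (2 * pi * of_int n * \<theta>) > 0) \<longrightarrow>
    (\<exists>a\<in>S. \<exists>b\<in>S. \<exists>c\<in>S. \<exists>d\<in>S. n = a + b - c - d))"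
proof -
  define A where "A = Suc (nat (Max (insert 0 (abs ` T))))"
  have A: "\<bar>a\<bar> \<le> int A" if "a \<in> T" for a
  proof -
    have "\<bar>a\<bar> \<le> Max (insert 0 (abs ` T))" using that \<open>finite T\<close> by (intro Max_ge) auto
    then show ?thesis unfolding A_def by linarith
  qed
  have "T \<noteq> {}" using cover by blast
  \<comment> \<open>With the modulus \<open>M = 3 * N + 6 * A\<close> used below,
    \<open>M \<le> 9 * A * N\<close> because \<open>A\<close> and \<open>N\<close> are at least 1,
    and covering gives \<open>N \<le> card T * card S'\<close>.\<close>
  define K where "K = 9 * A * card T"
  define R where "R = 2 * K\<^sup>2"
  have "\<exists>f::nat \<Rightarrow> real. (\<forall>i. f i \<in> {0..1}) \<and> (\<forall>n::int. \<bar>n\<bar> \<le> int N \<longrightarrow>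
     (\<forall>i<R. cos (2 * pi * of_int n * f i) \<ge> 0) \<longrightarrow>
      (\<exists>a\<in>S. \<exists>b\<in>S. \<exists>c\<in>S. \<exists>d\<in>S. n = a + b - c - d))" if "N \<ge> 1" for N
  proof -
    define S' where "S' = S \<inter> {- int A..<int N + int A}"
    \<comment> \<open>The window \<open>S'\<close> has length \<open>N + 2 * A\<close>, so
      \<open>a + b - c - d\<close> is below twice that in absolute value. A third copy leaves room
      for \<open>n\<close>, and divisibility of \<open>a + b - c - d - n\<close> by \<open>M\<close>
      becomes equality to 0.\<close>
    define M where "M = 3 * (N + 2 * A)"
    have "M > 0" using \<open>N \<ge> 1\<close> by (simp add: M_def)
    have "finite S'" by (simp add: S'_def)
    have sub: "{0..<int N} \<subseteq> (\<Union>a\<in>T. (\<lambda>x. x + a) ` S')"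
    proof
      fix n assume n: "n \<in> {0..<int N}"
      obtain a where a: "a \<in> T" "n - a \<in> S" using cover by blast
      then have "n - a \<in> S'" using A[OF a(1)] n by (auto simp: S'_def)
      then have "n \<in> (\<lambda>x. x + a) ` S'" by (intro image_eqI[of _ _ "n - a"]) auto
      then show "n \<in> (\<Union>a\<in>T. (\<lambda>x. x + a) ` S')" using a(1) by blast
    qed
    have "N = card {0..<int N}" by simp
    also have "\<dots> \<le> card (\<Union>a\<in>T. (\<lambda>x. x + a) ` S')"
      by (rule card_mono[OF _ sub]) (use \<open>finite T\<close> \<open>finite S'\<close> in auto)
    also have "\<dots> \<le> (\<Sum>a\<in>T. card ((\<lambda>x. x + a) ` S'))"
      by (rule card_UN_le[OF \<open>finite T\<close>])
    also have "\<dots> \<le> (\<Sum>a\<in>T. card S')"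
      by (intro sum_mono card_image_le \<open>finite S'\<close>)
    finally have N: "N \<le> card T * card S'" by simp
    have "M \<le> 9 * A * N"
    proof -
      have "A \<ge> 1" by (simp add: A_def)
      then have "3 * N \<le> 3 * (A * N)" "6 * A \<le> 6 * (A * N)" using \<open>N \<ge> 1\<close> by auto
      then have "3 * N + 6 * A \<le> 3 * (A * N) + 6 * (A * N)" by (rule add_mono)
      then show ?thesis unfolding M_def by (simp add: algebra_simps)
    qed
    also have "\<dots> \<le> K * card S'" using N by (simp add: K_def)
    finally have MK: "M \<le> K * card S'" .
    have "S' \<noteq> {}" using N \<open>N \<ge> 1\<close> by auto
    have inj: "inj_on (\<lambda>x. x mod int M) S'"
    proof (rule inj_onI)
      fix x y assume xy: "x \<in> S'" "y \<in> S'" "x mod int M = y mod int M"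
      then have "int M dvd x - y" by (simp add: mod_eq_dvd_iff)
      moreover have "\<bar>x - y\<bar> < int M" using xy by (auto simp: S'_def M_def)
      ultimately show "x = y" using zdvd_not_zless[of "\<bar>x - y\<bar>" "int M"] by (cases "x = y") auto
    qed
    obtain \<Lambda> where \<Lambda>: "\<Lambda> \<subseteq> {..<M}" "card \<Lambda> \<le> R"
      "\<And>n::int. (\<forall>\<xi>\<in>\<Lambda>. cos (2 * pi * of_int n * real \<xi> / real M) \<ge> 0) \<Longrightarrow>
       (\<exists>a\<in>S'. \<exists>b\<in>S'. \<exists>c\<in>S'. \<exists>d\<in>S'. int M dvd a + b - c - d - n)"
      using bogolyubov_cyclic[OF \<open>finite S'\<close> \<open>S' \<noteq> {}\<close> inj \<open>M > 0\<close> MK] unfolding R_def by blast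
    have "finite \<Lambda>" using \<Lambda>(1) finite_subset by blast
    then obtain h where h: "bij_betw h {0..<card \<Lambda>} \<Lambda>" using ex_bij_betw_nat_finite by blast
    \<comment> \<open>Padding with frequency 0 imposes no condition, as its cosine is 1. Every
      \<open>N\<close> thus yields a point of the same cube with the same number \<open>R\<close> of
      constraints.\<close>
    define f where "f i = (if i < card \<Lambda> then real (h i) / real M else 0)" for i
    have hM: "h i < M" if "i < card \<Lambda>" for i
      using h \<Lambda>(1) that by (auto simp: bij_betw_def)
    show ?thesis
    proof (intro exI[of _ f] conjI allI impI)
      fix i show "f i \<in> {0..1}" using hM[of i] \<open>M > 0\<close> by (auto simp: f_def)
    next
      fix n :: int assume n: "\<bar>n\<bar> \<le> int N" and cos: "\<forall>i<R. cos (2 * pi * of_int n * f i) \<ge> 0"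
      have "cos (2 * pi * of_int n * real \<xi> / real M) \<ge> 0" if "\<xi> \<in> \<Lambda>" for \<xi>
      proof -
        obtain i where i: "i < card \<Lambda>" "\<xi> = h i"
          using bij_betw_imp_surj_on[OF h] \<open>\<xi> \<in> \<Lambda>\<close> by (metis atLeastLessThan_iff imageE)
        then show ?thesis using cos[rule_format, of i] \<Lambda>(2) by (simp add: f_def)
      qed
      then obtain a b c d where abcd: "a \<in> S'" "b \<in> S'" "c \<in> S'" "d \<in> S'" "int M dvd a + b - c - d - n"
        using \<Lambda>(3)[of n] by blast
      have "\<bar>a + b - c - d - n\<bar> < int M" using abcd(1-4) n by (auto simp: S'_def M_def)
      then have "a + b - c - d - n = 0"
        using abcd(5) zdvd_not_zless[of "\<bar>a + b - c - d - n\<bar>" "int M"] by (cases "a + b - c - d - n = 0") auto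
      then show "\<exists>a\<in>S. \<exists>b\<in>S. \<exists>c\<in>S. \<exists>d\<in>S. n = a + b - c - d"
        using abcd(1-4) unfolding S'_def by (intro bexI[of _ a] bexI[of _ b] bexI[of _ c] bexI[of _ d]) auto
    qed
  qed
  then have "\<forall>N. \<exists>f::nat \<Rightarrow> real. (\<forall>i. f i \<in> {0..1}) \<and> (\<forall>n::int. \<bar>n\<bar> \<le> int (Suc N) \<longrightarrow>
     (\<forall>i<R. cos (2 * pi * of_int n * f i) \<ge> 0) \<longrightarrow>
      (\<exists>a\<in>S. \<exists>b\<in>S. \<exists>c\<in>S. \<exists>d\<in>S. n = a + b - c - d))" by (metis Suc_le_mono One_nat_def le0)
  then obtain f where f01: "\<And>N i. f N i \<in> {0..1::real}"
    and f: "\<And>N n. \<bar>n\<bar> \<le> int (Suc N) \<Longrightarrow> (\<forall>i<R. cos (2 * pi * of_int n * f N i) \<ge> 0) \<Longrightarrow>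
      (\<exists>a\<in>S. \<exists>b\<in>S. \<exists>c\<in>S. \<exists>d\<in>S. n = a + b - c - d)"
    by metis
  have "compact (PiE UNIV (\<lambda>i::nat. {0..1::real}))" 
    using compactin_PiE[of "\<lambda>_. euclideanreal" UNIV "\<lambda>i::nat. {0..1::real}"]
    by (simp add: euclidean_product_topology)
  then have "seq_compact (PiE UNIV (\<lambda>i::nat. {0..1::real}))" by (rule compact_imp_seq_compact)
  moreover have "\<forall>N. f N \<in> PiE UNIV (\<lambda>i::nat. {0..1::real})" using f01 by auto
  ultimately obtain l r where r: "strict_mono r" and lim: "(f \<circ> r) \<longlonglongrightarrow> l"
    unfolding seq_compact_def by blast
  have lim': "(\<lambda>N. f (r N) i) \<longlonglongrightarrow> l i" for i
    using continuous_on_tendsto_compose[OF continuous_on_product_coordinates[of i] lim] by (simp add: o_def)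
  show ?thesis
  proof (intro exI[of _ "l ` {..<R}"] conjI allI impI)
    \<comment> \<open>A strict inequality at the limit frequencies persists at late approximants,
      which is why the hypothesis here is strict while the cyclic version has a weak one.\<close>
    fix n :: int assume n: "\<forall>\<theta>\<in>l ` {..<R}. cos (2 * pi * of_int n * \<theta>) > 0"
    have "\<forall>\<^sub>F N in sequentially. cos (2 * pi * of_int n * f (r N) i) \<ge> 0" if "i < R" for i
    proof -
      have "(\<lambda>N. cos (2 * pi * of_int n * f (r N) i)) \<longlonglongrightarrow> cos (2 * pi * of_int n * l i)"
        by (intro tendsto_intros lim')
      moreover have "cos (2 * pi * of_int n * l i) > 0" using n that by blast
      ultimately have "\<forall>\<^sub>F N in sequentially. cos (2 * pi * of_int n * f (r N) i) > 0"
        by (rule order_tendstoD(1))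
      then show ?thesis by (rule eventually_mono) simp
    qed
    then have "\<forall>\<^sub>F N in sequentially. \<forall>i\<in>{..<R}. cos (2 * pi * of_int n * f (r N) i) \<ge> 0"
      by (intro eventually_ball_finite) auto
    moreover have "\<forall>\<^sub>F N in sequentially. N \<ge> nat \<bar>n\<bar>" by (rule eventually_ge_at_top)
    ultimately have "\<forall>\<^sub>F N in sequentially. (\<forall>i\<in>{..<R}. cos (2 * pi * of_int n * f (r N) i) \<ge> 0) \<and> N \<ge> nat \<bar>n\<bar>"
      by (rule eventually_conj)
    then obtain N where N: "\<forall>i\<in>{..<R}. cos (2 * pi * of_int n * f (r N) i) \<ge> 0" "N \<ge> nat \<bar>n\<bar>"
      by (metis (no_types, lifting) eventually_sequentially order_refl)
    have "N \<le> r N" using r by (rule seq_suble)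
    with N(2) have "\<bar>n\<bar> \<le> int (Suc (r N))" by linarith
    from f[OF this] N(1) show "\<exists>a\<in>S. \<exists>b\<in>S. \<exists>c\<in>S. \<exists>d\<in>S. n = a + b - c - d" by simp
  qed simp
qed

text \<open>The filter is generated by sets of \<open>n = 1 + q k\<close> for which
  \<open>n b / q\<close> is near an integer for finitely many basis elements
  \<open>b \<noteq> 1\<close>; Kronecker's theorem makes them nonempty. The reals for which the
  limit exists in the required form, also after division by any \<open>q\<close>, form a rational
  subspace containing the basis.\<close>

lemma bohr_filter:
  obtains F :: "int filter" where "F \<noteq> bot"
    and "\<And>q::int. q > 0 \<Longrightarrow> \<forall>\<^sub>F n in F. q dvd n - 1"
    and "\<And>\<theta>::real. \<exists>c::rat. tendsto (\<lambda>n. cis (2 * pi * of_int n * \<theta>)) (cis (2 * pi * of_rat c)) F"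
proof -
  have frac: "a * (t * (x / (q * d))) = t * (a / d * x / q)" for a t x q d :: real
    by (simp add: mult_ac)
  interpret Q: vector_space "\<lambda>(r::rat) (x::real). of_rat r * x"
    by unfold_locales (auto simp: of_rat_add of_rat_mult algebra_simps)
  interpret Z: Modules.module "\<lambda>(r::int) (x::real). of_int r * x"
    by (simp add: Modules.module.intro distrib_left mult.commute)
  define B where "B = Q.extend_basis {1}"
  have ind1: "Q.independent {1}" by (simp add: Q.dependent_single)
  have B: "1 \<in> B" "Q.independent B" "Q.span B = UNIV"
    unfolding B_def using Q.extend_basis_superset[OF ind1] Q.independent_extend_basis[OF ind1] Q.span_extend_basis[OF ind1] by auto
  have ZB: "Z.independent B"
  proof
    assume "Z.dependent B"
    then obtain t u where t: "finite t" "t \<subseteq> B" "(\<Sum>v\<in>t. of_int (u v) * v) = 0" "\<exists>v\<in>t. u v \<noteq> 0"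
      unfolding Z.dependent_explicit by blast
    then have "Q.dependent B" unfolding Q.dependent_explicit
      by (intro exI[of _ t] exI[of _ "\<lambda>v. of_int (u v)"]) auto
    with B(2) show False by simp
  qed
  \<comment> \<open>Approximating \<open>n b / q\<close> instead of \<open>n b\<close> gives control
    over rational multiples of \<open>b\<close> with denominator \<open>q\<close>.\<close>
  define S where "S q Y \<epsilon> = {n::int. q dvd n - 1 \<and> (\<forall>b\<in>Y. \<exists>m::int. \<bar>real_of_int n * b / real_of_int q - real_of_int m\<bar> < \<epsilon>)}"
    for q :: int and Y :: "real set" and \<epsilon> :: real
  have ne: "S q Y \<epsilon> \<noteq> {}" if "q > 0" "finite Y" "Y \<subseteq> B - {1}" "\<epsilon> > 0" for q Y \<epsilon>
  proof -
    obtain h where h: "bij_betw h {0..<card Y} Y" using ex_bij_betw_nat_finite \<open>finite Y\<close> by blast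
    define \<theta> where "\<theta> i = (if i < card Y then h i else 1)" for i
    have im: "\<theta> ` {..card Y} = insert 1 Y"
    proof -
      have "\<theta> ` {..card Y} = insert (\<theta> (card Y)) (\<theta> ` {0..<card Y})"
        by (simp add: atLeast0LessThan lessThan_Suc_atMost[symmetric] lessThan_Suc)
      also have "\<theta> ` {0..<card Y} = h ` {0..<card Y}" by (auto simp: \<theta>_def)
      finally show ?thesis using h by (simp add: bij_betw_def \<theta>_def)
    qed
    have hX: "h i \<in> Y" if "i < card Y" for i using h that by (auto simp: bij_betw_def)
    have "inj_on \<theta> {..card Y}"
    proof (rule inj_onI)
      fix i j assume ij: "i \<in> {..card Y}" "j \<in> {..card Y}" "\<theta> i = \<theta> j"
      have "1 \<notin> Y" using that by auto
      then have "i < card Y \<longleftrightarrow> j < card Y" using ij(3) hX[of i] hX[of j] by (auto simp: \<theta>_def split: if_splits)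
      moreover have "i = j" if "i < card Y" "j < card Y"
        using inj_onD[OF bij_betw_imp_inj_on[OF h], of i j] ij(3) that by (simp add: \<theta>_def)
      moreover have "i = j" if "\<not> i < card Y" "\<not> j < card Y" using ij(1,2) that by simp
      ultimately show "i = j" by blast
    qed
    moreover have "Z.independent (\<theta> ` {..card Y})"
      unfolding im by (rule Z.independent_mono[OF ZB]) (use that B in auto)
    moreover have "\<theta> (card Y) = 1" by (simp add: \<theta>_def)
    \<comment> \<open>For \<open>n = 1 + q k\<close> one has \<open>n b / q = k b + b / q\<close>,
      so \<open>k b\<close> has to approximate \<open>- b / q\<close> modulo 1.\<close>
    ultimately obtain k m where km: "\<And>i. i < card Y \<Longrightarrow> \<bar>of_int k * \<theta> i - of_int (m i) - (- \<theta> i / of_int q)\<bar> < \<epsilon>"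
      using Kronecker_thm_2[of \<theta> "card Y" \<epsilon> "\<lambda>i. - \<theta> i / of_int q"] \<open>\<epsilon> > 0\<close> by (metis (no_types, lifting))
    have "1 + q * k \<in> S q Y \<epsilon>"
      unfolding S_def
    proof (intro CollectI conjI ballI)
      fix b assume "b \<in> Y"
      then obtain i where i: "i < card Y" "b = h i"
        using bij_betw_imp_surj_on[OF h] by (metis atLeastLessThan_iff imageE)
      have "of_int (1 + q * k) * b / of_int q = of_int k * b + b / of_int q"
        using \<open>q > 0\<close> by (simp add: field_simps)
      then show "\<exists>m::int. \<bar>of_int (1 + q * k) * b / of_int q - of_int m\<bar> < \<epsilon>"
        using km[OF i(1)] i by (intro exI[of _ "m i"]) (simp add: \<theta>_def add_diff_eq diff_add_eq)
    qed auto
    then show ?thesis by blast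
  qed
  define J where "J = {(q, Y, \<epsilon>). q > (0::int) \<and> finite Y \<and> Y \<subseteq> B - {1::real} \<and> \<epsilon> > (0::real)}"
  define F where "F = (INF (q, Y, \<epsilon>) \<in> J. principal (S q Y \<epsilon>))"
  have Ine: "J \<noteq> {}" unfolding J_def by (auto intro!: exI[of _ "{}"] exI[of _ "1::int"] exI[of _ "1::real"])
  \<comment> \<open>Passing from \<open>n b / (q1 q2)\<close> to \<open>n b / q1\<close> multiplies
    the distance to the integers by \<open>q2\<close>; dividing the tolerance by
    \<open>q1 q2\<close> absorbs this. This makes the sets a filter base.\<close>
  have mono: "S (q1 * q2) (X1 \<union> X2) (min \<epsilon>1 \<epsilon>2 / of_int (q1 * q2)) \<subseteq> S q1 X1 \<epsilon>1"
    if "q1 > 0" "q2 > 0" "\<epsilon>1 > 0" "\<epsilon>2 > 0" for q1 q2 X1 X2 \<epsilon>1 \<epsilon>2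
  proof
    fix n assume n: "n \<in> S (q1 * q2) (X1 \<union> X2) (min \<epsilon>1 \<epsilon>2 / of_int (q1 * q2))"
    show "n \<in> S q1 X1 \<epsilon>1" unfolding S_def
    proof (intro CollectI conjI ballI)
      show "q1 dvd n - 1" using n by (auto simp: S_def intro: dvd_mult_left)
      fix b assume "b \<in> X1"
      then obtain m :: int where m: "\<bar>of_int n * b / of_int (q1 * q2) - of_int m\<bar> < min \<epsilon>1 \<epsilon>2 / of_int (q1 * q2)"
        using n by (auto simp: S_def)
      have q: "of_int q2 > (0::real)" "of_int q1 \<ge> (1::real)" using that(1,2) by auto
      then have nz: "real_of_int q1 \<noteq> 0" "real_of_int q2 \<noteq> 0" by auto
      have "of_int n * b / of_int q1 - of_int (q2 * m) = of_int q2 * (of_int n * b / of_int (q1 * q2) - of_int m)"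
        using nz by (simp add: right_diff_distrib)
      then have "\<bar>of_int n * b / of_int q1 - of_int (q2 * m)\<bar> = of_int q2 * \<bar>of_int n * b / of_int (q1 * q2) - of_int m\<bar>"
        using q by (simp add: abs_mult)
      also have "\<dots> < of_int q2 * (min \<epsilon>1 \<epsilon>2 / of_int (q1 * q2))"
        using q m by (intro mult_strict_left_mono) auto
      also have "\<dots> = min \<epsilon>1 \<epsilon>2 / of_int q1" using nz by simp
      also have "\<dots> \<le> min \<epsilon>1 \<epsilon>2 / 1" using q(2) that(3,4) by (intro divide_left_mono) auto
      also have "\<dots> \<le> \<epsilon>1" by simp
      finally show "\<exists>m::int. \<bar>of_int n * b / of_int q1 - of_int m\<bar> < \<epsilon>1" by blast
    qed
  qed
  have ev: "eventually P F \<longleftrightarrow> (\<exists>(q, Y, \<epsilon>)\<in>J. \<forall>n\<in>S q Y \<epsilon>. P n)" for P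
  proof -
    have "eventually P F \<longleftrightarrow> (\<exists>i\<in>J. eventually P (case i of (q, Y, \<epsilon>) \<Rightarrow> principal (S q Y \<epsilon>)))"
      unfolding F_def
    proof (rule eventually_INF_base[OF Ine])
      fix i j assume "i \<in> J" "j \<in> J"
      obtain q1 X1 \<epsilon>1 q2 X2 \<epsilon>2 where ij: "i = (q1, X1, \<epsilon>1)" "j = (q2, X2, \<epsilon>2)" by (metis prod.exhaust)
      note pos = \<open>i \<in> J\<close> \<open>j \<in> J\<close>[unfolded ij J_def]
      have "(q1 * q2, X1 \<union> X2, min \<epsilon>1 \<epsilon>2 / of_int (q1 * q2)) \<in> J"
        using \<open>i \<in> J\<close> \<open>j \<in> J\<close> by (auto simp: ij J_def)
      moreover have "S (q1 * q2) (X1 \<union> X2) (min \<epsilon>1 \<epsilon>2 / of_int (q1 * q2)) \<subseteq> S q1 X1 \<epsilon>1"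
        by (rule mono) (use \<open>i \<in> J\<close> \<open>j \<in> J\<close> in \<open>auto simp: ij J_def\<close>)
      moreover have "S (q2 * q1) (X2 \<union> X1) (min \<epsilon>2 \<epsilon>1 / of_int (q2 * q1)) \<subseteq> S q2 X2 \<epsilon>2"
        by (rule mono) (use \<open>i \<in> J\<close> \<open>j \<in> J\<close> in \<open>auto simp: ij J_def\<close>)
      ultimately show "\<exists>x\<in>J. (case x of (q, Y, \<epsilon>) \<Rightarrow> principal (S q Y \<epsilon>))
          \<le> inf (case i of (q, Y, \<epsilon>) \<Rightarrow> principal (S q Y \<epsilon>)) (case j of (q, Y, \<epsilon>) \<Rightarrow> principal (S q Y \<epsilon>))"
        unfolding ij by (intro bexI[of _ "(q1 * q2, X1 \<union> X2, min \<epsilon>1 \<epsilon>2 / of_int (q1 * q2))"])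
          (auto simp: mult.commute Un_commute min.commute)
    qed
    also have "\<dots> \<longleftrightarrow> (\<exists>(q, Y, \<epsilon>)\<in>J. \<forall>n\<in>S q Y \<epsilon>. P n)"
      by (intro bex_cong refl) (auto simp: eventually_principal)
    finally show ?thesis .
  qed
  have F0: "F \<noteq> bot"
  proof
    assume "F = bot"
    then have "eventually (\<lambda>_. False) F" by simp
    then obtain q Y \<epsilon> where "(q, Y, \<epsilon>) \<in> J" "S q Y \<epsilon> = {}" unfolding ev by blast
    then show False using ne[of q Y \<epsilon>] unfolding J_def by blast
  qed
  have F1: "\<forall>\<^sub>F n in F. q dvd n - 1" if "q > 0" for q
    unfolding ev by (intro bexI[of _ "(q, {}, 1)"]) (use that in \<open>auto simp: J_def S_def\<close>)
  \<comment> \<open>Quantifying over the divisor \<open>q\<close> makes the property stable under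
    rational scaling: \<open>(a / d) x / q\<close> is \<open>a\<close> times
    \<open>x / (q d)\<close>, and integer multiples become powers of \<open>cis\<close>.\<close>
  define good where "good \<theta> \<longleftrightarrow> (\<forall>q::int. q > 0 \<longrightarrow> (\<exists>c::rat.
      tendsto (\<lambda>n. cis (2 * pi * of_int n * (\<theta> / of_int q))) (cis (2 * pi * of_rat c)) F))" for \<theta> :: real
  have good1: "good 1" unfolding good_def
  proof (intro allI impI)
    fix q :: int assume "q > 0"
    have "\<forall>\<^sub>F n in F. cis (2 * pi * of_int n * (1 / of_int q)) = cis (2 * pi * of_rat (1 / of_int q))"
      using F1[OF \<open>q > 0\<close>]
    proof (rule eventually_mono)
      fix n assume "q dvd n - 1"
      then obtain k where "n = 1 + q * k" by (metis add.commute diff_add_cancel dvdE)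
      then have n: "of_int n * (1 / of_int q) = 1 / of_int q + real_of_int k"
        using \<open>q > 0\<close> by (simp add: add_divide_distrib)
      have "cis (2 * pi * of_int n * (1 / of_int q)) = cis (2 * pi * (1 / of_int q)) * cis (2 * pi * of_int k)"
        unfolding mult.assoc n by (simp add: cis_mult distrib_left)
      then show "cis (2 * pi * of_int n * (1 / of_int q)) = cis (2 * pi * of_rat (1 / of_int q))"
        by (simp add: of_rat_divide)
    qed
    then show "\<exists>c::rat. tendsto (\<lambda>n. cis (2 * pi * of_int n * (1 / of_int q))) (cis (2 * pi * of_rat c)) F"
      by (intro exI tendsto_eventually)
  qed
  have goodb: "good b" if b: "b \<in> B" "b \<noteq> 1" for b unfolding good_def
  proof (intro allI impI exI[of _ 0])
    fix q :: int assume "q > 0"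
    have "tendsto (\<lambda>n. cis (2 * pi * of_int n * (b / of_int q))) (cis 0) F"
    proof (rule tendstoI)
      fix e :: real assume "e > 0"
      have "isCont cis 0"
        using continuous_on_cis[OF continuous_on_id, of UNIV] by (simp add: continuous_on_eq_continuous_at)
      then obtain d where d: "d > 0" "\<And>x. \<bar>x\<bar> < d \<Longrightarrow> dist (cis x) (cis 0) < e"
        using \<open>e > 0\<close> unfolding continuous_at_eps_delta by (auto simp: dist_real_def)
      show "\<forall>\<^sub>F n in F. dist (cis (2 * pi * of_int n * (b / of_int q))) (cis 0) < e"
        unfolding ev
      proof (intro bexI[of _ "(q, {b}, d / (2 * pi))"], clarify)
        fix n assume "n \<in> S q {b} (d / (2 * pi))"
        then obtain m :: int where m: "\<bar>of_int n * b / of_int q - of_int m\<bar> < d / (2 * pi)"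
          by (auto simp: S_def)
        define y where "y = 2 * pi * (of_int n * b / of_int q - of_int m)"
        have "\<bar>y\<bar> = \<bar>of_int n * b / of_int q - of_int m\<bar> * (2 * pi)" by (simp add: y_def abs_mult)
        moreover have "\<bar>of_int n * b / of_int q - of_int m\<bar> * (2 * pi) < d"
          using m by (subst (asm) pos_less_divide_eq) auto
        ultimately have "\<bar>y\<bar> < d" by simp
        moreover have "cis (2 * pi * of_int n * (b / of_int q)) = cis (y + 2 * pi * of_int m)"
          by (simp add: y_def right_diff_distrib mult.assoc)
        then have "cis (2 * pi * of_int n * (b / of_int q)) = cis y"
          by (simp only: cis_mult[symmetric]) simp
        ultimately show "dist (cis (2 * pi * of_int n * (b / of_int q))) (cis 0) < e"
          using d(2) by simp
      next
        show "(q, {b}, d / (2 * pi)) \<in> J" using b d \<open>q > 0\<close> by (auto simp: J_def)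
      qed
    qed
    then show "tendsto (\<lambda>n. cis (2 * pi * of_int n * (b / of_int q))) (cis (2 * pi * of_rat 0)) F" by simp
  qed
  have good_add: "good (x + y)" if "good x" "good y" for x y unfolding good_def
  proof (intro allI impI)
    fix q :: int assume "q > 0"
    with that obtain c1 c2 :: rat where
      "tendsto (\<lambda>n. cis (2 * pi * of_int n * (x / of_int q))) (cis (2 * pi * of_rat c1)) F"
      "tendsto (\<lambda>n. cis (2 * pi * of_int n * (y / of_int q))) (cis (2 * pi * of_rat c2)) F"
      unfolding good_def by blast
    from tendsto_mult[OF this]
    have "tendsto (\<lambda>n. cis (2 * pi * of_int n * ((x + y) / of_int q))) (cis (2 * pi * of_rat (c1 + c2))) F"
      by (simp add: cis_mult of_rat_add distrib_left add_divide_distrib)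
    then show "\<exists>c::rat. tendsto (\<lambda>n. cis (2 * pi * of_int n * ((x + y) / of_int q))) (cis (2 * pi * of_rat c)) F" by blast
  qed
  have good_scale: "good (of_rat r * x)" if "good x" for r x unfolding good_def
  proof (intro allI impI)
    fix q :: int assume "q > 0"
    obtain a d where ad: "r = of_int a / of_int d" "d > 0"
      by (metis Fract_of_int_quotient Rat_cases)
    then have "q * d > 0" using \<open>q > 0\<close> by simp
    with that obtain c :: rat where
      c: "tendsto (\<lambda>n. cis (2 * pi * of_int n * (x / of_int (q * d)))) (cis (2 * pi * of_rat c)) F"
      unfolding good_def by blast
    have cisi: "cis t powi a = cis (of_int a * t)" for t by (simp add: cis_power_int)
    have eq1: "of_int a * (2 * pi * of_int n * (x / of_int (q * d))) = 2 * pi * of_int n * (of_rat r * x / of_int q)" for n :: int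
      by (simp only: ad(1) of_rat_divide of_rat_of_int_eq of_int_mult frac)
    have eq2: "of_int a * (2 * pi * of_rat c) = 2 * pi * of_rat (of_int a * c)" by (simp add: of_rat_mult)
    have "tendsto (\<lambda>n. cis (2 * pi * of_int n * (x / of_int (q * d))) powi a) (cis (2 * pi * of_rat c) powi a) F"
      by (intro tendsto_power_int c) simp
    then have "tendsto (\<lambda>n. cis (2 * pi * of_int n * (of_rat r * x / of_int q))) (cis (2 * pi * of_rat (of_int a * c))) F"
      unfolding cisi eq1 eq2 .
    then show "\<exists>c::rat. tendsto (\<lambda>n. cis (2 * pi * of_int n * (of_rat r * x / of_int q))) (cis (2 * pi * of_rat c)) F" by blast
  qed
  have good0: "good 0" using good_scale[OF good1, of 0] by simp
  have all_good: "good \<theta>" for \<theta>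
  proof -
    have "\<theta> \<in> Q.span B" using B by simp
    then show ?thesis
    proof (induction rule: Q.span_induct_alt)
      case base show ?case by (rule good0)
    next
      case (step c x y)
      then have "good x" using good1 goodb by blast
      then show ?case using step good_add good_scale by blast
    qed
  qed
  have "\<exists>c::rat. tendsto (\<lambda>n. cis (2 * pi * of_int n * \<theta>)) (cis (2 * pi * of_rat c)) F" for \<theta>
    using all_good[of \<theta>, unfolded good_def, rule_format, of 1] by simp
  with F0 F1 show ?thesis by (rule that)
qed

text \<open>The two points of the circle are joined by a chord shorter than 1, whose square is
  \<open>2 - 2 * cos (a - b)\<close>. This turns convergence of characters along the filter into the
  positivity that describes Bohr sets.\<close>

lemma cos_diff_pos:
  assumes "norm (cis a - z) < 1/2" "norm (cis b - z) < 1/2"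
  shows "cos (a - b) > 0"
proof -
  have "norm (cis a - cis b) < 1"
    using norm_triangle_ineq4[of "cis a - z" "cis b - z"] assms by simp
  then have "(norm (cis a - cis b))\<^sup>2 < 1" by (simp add: power_less_one_iff)
  moreover have "(norm (cis a - cis b))\<^sup>2 = 2 - 2 * cos (a - b)"
  proof -
    have "(norm (cis a - cis b))\<^sup>2 = (cos a - cos b)\<^sup>2 + (sin a - sin b)\<^sup>2" by (simp add: cmod_power2)
    also have "\<dots> = ((cos a)\<^sup>2 + (sin a)\<^sup>2) + ((cos b)\<^sup>2 + (sin b)\<^sup>2) - 2 * (cos a * cos b + sin a * sin b)"
      by (simp only: power2_diff) (simp add: algebra_simps)
    finally show ?thesis by (simp add: cos_diff)
  qed
  ultimately show ?thesis by simp
qed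

section \<open>Topological groups and limits of powers\<close>

locale topgroup = group G for G :: "('a, 'b) monoid_scheme" (structure) +
  fixes T :: "'a topology"
  assumes topspace_eq [simp]: "topspace T = carrier G"
    and cont_mult: "continuous_map (prod_topology T T) T (\<lambda>(x, y). x \<otimes> y)"
    and cont_inv: "continuous_map T T (\<lambda>x. inv x)"

lemma topgroup_iff: "topgroup G T \<longleftrightarrow> topological_group G T"
  unfolding topgroup_def topgroup_axioms_def topological_group_def by blast

context topgroup begin

abbreviation cl :: "'a set \<Rightarrow> 'a set" where "cl S \<equiv> T closure_of S"

abbreviation cyc :: "'a \<Rightarrow> 'a set" where "cyc x \<equiv> cl (generate G {x})"

lemma openin_carrier: "openin T U \<Longrightarrow> x \<in> U \<Longrightarrow> x \<in> carrier G"
  using openin_subset by fastforce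

lemma openin_carrier_self [simp]: "openin T (carrier G)"
  using openin_topspace[of T] by simp

lemma continuous_map_mult:
  assumes "continuous_map Y T f" "continuous_map Y T g"
  shows "continuous_map Y T (\<lambda>x. f x \<otimes> g x)"
proof -
  have "continuous_map Y (prod_topology T T) (\<lambda>x. (f x, g x))"
    using assms by (simp add: continuous_map_pairedI)
  from continuous_map_compose[OF this cont_mult] show ?thesis by (simp add: o_def)
qed

lemma continuous_map_inv:
  assumes "continuous_map Y T f"
  shows "continuous_map Y T (\<lambda>x. inv (f x))"
  using continuous_map_compose[OF assms cont_inv] by (simp add: o_def)

lemma continuous_map_nat_pow:
  assumes "continuous_map Y T f"
  shows "continuous_map Y T (\<lambda>x. f x [^] (n::nat))"
  by (induction n) (auto intro: continuous_map_mult assms)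

lemma continuous_map_int_pow:
  assumes "continuous_map Y T f"
  shows "continuous_map Y T (\<lambda>x. f x [^] (n::int))"
  unfolding int_pow_def2 using continuous_map_inv[OF continuous_map_nat_pow[OF assms, of "nat (- n)"]]
    continuous_map_nat_pow[OF assms, of "nat n"] by (cases "n < 0") (simp_all only: if_True if_False)

lemma continuous_map_translate: "a \<in> carrier G \<Longrightarrow> continuous_map T T (\<lambda>x. a \<otimes> x)"
  by (intro continuous_map_mult) auto

lemma openin_translate:
  assumes "openin T U" "a \<in> carrier G"
  shows "openin T {x \<in> carrier G. a \<otimes> x \<in> U}"
  using openin_continuous_map_preimage[OF continuous_map_translate assms(1), of a] assms by simp

lemma closedin_translate:
  assumes "closedin T U" "a \<in> carrier G"
  shows "closedin T {x \<in> carrier G. a \<otimes> x \<in> U}"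
  using closedin_continuous_map_preimage[OF continuous_map_translate assms(1), of a] assms by simp

lemma nbhd_mult:
  assumes "openin T U" "\<one> \<in> U"
  obtains W where "openin T W" "\<one> \<in> W" "\<And>x y. x \<in> W \<Longrightarrow> y \<in> W \<Longrightarrow> x \<otimes> y \<in> U"
proof -
  have "openin (prod_topology T T) {z \<in> topspace (prod_topology T T). (case z of (x, y) \<Rightarrow> x \<otimes> y) \<in> U}"
    by (rule openin_continuous_map_preimage[OF cont_mult assms(1)])
  moreover have "(\<one>, \<one>) \<in> {z \<in> topspace (prod_topology T T). (case z of (x, y) \<Rightarrow> x \<otimes> y) \<in> U}"
    using assms by simp
  ultimately obtain V1 V2 where V: "openin T V1" "openin T V2" "\<one> \<in> V1" "\<one> \<in> V2"
    "V1 \<times> V2 \<subseteq> {z \<in> topspace (prod_topology T T). (case z of (x, y) \<Rightarrow> x \<otimes> y) \<in> U}"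
    unfolding openin_prod_topology_alt by meson
  show ?thesis by (rule that[of "V1 \<inter> V2"]) (use V in auto)
qed

lemma nbhd_inv:
  assumes "openin T U" "\<one> \<in> U"
  shows "openin T {x \<in> carrier G. inv x \<in> U}" "\<one> \<in> {x \<in> carrier G. inv x \<in> U}"
  using openin_continuous_map_preimage[OF cont_inv assms(1)] assms by auto

lemma nbhd_mult_sym:
  assumes "openin T U" "\<one> \<in> U"
  obtains W where "openin T W" "\<one> \<in> W" "\<And>x y. x \<in> W \<Longrightarrow> y \<in> W \<Longrightarrow> x \<otimes> y \<in> U"
    "\<And>x. x \<in> W \<Longrightarrow> inv x \<in> W"
proof -
  obtain V where V: "openin T V" "\<one> \<in> V" "\<And>x y. x \<in> V \<Longrightarrow> y \<in> V \<Longrightarrow> x \<otimes> y \<in> U"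
    using nbhd_mult[OF assms] by blast
  show ?thesis
    by (rule that[of "V \<inter> {x \<in> carrier G. inv x \<in> V}"]) (use V nbhd_inv[OF V(1,2)] in auto)
qed

lemma nbhd_translate:
  assumes "openin T U" "x \<in> U"
  shows "openin T {w \<in> carrier G. x \<otimes> w \<in> U}" "\<one> \<in> {w \<in> carrier G. x \<otimes> w \<in> U}"
  using openin_translate[OF assms(1) openin_carrier[OF assms]] assms openin_carrier[OF assms] by auto

lemma in_closure_of_iff:
  assumes "x \<in> carrier G" "S \<subseteq> carrier G"
  shows "x \<in> cl S \<longleftrightarrow> (\<forall>U. openin T U \<and> \<one> \<in> U \<longrightarrow> (\<exists>u\<in>U. x \<otimes> u \<in> S))"
proof
  assume L: "x \<in> cl S"
  show "\<forall>U. openin T U \<and> \<one> \<in> U \<longrightarrow> (\<exists>u\<in>U. x \<otimes> u \<in> S)"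
  proof (intro allI impI)
    fix U assume U: "openin T U \<and> \<one> \<in> U"
    have "openin T {y \<in> carrier G. inv x \<otimes> y \<in> U}" using openin_translate U assms by simp
    moreover have "x \<in> {y \<in> carrier G. inv x \<otimes> y \<in> U}" using assms U by simp
    ultimately have "\<exists>y. y \<in> S \<and> y \<in> {y \<in> carrier G. inv x \<otimes> y \<in> U}"
      using L[unfolded in_closure_of, THEN conjunct2, rule_format] by metis
    then obtain y where y: "y \<in> S" "y \<in> carrier G" "inv x \<otimes> y \<in> U" by blast
    then have "x \<otimes> (inv x \<otimes> y) = y" using assms by (simp flip: m_assoc)
    with y show "\<exists>u\<in>U. x \<otimes> u \<in> S" by (intro bexI[OF _ y(3)]) (simp only:)
  qed
next
  assume R: "\<forall>U. openin T U \<and> \<one> \<in> U \<longrightarrow> (\<exists>u\<in>U. x \<otimes> u \<in> S)"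
  show "x \<in> cl S" unfolding in_closure_of
  proof (intro conjI allI impI)
    fix V assume "x \<in> V \<and> openin T V"
    then have "\<exists>u\<in>{w \<in> carrier G. x \<otimes> w \<in> V}. x \<otimes> u \<in> S" by (intro R[rule_format] conjI nbhd_translate) auto
    then show "\<exists>y. y \<in> S \<and> y \<in> V" by blast
  qed (use assms in auto)
qed

lemma subgroup_closure_of:
  assumes "subgroup H G"
  shows "subgroup (cl H) G"
proof (rule subgroupI)
  interpret H: subgroup H G by fact
  show sub: "cl H \<subseteq> carrier G" using closure_of_subset_topspace by fastforce
  have Hs: "H \<subseteq> carrier G" by auto
  show "cl H \<noteq> {}" using closure_of_subset[of H T] H.one_closed Hs by (metis empty_iff subset_empty topspace_eq)
  fix a assume a: "a \<in> cl H"
  have "(\<lambda>x. inv x) ` (cl H) \<subseteq> cl ((\<lambda>x. inv x) ` H)"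
    using cont_inv by (rule continuous_map_image_closure_subset)
  also have "(\<lambda>x. inv x) ` H \<subseteq> H" by auto
  finally show "inv a \<in> cl H" using a closure_of_mono by blast
  fix b assume b: "b \<in> cl H"
  have "(\<lambda>(x, y). x \<otimes> y) ` ((prod_topology T T) closure_of (H \<times> H)) \<subseteq> cl ((\<lambda>(x, y). x \<otimes> y) ` (H \<times> H))"
    using cont_mult by (rule continuous_map_image_closure_subset)
  moreover have "(\<lambda>(x, y). x \<otimes> y) ` (H \<times> H) \<subseteq> H" by auto
  ultimately have "(\<lambda>(x, y). x \<otimes> y) ` ((cl H) \<times> (cl H)) \<subseteq> cl H"
    using closure_of_mono[of "(\<lambda>(x, y). x \<otimes> y) ` (H \<times> H)" H T] by (simp add: closure_of_Times)
  then show "a \<otimes> b \<in> cl H" using a b by force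
qed

lemma generate_eq: "x \<in> carrier G \<Longrightarrow> generate G {x} = range (\<lambda>k::int. x [^] k)"
  using generate_pow[of x] by auto

lemma subgroup_generate: "x \<in> carrier G \<Longrightarrow> subgroup (generate G {x}) G"
  by (rule generate_is_subgroup) auto

lemma subgroup_cyc: "x \<in> carrier G \<Longrightarrow> subgroup (cyc x) G"
  by (intro subgroup_closure_of subgroup_generate)

lemma pow_in_cyc: "x \<in> carrier G \<Longrightarrow> x [^] (k::int) \<in> cyc x"
  using closure_of_subset[of "generate G {x}" T] generate_eq[of x] by auto

lemma self_in_cyc: "x \<in> carrier G \<Longrightarrow> x \<in> cyc x"
  using pow_in_cyc[of x 1] by simp

lemma cyc_subset_carrier: "x \<in> carrier G \<Longrightarrow> cyc x \<subseteq> carrier G"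
  using subgroup_cyc subgroup.subset by blast

lemma generate_subset_subgroup: "subgroup H G \<Longrightarrow> x \<in> H \<Longrightarrow> generate G {x} \<subseteq> H"
  using generate_subgroup_incl[of "{x}" H] by simp

lemma cyc_minimal: "subgroup H G \<Longrightarrow> closedin T H \<Longrightarrow> x \<in> H \<Longrightarrow> cyc x \<subseteq> H"
  by (intro closure_of_minimal generate_subset_subgroup)

lemma in_cyc_iff:
  assumes "x \<in> carrier G"
  shows "y \<in> cyc x \<longleftrightarrow> y \<in> carrier G \<and> (\<forall>U. openin T U \<and> \<one> \<in> U \<longrightarrow> (\<exists>u\<in>U. \<exists>k::int. y \<otimes> u = x [^] k))"
proof -
  have "generate G {x} \<subseteq> carrier G" using generate_eq assms by auto
  then show ?thesis using in_closure_of_iff[of y "generate G {x}"] cyc_subset_carrier[OF assms] generate_eq[OF assms]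
    by (auto simp: image_iff)
qed

lemma open_subgroup_closed:
  assumes "subgroup N G" "openin T N"
  shows "closedin T N"
proof -
  interpret N: subgroup N G by fact
  have "cl N \<subseteq> N"
  proof
    fix x assume x: "x \<in> cl N"
    then have xc: "x \<in> carrier G" using closure_of_subset_topspace by fastforce
    then obtain u where "u \<in> N" "x \<otimes> u \<in> N"
      using iffD1[OF in_closure_of_iff[OF xc N.subset] x, rule_format, of N] assms(2) N.one_closed by blast
    then show "x \<in> N" using xc N.m_closed[of "x \<otimes> u" "inv u"] by (simp add: m_assoc)
  qed
  then show ?thesis using N.subset closure_of_subset_eq[of N T] by simp
qed

text \<open>Finitely many translates of \<open>W\<close> by powers of \<open>x\<close> cover the
  compact set \<open>cyc x\<close>. The return times to \<open>W\<close> therefore satisfy the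
  covering hypothesis of \<open>bogolyubov_int\<close>.\<close>

lemma compactin_cyc_syndetic:
  assumes "x \<in> carrier G" "compactin T (cyc x)" "openin T W" "\<one> \<in> W"
  obtains A :: "int set" where "finite A" "\<And>n. \<exists>a\<in>A. x [^] (n - a) \<in> W"
proof -
  define O' where "O' a = {y \<in> carrier G. x [^] (- a) \<otimes> y \<in> W}" for a :: int
  have "cyc x \<subseteq> \<Union> (range O')"
  proof
    fix y assume y: "y \<in> cyc x"
    have yc: "y \<in> carrier G" using subsetD[OF cyc_subset_carrier[OF assms(1)] y] .
    obtain u k where uk: "u \<in> carrier G" "inv u \<in> W" "y \<otimes> u = x [^] (k::int)"
      using iffD1[OF in_cyc_iff[OF assms(1)] y, THEN conjunct2, rule_format, OF conjI[OF nbhd_inv[OF assms(3,4)]]] by blast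
    have "x [^] (- k) \<otimes> y = inv (y \<otimes> u) \<otimes> y" using assms uk by (simp add: int_pow_neg)
    also have "\<dots> = inv u" using uk(1) yc by (simp add: inv_mult_group m_assoc)
    finally have "y \<in> O' k" using uk yc by (simp add: O'_def)
    then show "y \<in> \<Union> (range O')" by blast
  qed
  moreover have "\<And>a. openin T (O' a)" unfolding O'_def using assms openin_translate by simp
  ultimately obtain \<F> where \<F>: "finite \<F>" "\<F> \<subseteq> range O'" "cyc x \<subseteq> \<Union> \<F>"
    using compactinD[OF assms(2), of "range O'"] by blast
  then obtain A where A: "finite A" "\<F> = O' ` A" by (meson finite_subset_image)
  show ?thesis
  proof (rule that[OF A(1)])
    fix n :: int
    have "x [^] n \<in> \<Union> \<F>" using subsetD[OF \<F>(3) pow_in_cyc[OF assms(1)]] .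
    then obtain a where a: "a \<in> A" "x [^] (- a) \<otimes> x [^] n \<in> W" using A by (auto simp: O'_def)
    moreover have "x [^] (n - a) = x [^] (- a) \<otimes> x [^] n" using assms(1) by (simp flip: int_pow_mult)
    ultimately show "\<exists>a\<in>A. x [^] (n - a) \<in> W" by (intro bexI[OF _ a(1)]) (simp only:)
  qed
qed

text \<open>Pigeonhole: two distinct exponents share the same element of the finite set
  \<open>A\<close>, so their difference returns to \<open>N\<close>.\<close>

lemma compactin_cyc_finite_order_mod:
  assumes "x \<in> carrier G" "compactin T (cyc x)" "subgroup N G" "openin T N"
  obtains m :: int where "m > 0" "x [^] m \<in> N"
proof -
  interpret N: subgroup N G by fact
  obtain A :: "int set" where A: "finite A" "\<And>n. \<exists>a\<in>A. x [^] (n - a) \<in> N"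
    using compactin_cyc_syndetic[OF assms(1,2,4) N.one_closed] by blast
  then obtain f where f: "\<And>n. f n \<in> A" "\<And>n. x [^] (n - f n) \<in> N" by metis
  have "\<not> inj_on (\<lambda>n::nat. f (int n)) UNIV"
  proof
    assume "inj_on (\<lambda>n::nat. f (int n)) UNIV"
    moreover have "finite (range (\<lambda>n::nat. f (int n)))" using A(1) f(1) by (auto intro: finite_subset)
    ultimately show False using finite_imageD infinite_UNIV_nat by blast
  qed
  then obtain i j :: nat where ij: "i \<noteq> j" "f (int i) = f (int j)" by (auto simp: inj_on_def)
  have d: "x [^] (int j' - int i') \<in> N" if "f (int i') = f (int j')" for i' j' :: nat
  proof -
    have "x [^] ((int j' - f (int j')) - (int i' - f (int i'))) \<in> N"
      using f(2)[of "int i'"] f(2)[of "int j'"] assms(1) by (simp add: int_pow_diff)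
    then show ?thesis using that by simp
  qed
  show ?thesis
  proof (cases "i < j")
    case True then show ?thesis using that[of "int j - int i"] d[of i j] ij by simp
  next
    case False then show ?thesis using that[of "int i - int j"] d[of j i] ij by simp
  qed
qed

text \<open>Take a symmetric \<open>W\<close> whose fourfold products lie in \<open>U\<close>. By
  \<open>bogolyubov_int\<close> a Bohr set consists of integers \<open>a + b - c - d\<close> with
  all four return times to \<open>W\<close>. Duality theory would obtain the same from finitely many
  characters.\<close>

lemma bohr_neighbourhood:
  assumes "x \<in> carrier G" "compactin T (cyc x)" "openin T U" "\<one> \<in> U"
  obtains \<Theta> :: "real set" where "finite \<Theta>"
    "\<And>n::int. (\<And>\<theta>. \<theta> \<in> \<Theta> \<Longrightarrow> cos (2 * pi * of_int n * \<theta>) > 0) \<Longrightarrow> x [^] n \<in> U"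
proof -
  obtain V where V: "openin T V" "\<one> \<in> V" "\<And>x y. x \<in> V \<Longrightarrow> y \<in> V \<Longrightarrow> x \<otimes> y \<in> U"
    using nbhd_mult[OF assms(3,4)] by blast
  obtain W where W: "openin T W" "\<one> \<in> W" "\<And>x y. x \<in> W \<Longrightarrow> y \<in> W \<Longrightarrow> x \<otimes> y \<in> V"
    "\<And>x. x \<in> W \<Longrightarrow> inv x \<in> W"
    using nbhd_mult_sym[OF V(1,2)] by blast
  obtain A :: "int set" where A: "finite A" "\<And>n. \<exists>a\<in>A. x [^] (n - a) \<in> W"
    using compactin_cyc_syndetic[OF assms(1,2) W(1,2)] by blast
  obtain \<Theta> :: "real set" where \<Theta>: "finite \<Theta>"
    "\<And>n::int. (\<forall>\<theta>\<in>\<Theta>. cos (2 * pi * of_int n * \<theta>) > 0) \<Longrightarrow>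
      \<exists>a\<in>{n. x [^] n \<in> W}. \<exists>b\<in>{n. x [^] n \<in> W}. \<exists>c\<in>{n. x [^] n \<in> W}. \<exists>d\<in>{n. x [^] n \<in> W}. n = a + b - c - d"
    using bogolyubov_int[OF A(1), of "{n. x [^] n \<in> W}"] A(2) by auto
  show ?thesis
  proof (rule that[OF \<Theta>(1)])
    fix n :: int assume "\<And>\<theta>. \<theta> \<in> \<Theta> \<Longrightarrow> cos (2 * pi * of_int n * \<theta>) > 0"
    then obtain a b c d where abcd: "x [^] a \<in> W" "x [^] b \<in> W" "x [^] c \<in> W" "x [^] d \<in> W" "n = a + b - c - d"
      using \<Theta>(2)[of n] by blast
    have "n = (a + b) + (- c + - d)" using abcd by simp
    then have "x [^] n = (x [^] a \<otimes> x [^] b) \<otimes> (inv (x [^] c) \<otimes> inv (x [^] d))"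
      using assms(1) by (simp only: int_pow_mult int_pow_neg)
    then show "x [^] n \<in> U" using V(3) W(3,4) abcd by simp
  qed
qed

text \<open>Compactness gives a cluster point, and \<open>bohr_neighbourhood\<close> makes the
  powers Cauchy along \<open>F\<close>, so they converge to it. The last conclusion is the gain over
  \<open>x\<close>: the characters take values of finite order at \<open>y\<close>, which expresses
  without characters that \<open>y\<close> generates a profinite group.\<close>

lemma bohr_limit:
  fixes F :: "int filter"
  assumes x: "x \<in> carrier G" "compactin T (cyc x)" and F: "F \<noteq> bot"
    and lim: "\<And>\<theta>::real. \<exists>c::rat. tendsto (\<lambda>n. cis (2 * pi * of_int n * \<theta>)) (cis (2 * pi * of_rat c)) F"
  obtains y where "y \<in> cyc x" "limitin T (\<lambda>n. x [^] n) y F"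
    "\<And>U. openin T U \<Longrightarrow> \<one> \<in> U \<Longrightarrow> \<exists>m::int>0. \<forall>j::int. y [^] (m * j) \<in> U"
proof -
  have "\<forall>\<theta>. \<exists>c::rat. tendsto (\<lambda>n. cis (2 * pi * of_int n * \<theta>)) (cis (2 * pi * of_rat c)) F"
    using lim by (rule allI)
  from choice[OF this] obtain c :: "real \<Rightarrow> rat" where
    "\<forall>\<theta>. tendsto (\<lambda>n. cis (2 * pi * of_int n * \<theta>)) (cis (2 * pi * of_rat (c \<theta>))) F"
    by (rule exE)
  then have c: "tendsto (\<lambda>n. cis (2 * pi * of_int n * \<theta>)) (cis (2 * pi * of_rat (c \<theta>))) F" for \<theta>
    by blast
  \<comment> \<open>If every point had a neighbourhood that is eventually avoided, finitely many of
    them would cover \<open>cyc x\<close>, and no power of \<open>x\<close> could lie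
    anywhere.\<close>
  have "\<exists>y\<in>cyc x. \<forall>U. openin T U \<and> y \<in> U \<longrightarrow> (\<exists>\<^sub>F n in F. x [^] n \<in> U)"
  proof (rule ccontr)
    assume "\<not> ?thesis"
    then have "\<forall>y\<in>cyc x. \<exists>U. openin T U \<and> y \<in> U \<and> (\<forall>\<^sub>F n in F. x [^] n \<notin> U)"
      by (simp add: not_frequently)
    then obtain O' where O': "\<forall>y\<in>cyc x. openin T (O' y) \<and> y \<in> O' y \<and> (\<forall>\<^sub>F n in F. x [^] n \<notin> O' y)"
      by (rule bchoice[THEN exE])
    have "\<exists>\<F>. finite \<F> \<and> \<F> \<subseteq> O' ` cyc x \<and> cyc x \<subseteq> \<Union> \<F>"
      by (rule compactinD[OF x(2)]) (use O' in auto)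
    then obtain B where B: "finite B" "B \<subseteq> cyc x" "cyc x \<subseteq> \<Union> (O' ` B)" by (metis finite_subset_image)
    have "\<forall>\<^sub>F n in F. \<forall>b\<in>B. x [^] n \<notin> O' b"
      using B O' by (intro eventually_ball_finite) auto
    moreover have "\<not> (\<forall>b\<in>B. x [^] n \<notin> O' b)" for n :: int using B(3) pow_in_cyc[OF x(1), of n] by blast
    ultimately have "\<forall>\<^sub>F n in F. False" by (simp add: eventually_mono)
    then show False using F by simp
  qed
  then obtain y where y: "y \<in> cyc x" "\<And>U. openin T U \<Longrightarrow> y \<in> U \<Longrightarrow> (\<exists>\<^sub>F n in F. x [^] n \<in> U)" by blast
  have yc: "y \<in> carrier G" using subsetD[OF cyc_subset_carrier[OF x(1)] y(1)] .
  have cauchy: "\<exists>S. (\<forall>\<^sub>F n in F. n \<in> S) \<and> (\<forall>n\<in>S. \<forall>n'\<in>S. x [^] (n - n') \<in> V)"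
    if V: "openin T V" "\<one> \<in> V" for V
  proof -
    obtain \<Theta> :: "real set" where \<Theta>: "finite \<Theta>"
      "\<And>n::int. (\<And>\<theta>. \<theta> \<in> \<Theta> \<Longrightarrow> cos (2 * pi * of_int n * \<theta>) > 0) \<Longrightarrow> x [^] n \<in> V"
      using bohr_neighbourhood[OF x V] by blast
    define z where "z \<theta> = cis (2 * pi * of_rat (c \<theta>))" for \<theta>
    have z: "tendsto (\<lambda>n. cis (2 * pi * of_int n * \<theta>)) (z \<theta>) F" for \<theta>
      using c unfolding z_def by blast
    define S where "S = {n. \<forall>\<theta>\<in>\<Theta>. norm (cis (2 * pi * of_int n * \<theta>) - z \<theta>) < 1/2}"
    have "\<forall>\<^sub>F n in F. n \<in> S" unfolding S_def mem_Collect_eq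
      using \<Theta>(1) tendstoD[OF z, of "1/2"] by (intro eventually_ball_finite) (auto simp: dist_norm)
    moreover have "x [^] (n - n') \<in> V" if "n \<in> S" "n' \<in> S" for n n'
    proof (rule \<Theta>(2))
      fix \<theta> assume "\<theta> \<in> \<Theta>"
      then have "cos (2 * pi * of_int n * \<theta> - 2 * pi * of_int n' * \<theta>) > 0"
        using that by (intro cos_diff_pos[of _ "z \<theta>"]) (auto simp: S_def)
      then show "cos (2 * pi * of_int (n - n') * \<theta>) > 0" by (simp add: algebra_simps)
    qed
    ultimately show ?thesis by blast
  qed
  have limy: "limitin T (\<lambda>n. x [^] n) y F"
    unfolding limitin_def
  proof (intro conjI allI impI)
    show "y \<in> topspace T" using yc by simp
    fix U assume U: "openin T U \<and> y \<in> U"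
    obtain V where V: "openin T V" "\<one> \<in> V" "\<And>a b. a \<in> V \<Longrightarrow> b \<in> V \<Longrightarrow> a \<otimes> b \<in> {w \<in> carrier G. y \<otimes> w \<in> U}"
      using nbhd_mult[OF nbhd_translate[of U y]] U by blast
    obtain S where S: "\<forall>\<^sub>F n in F. n \<in> S" "\<And>n n'. n \<in> S \<Longrightarrow> n' \<in> S \<Longrightarrow> x [^] (n - n') \<in> V"
      using cauchy[OF V(1,2)] by blast
    have "openin T {w \<in> carrier G. inv y \<otimes> w \<in> V}" using openin_translate V yc by simp
    then have "\<exists>\<^sub>F n in F. x [^] n \<in> {w \<in> carrier G. inv y \<otimes> w \<in> V}"
      by (rule y(2)) (use V yc in simp)
    then have "\<exists>\<^sub>F n in F. x [^] n \<in> {w \<in> carrier G. inv y \<otimes> w \<in> V} \<and> n \<in> S"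
      using S(1) by (rule frequently_eventually_frequently)
    from frequently_ex[OF this] obtain n where n: "n \<in> S" "inv y \<otimes> x [^] n \<in> V" by blast
    show "\<forall>\<^sub>F m in F. x [^] m \<in> U" using S(1)
    proof (rule eventually_mono)
      fix m assume "m \<in> S"
      then have "(inv y \<otimes> x [^] n) \<otimes> x [^] (m - n) \<in> {w \<in> carrier G. y \<otimes> w \<in> U}"
        using S(2) n V(3) by blast
      moreover have "(inv y \<otimes> x [^] n) \<otimes> x [^] (m - n) = inv y \<otimes> x [^] m"
        using x yc by (simp add: m_assoc flip: int_pow_mult)
      ultimately have "y \<otimes> (inv y \<otimes> x [^] m) \<in> U" by simp
      then show "x [^] m \<in> U" using x yc by (simp flip: m_assoc)
    qed
  qed
  have "\<exists>m::int>0. \<forall>j::int. y [^] (m * j) \<in> U" if U: "openin T U" "\<one> \<in> U" for U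
  proof -
    obtain V where V: "openin T V" "\<one> \<in> V" "\<And>a b. a \<in> V \<Longrightarrow> b \<in> V \<Longrightarrow> a \<otimes> b \<in> U"
      "\<And>a. a \<in> V \<Longrightarrow> inv a \<in> V"
      using nbhd_mult_sym[OF U] by blast
    obtain \<Theta> :: "real set" where \<Theta>: "finite \<Theta>"
      "\<And>n::int. (\<And>\<theta>. \<theta> \<in> \<Theta> \<Longrightarrow> cos (2 * pi * of_int n * \<theta>) > 0) \<Longrightarrow> x [^] n \<in> V"
      using bohr_neighbourhood[OF x V(1,2)] by blast
    define den where "den \<theta> = snd (quotient_of (c \<theta>))" for \<theta>
    have den: "den \<theta> > 0" "c \<theta> = of_int (fst (quotient_of (c \<theta>))) / of_int (den \<theta>)" for \<theta>
      unfolding den_def by (auto simp: quotient_of_denom_pos' intro!: quotient_of_div[of "c \<theta>", OF prod.collapse[symmetric]])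
    \<comment> \<open>Clearing the denominators of the limits at the finitely many frequencies of
      \<open>\<Theta>\<close> makes the limit of \<open>cis (2 * pi * n * \<theta>)\<close> trivial
      after raising to the power \<open>m * j\<close>. One \<open>m\<close> serves all
      \<open>j\<close>; only the late index \<open>n\<close> used to approximate
      \<open>y [^] (m * j)\<close> depends on \<open>j\<close>.\<close>
    define m where "m = (\<Prod>\<theta>\<in>\<Theta>. den \<theta>)"
    have m0: "m > 0" unfolding m_def using den by (simp add: prod_pos)
    have "y [^] (m * j) \<in> U" for j
    proof -
      have lp: "limitin T (\<lambda>n. (x [^] n) [^] (m * j)) (y [^] (m * j)) F"
        using continuous_map_limit[OF continuous_map_int_pow[OF continuous_map_id] limy] by (simp add: o_def)
      have ev: "\<forall>\<^sub>F n in F. x [^] (n * (m * j)) \<in> V"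
      proof -
        have "\<forall>\<^sub>F n in F. cos (2 * pi * of_int (n * (m * j)) * \<theta>) > 0" if "\<theta> \<in> \<Theta>" for \<theta>
        proof -
          have "den \<theta> dvd m" unfolding m_def using that \<Theta>(1) by (rule dvd_prodI[rotated])
          then obtain l where l: "m = den \<theta> * l" by blast
          have "tendsto (\<lambda>n. cis (2 * pi * of_int n * \<theta>) powi (m * j)) (cis (2 * pi * of_rat (c \<theta>)) powi (m * j)) F"
            by (intro tendsto_power_int c) simp
          also have "cis (2 * pi * of_rat (c \<theta>)) powi (m * j) = cis (2 * pi * of_int (fst (quotient_of (c \<theta>)) * l * j))"
          proof -
            have "real_of_rat (c \<theta>) * of_int (den \<theta>) = of_int (fst (quotient_of (c \<theta>)))"
              using den(1)[of \<theta>] by (subst den(2)) (simp add: of_rat_divide)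
            then have "of_int (m * j) * (2 * pi * of_rat (c \<theta>)) = 2 * pi * of_int (fst (quotient_of (c \<theta>)) * l * j)"
              by (simp add: l mult_ac)
            then show ?thesis by (simp only: cis_power_int)
          qed
          also have "\<dots> = 1" by (rule cis_multiple_2pi) simp
          finally have "tendsto (\<lambda>n. Re (cis (2 * pi * of_int n * \<theta>) powi (m * j))) (Re 1) F" by (rule tendsto_Re)
          then have "\<forall>\<^sub>F n in F. Re (cis (2 * pi * of_int n * \<theta>) powi (m * j)) > 0"
            by (rule order_tendstoD) simp
          then show ?thesis by (simp add: cis_power_int mult_ac)
        qed
        then have "\<forall>\<^sub>F n in F. \<forall>\<theta>\<in>\<Theta>. cos (2 * pi * of_int (n * (m * j)) * \<theta>) > 0"
          using \<Theta>(1) by (intro eventually_ball_finite) auto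
        then show ?thesis by (rule eventually_mono) (use \<Theta>(2) in blast)
      qed
      have "openin T {w \<in> carrier G. inv (y [^] (m * j)) \<otimes> w \<in> V}" using openin_translate V yc by simp
      then have "\<forall>\<^sub>F n in F. (x [^] n) [^] (m * j) \<in> {w \<in> carrier G. inv (y [^] (m * j)) \<otimes> w \<in> V}"
        by (rule lp[unfolded limitin_def, THEN conjunct2, rule_format, OF conjI]) (use V(2) yc in simp)
      then have "\<forall>\<^sub>F n in F. (x [^] n) [^] (m * j) \<in> {w \<in> carrier G. inv (y [^] (m * j)) \<otimes> w \<in> V} \<and> x [^] (n * (m * j)) \<in> V"
        using ev by (rule eventually_conj)
      from eventually_happens'[OF F this]
      obtain n where n: "inv (y [^] (m * j)) \<otimes> (x [^] n) [^] (m * j) \<in> V" "x [^] (n * (m * j)) \<in> V" by blast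
      then have "inv (y [^] (m * j)) \<otimes> x [^] (n * (m * j)) \<in> V" using x(1) by (simp add: int_pow_pow)
      with n(2) have "x [^] (n * (m * j)) \<otimes> inv (inv (y [^] (m * j)) \<otimes> x [^] (n * (m * j))) \<in> U" by (intro V(3,4))
      then show ?thesis using x(1) yc by (simp add: inv_mult_group flip: m_assoc)
    qed
    with m0 show ?thesis by blast
  qed
  with y(1) limy show ?thesis by (rule that)
qed

end

section \<open>Compact open subgroups: van Dantzig's theorem, and passage to subgroups\<close>

context topgroup begin

lemma open_subgroupI:
  assumes "subgroup N G" "openin T W" "\<one> \<in> W" "W \<subseteq> N"
  shows "openin T N"
proof (subst openin_subopen, rule ballI)
  interpret N: subgroup N G by fact
  fix x assume x: "x \<in> N"
  then have xc: "x \<in> carrier G" by simp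
  have "{y \<in> carrier G. inv x \<otimes> y \<in> W} \<subseteq> N"
  proof
    fix y assume y: "y \<in> {y \<in> carrier G. inv x \<otimes> y \<in> W}"
    then have "inv x \<otimes> y \<in> N" using assms(4) by blast
    then have "x \<otimes> (inv x \<otimes> y) \<in> N" by (rule N.m_closed[OF x])
    then show "y \<in> N" using xc y by (simp flip: m_assoc)
  qed
  moreover have "x \<in> {y \<in> carrier G. inv x \<otimes> y \<in> W}" using xc assms(3) by simp
  moreover have "openin T {y \<in> carrier G. inv x \<otimes> y \<in> W}" using openin_translate[OF assms(2)] xc by simp
  ultimately show "\<exists>S. openin T S \<and> x \<in> S \<and> S \<subseteq> N" by (intro exI conjI)
qed

text \<open>In a compact Hausdorff neighbourhood \<open>K\<close> components and quasi-components
  agree, so a set clopen in \<open>K\<close> separates the identity from the compact part of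
  \<open>K\<close> outside \<open>U \<inter> V\<close>. Lying inside the open set \<open>U\<close>,
  that set is open in \<open>T\<close> as well.\<close>

lemma nbhd_compact_open:
  assumes lc: "locally_compact_space T" and H: "Hausdorff_space T" and td: "totally_disconnected_space T"
    and V: "openin T V" "\<one> \<in> V"
  obtains C where "openin T C" "compactin T C" "\<one> \<in> C" "C \<subseteq> V"
proof -
  obtain U K where UK: "openin T U" "compactin T K" "\<one> \<in> U" "U \<subseteq> K"
    using lc unfolding locally_compact_space_def by (metis one_closed topspace_eq)
  define Y where "Y = subtopology T K"
  have K: "K \<subseteq> carrier G" using compactin_subset_topspace[OF UK(2)] by simp
  then have tY: "topspace Y = K" by (simp add: Y_def Int_absorb1)
  have cY: "compact_space Y" unfolding Y_def using UK(2) by (rule compact_space_subtopology)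
  have HY: "Hausdorff_space Y" unfolding Y_def using H by (rule Hausdorff_space_subtopology)
  have oneK: "\<one> \<in> K" using UK by blast
  have "connected_component_of_set Y \<one> \<subseteq> connected_component_of_set T \<one>"
    unfolding connected_component_of_def Y_def connectedin_subtopology by blast
  also have "\<dots> = {\<one>}" using td unfolding totally_disconnected_space_def by simp
  finally have "quasi_component_of_set Y \<one> \<subseteq> {\<one>}"
    using quasi_eq_connected_component_of[of Y \<one>] cY HY by simp
  moreover have "\<one> \<in> quasi_component_of_set Y \<one>" using oneK tY by (simp add: quasi_component_of_refl)
  ultimately have q: "quasi_component_of_set Y \<one> = {\<one>}" by blast
  then have qin: "{\<one>} \<in> quasi_components_of Y" unfolding quasi_components_of_def using oneK tY by (metis imageI)
  have "closedin Y (K - (U \<inter> V))"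
  proof -
    have "openin Y (K \<inter> (U \<inter> V))" unfolding Y_def using UK(1) V(1) by (intro openin_subtopology_Int2) auto
    then have "closedin Y (topspace Y - K \<inter> (U \<inter> V))" by (rule closedin_diff[OF closedin_topspace])
    moreover have "topspace Y - K \<inter> (U \<inter> V) = K - (U \<inter> V)" using tY by blast
    ultimately show ?thesis by simp
  qed
  then have "compactin Y (K - (U \<inter> V))" by (rule closedin_compact_space[OF cY])
  then have "separated_between Y {\<one>} (K - (U \<inter> V))"
    using separated_between_quasi_component_compact[OF qin] UK(3) V(2) by (simp add: disjnt_def)
  then obtain C C' where C: "openin Y C" "openin Y C'" "C \<union> C' = K" "disjnt C C'" "\<one> \<in> C" "K - (U \<inter> V) \<subseteq> C'"
    unfolding separated_between_def tY by blast
  have CUV: "C \<subseteq> U \<inter> V" using C by (auto simp: disjnt_def)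
  obtain C0 where C0: "openin T C0" "C = C0 \<inter> K" using C(1) unfolding Y_def openin_subtopology by blast
  have "C = C0 \<inter> (U \<inter> V)" using C0 CUV UK(4) by blast
  then have "openin T C" using C0(1) UK(1) V(1) by (simp add: openin_Int)
  moreover have "C = topspace Y - C'" using C(3,4) tY by (auto simp: disjnt_def)
  then have "closedin Y C" using C(2) by (simp add: closedin_diff)
  then have "compactin Y C" by (rule closedin_compact_space[OF cY])
  then have "compactin T C" unfolding Y_def compactin_subtopology by blast
  ultimately show ?thesis using that C(5) CUV by blast
qed

text \<open>The subgroup consists of the \<open>x\<close> for which right translation by
  \<open>x\<close> and by its inverse maps \<open>C\<close> into itself. It lies in \<open>C\<close>
  because the identity does, and compactness of \<open>C\<close> makes it open.\<close>

lemma compact_open_stabilizer: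
  assumes C: "openin T C" "compactin T C" "\<one> \<in> C"
  obtains N where "subgroup N G" "openin T N" "compactin T N" "N \<subseteq> C"
proof -
  define N where "N = {x \<in> carrier G. \<forall>c\<in>C. c \<otimes> x \<in> C \<and> c \<otimes> inv x \<in> C}"
  have Cc: "c \<in> carrier G" if "c \<in> C" for c using openin_carrier[OF C(1) that] .
  have sub: "subgroup N G"
  proof (rule subgroupI)
    show "N \<subseteq> carrier G" by (auto simp: N_def)
    have "\<one> \<in> N" using Cc by (simp add: N_def)
    then show "N \<noteq> {}" by blast
    fix a assume a: "a \<in> N"
    then show "inv a \<in> N" by (simp add: N_def)
    fix b assume b: "b \<in> N"
    have ab: "a \<in> carrier G" "b \<in> carrier G" using a b by (auto simp: N_def)
    show "a \<otimes> b \<in> N" unfolding N_def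
    proof (intro CollectI conjI ballI)
      show "a \<otimes> b \<in> carrier G" using ab by simp
      fix c assume c: "c \<in> C"
      have "(c \<otimes> a) \<otimes> b \<in> C" using a b c by (simp add: N_def)
      then show "c \<otimes> (a \<otimes> b) \<in> C" using ab Cc[OF c] by (simp add: m_assoc)
      have "(c \<otimes> inv b) \<otimes> inv a \<in> C" using a b c by (simp add: N_def)
      then show "c \<otimes> inv (a \<otimes> b) \<in> C" using ab Cc[OF c] by (simp add: m_assoc inv_mult_group)
    qed
  qed
  have NC: "N \<subseteq> C"
  proof
    fix x assume "x \<in> N"
    then have "\<one> \<otimes> x \<in> C" "x \<in> carrier G" using C(3) unfolding N_def by blast+
    then show "x \<in> C" by simp
  qed
  \<comment> \<open>Room for two factors is needed: one accounts for replacing \<open>c\<close> by a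
    nearby point of \<open>C\<close>, the other for the translation itself. The same neighbourhood
    then works for all points near \<open>c\<close>.\<close>
  have "\<forall>c\<in>C. \<exists>W. openin T W \<and> \<one> \<in> W \<and> (\<forall>x\<in>W. \<forall>y\<in>W. c \<otimes> (x \<otimes> y) \<in> C)"
  proof
    fix c assume "c \<in> C"
    obtain W where "openin T W" "\<one> \<in> W" "\<And>x y. x \<in> W \<Longrightarrow> y \<in> W \<Longrightarrow> x \<otimes> y \<in> {w \<in> carrier G. c \<otimes> w \<in> C}"
      using nbhd_mult[OF nbhd_translate[OF C(1) \<open>c \<in> C\<close>]] by blast
    then show "\<exists>W. openin T W \<and> \<one> \<in> W \<and> (\<forall>x\<in>W. \<forall>y\<in>W. c \<otimes> (x \<otimes> y) \<in> C)" by blast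
  qed
  from bchoice[OF this] obtain W where
    W: "\<forall>c\<in>C. openin T (W c) \<and> \<one> \<in> W c \<and> (\<forall>x\<in>W c. \<forall>y\<in>W c. c \<otimes> (x \<otimes> y) \<in> C)" by (rule exE)
  define O' where "O' c = {y \<in> carrier G. inv c \<otimes> y \<in> W c}" for c
  have "\<exists>\<F>. finite \<F> \<and> \<F> \<subseteq> O' ` C \<and> C \<subseteq> \<Union> \<F>"
  proof (rule compactinD[OF C(2)])
    fix U assume "U \<in> O' ` C"
    then show "openin T U" unfolding O'_def using W openin_translate Cc by auto
  next
    show "C \<subseteq> \<Union> (O' ` C)"
    proof
      fix c assume "c \<in> C"
      then have "c \<in> O' c" unfolding O'_def using W Cc by simp
      then show "c \<in> \<Union> (O' ` C)" using \<open>c \<in> C\<close> by blast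
    qed
  qed
  then obtain B where B: "finite B" "B \<subseteq> C" "C \<subseteq> \<Union> (O' ` B)" by (metis finite_subset_image)
  define W' where "W' = carrier G \<inter> (\<Inter>b\<in>B. W b)"
  have oW: "openin T W'" unfolding W'_def
  proof (cases "B = {}")
    case True then show "openin T (carrier G \<inter> (\<Inter>b\<in>B. W b))" by simp
  next
    case False
    then have "openin T (\<Inter>b\<in>B. W b)" using B W by (intro openin_Inter) auto
    then show "openin T (carrier G \<inter> (\<Inter>b\<in>B. W b))" by (intro openin_Int) auto
  qed
  have oneW: "\<one> \<in> W'" unfolding W'_def using B W by auto
  have CW: "c \<otimes> w \<in> C" if "c \<in> C" "w \<in> W'" for c w
  proof -
    obtain b where b: "b \<in> B" "c \<in> O' b" using B(3) \<open>c \<in> C\<close> by blast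
    have bc: "b \<in> C" "b \<in> carrier G" using b B Cc by auto
    have wc: "w \<in> carrier G" "w \<in> W b" using \<open>w \<in> W'\<close> b unfolding W'_def by auto
    have "inv b \<otimes> c \<in> W b" using b unfolding O'_def by blast
    then have "b \<otimes> ((inv b \<otimes> c) \<otimes> w) \<in> C" using W bc wc by blast
    moreover have "b \<otimes> ((inv b \<otimes> c) \<otimes> w) = c \<otimes> w" using bc wc Cc[OF \<open>c \<in> C\<close>] by (simp flip: m_assoc)
    ultimately show ?thesis by simp
  qed
  have "openin T N"
  proof (rule open_subgroupI[OF sub])
    show "openin T (W' \<inter> {x \<in> carrier G. inv x \<in> W'})"
      using oW nbhd_inv[OF oW oneW] by (intro openin_Int)
    show "\<one> \<in> W' \<inter> {x \<in> carrier G. inv x \<in> W'}" using oneW nbhd_inv(2)[OF oW oneW] by blast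
    show "W' \<inter> {x \<in> carrier G. inv x \<in> W'} \<subseteq> N" unfolding N_def using CW by blast
  qed
  moreover have "compactin T N"
    using closed_compactin[OF C(2) NC open_subgroup_closed[OF sub \<open>openin T N\<close>]] .
  ultimately show ?thesis using that sub NC by blast
qed

lemma van_Dantzig:
  assumes "locally_compact_space T" "Hausdorff_space T" "totally_disconnected_space T" "openin T V" "\<one> \<in> V"
  obtains N where "subgroup N G" "openin T N" "compactin T N" "N \<subseteq> V"
proof -
  obtain C where C: "openin T C" "compactin T C" "\<one> \<in> C" "C \<subseteq> V"
    using nbhd_compact_open[OF assms] .
  obtain N where N: "subgroup N G" "openin T N" "compactin T N" "N \<subseteq> C"
    using compact_open_stabilizer[OF C(1-3)] .
  with C(4) show ?thesis using that by blast
qed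

lemma topgroup_subgroup:
  assumes "subgroup H G"
  shows "topgroup (G\<lparr>carrier := H\<rparr>) (subtopology T H)"
proof -
  interpret H: subgroup H G by fact
  interpret H': group "G\<lparr>carrier := H\<rparr>" by (rule subgroup_imp_group[OF assms])
  show ?thesis
  proof unfold_locales
    show "topspace (subtopology T H) = carrier (G\<lparr>carrier := H\<rparr>)" using H.subset by (simp add: Int_absorb1)
    have "continuous_map (subtopology (prod_topology T T) (H \<times> H)) T (\<lambda>(x, y). x \<otimes> y)"
      by (rule continuous_map_from_subtopology[OF cont_mult])
    then have "continuous_map (subtopology (prod_topology T T) (H \<times> H)) (subtopology T H) (\<lambda>(x, y). x \<otimes> y)"
      by (rule continuous_map_into_subtopology) auto
    then show "continuous_map (prod_topology (subtopology T H) (subtopology T H)) (subtopology T H)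
        (\<lambda>(x, y). x \<otimes>\<^bsub>G\<lparr>carrier := H\<rparr>\<^esub> y)"
      by (simp add: subtopology_Times)
    have "continuous_map (subtopology T H) T (\<lambda>x. inv x)"
      by (rule continuous_map_from_subtopology[OF cont_inv])
    then have "continuous_map (subtopology T H) (subtopology T H) (\<lambda>x. inv x)"
      by (rule continuous_map_into_subtopology) auto
    then show "continuous_map (subtopology T H) (subtopology T H) (\<lambda>x. inv\<^bsub>G\<lparr>carrier := H\<rparr>\<^esub> x)"
      by (rule continuous_map_eq) (use m_inv_consistent[OF assms] in auto)
  qed
qed

lemma generate_subgroup_eq:
  assumes "subgroup H G" "b \<in> H"
  shows "generate (G\<lparr>carrier := H\<rparr>) {b} = generate G {b}"
  using generate_consistent[of "{b}" H] assms by simp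

lemma int_pow_subgroup_eq:
  assumes "subgroup H G" "b \<in> H"
  shows "b [^]\<^bsub>G\<lparr>carrier := H\<rparr>\<^esub> (k::int) = b [^] k"
  using int_pow_consistent[OF assms] by simp

end

section \<open>Groups with a base of open subgroups\<close>

text \<open>Non-archimedean groups. For \<open>G/A\<close> the base of open subgroups comes from
  total disconnectedness through \<open>na_groupI_td\<close>; for the supplement it is constructed
  by hand, and total disconnectedness is deduced from it.\<close>

locale na_group = topgroup +
  assumes Hausdorff: "Hausdorff_space T"
    and small_subgroups: "\<And>U. openin T U \<Longrightarrow> \<one> \<in> U \<Longrightarrow> \<exists>N. subgroup N G \<and> openin T N \<and> N \<subseteq> U"
begin

abbreviation opensub :: "'a set \<Rightarrow> bool" where "opensub N \<equiv> subgroup N G \<and> openin T N"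

lemma opensub_Int: "opensub N \<Longrightarrow> opensub M \<Longrightarrow> opensub (N \<inter> M)"
  using subgroups_Inter_pair by (auto intro: openin_Int)

lemma eq_one_if_in_all_opensub:
  assumes "x \<in> carrier G" "\<And>N. opensub N \<Longrightarrow> x \<in> N"
  shows "x = \<one>"
proof (rule ccontr)
  assume "x \<noteq> \<one>"
  then obtain U V where UV: "openin T U" "openin T V" "\<one> \<in> U" "x \<in> V" "disjnt U V"
    using Hausdorff assms(1) unfolding Hausdorff_space_def by (metis one_closed topspace_eq)
  then obtain N where "opensub N" "N \<subseteq> U" using small_subgroups by blast
  then show False using assms(2) UV by (auto simp: disjnt_def)
qed

lemma in_closure_iff_opensub:
  assumes "x \<in> carrier G" "S \<subseteq> carrier G"
  shows "x \<in> cl S \<longleftrightarrow> (\<forall>N. opensub N \<longrightarrow> (\<exists>s\<in>S. inv s \<otimes> x \<in> N))"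
proof
  assume L: "x \<in> cl S"
  show "\<forall>N. opensub N \<longrightarrow> (\<exists>s\<in>S. inv s \<otimes> x \<in> N)"
  proof (intro allI impI)
    fix N assume N: "opensub N"
    then interpret N: subgroup N G by simp
    obtain u where u: "u \<in> N" "x \<otimes> u \<in> S"
      using iffD1[OF in_closure_of_iff[OF assms] L, rule_format, of N] N N.one_closed by blast
    have "inv (x \<otimes> u) \<otimes> x = inv u" using assms(1) u(1) by (simp add: inv_mult_group m_assoc)
    then show "\<exists>s\<in>S. inv s \<otimes> x \<in> N" using u by (intro bexI[OF _ u(2)]) simp
  qed
next
  assume R: "\<forall>N. opensub N \<longrightarrow> (\<exists>s\<in>S. inv s \<otimes> x \<in> N)"
  show "x \<in> cl S" unfolding in_closure_of_iff[OF assms]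
  proof (intro allI impI)
    fix U assume "openin T U \<and> \<one> \<in> U"
    then obtain N where N: "opensub N" "N \<subseteq> U" using small_subgroups by blast
    then interpret N: subgroup N G by simp
    obtain s where s: "s \<in> S" "inv s \<otimes> x \<in> N" using R N by blast
    then have sc: "s \<in> carrier G" using assms by blast
    have "inv (inv s \<otimes> x) \<in> U" using N(2) s(2) N.m_inv_closed by blast
    moreover have "x \<otimes> inv (inv s \<otimes> x) = s" using assms(1) sc by (simp add: inv_mult_group flip: m_assoc)
    ultimately show "\<exists>u\<in>U. x \<otimes> u \<in> S" using s(1) by (intro bexI) simp_all
  qed
qed

lemma in_cyc_iff_opensub:
  assumes "x \<in> carrier G"
  shows "y \<in> cyc x \<longleftrightarrow> y \<in> carrier G \<and> (\<forall>N. opensub N \<longrightarrow> (\<exists>k::int. inv (x [^] k) \<otimes> y \<in> N))"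
proof -
  have "generate G {x} \<subseteq> carrier G" using generate_eq assms by auto
  then show ?thesis using in_closure_iff_opensub[of y "generate G {x}"] cyc_subset_carrier[OF assms] generate_eq[OF assms]
    by (auto simp: image_iff)
qed

lemma totally_disconnected: "totally_disconnected_space T"
  unfolding totally_disconnected_space_def
proof (intro ballI equalityI subsetI)
  fix x y assume x: "x \<in> topspace T" and y: "y \<in> connected_component_of_set T x"
  then obtain S where S: "connectedin T S" "x \<in> S" "y \<in> S" unfolding connected_component_of_def by blast
  have Sc: "S \<subseteq> carrier G" using connectedin_subset_topspace[OF S(1)] by simp
  then have xy: "x \<in> carrier G" "y \<in> carrier G" using S by auto
  have "inv x \<otimes> y \<in> N" if N: "opensub N" for N
  proof (rule ccontr)
    assume n: "inv x \<otimes> y \<notin> N"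
    define U where "U = {z \<in> carrier G. inv x \<otimes> z \<in> N}"
    have U: "openin T U" "closedin T U" unfolding U_def
      using N openin_translate closedin_translate open_subgroup_closed xy by auto
    have "\<not> connectedin T S"
      using U S(2,3) n xy N subgroup.one_closed[of N G] connectedin_clopen_cases[OF S(1) U(2,1)]
      by (auto simp: U_def disjnt_def)
    with S show False by simp
  qed
  then have "inv x \<otimes> y = \<one>" using eq_one_if_in_all_opensub xy by simp
  then show "y \<in> {x}" using xy by (metis inv_closed inv_equality inv_inv singleton_iff)
next
  fix x y assume "x \<in> topspace T" "y \<in> {x}"
  then show "y \<in> connected_component_of_set T x" by (simp add: connected_component_of_refl)
qed

end

lemma (in topgroup) na_groupI_td:
  assumes "locally_compact_space T" "Hausdorff_space T" "totally_disconnected_space T"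
  shows "na_group G T"
proof unfold_locales
  fix U assume "openin T U" "\<one> \<in> U"
  then obtain N where "subgroup N G" "openin T N" "N \<subseteq> U" using van_Dantzig[OF assms] by metis
  then show "\<exists>N. subgroup N G \<and> openin T N \<and> N \<subseteq> U" by blast
qed fact

section \<open>Primary elements\<close>

locale na_cgroup = na_group + comm_group G
begin

text \<open>Elementary form of \<open>cyc b\<close> being a pro-p group: the powers with exponents
  \<open>p^k\<close> converge to the identity. It is compatible with subgroups and limits and needs
  no counting of cosets; \<open>primary_component_eq\<close> links it to the primary
  components.\<close>

definition p_elt :: "nat \<Rightarrow> 'a \<Rightarrow> bool" where
  "p_elt p b \<longleftrightarrow> b \<in> carrier G \<and> (\<forall>N. opensub N \<longrightarrow> (\<exists>k::nat. b [^] (int p ^ k) \<in> N))"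

text \<open>Congruence modulo \<open>N\<close>. It allows computing in the quotient by
  \<open>N\<close> with elements of the group itself.\<close>

definition cg :: "'a set \<Rightarrow> 'a \<Rightarrow> 'a \<Rightarrow> bool" where "cg N x y \<longleftrightarrow> inv x \<otimes> y \<in> N"

lemma cg_refl: "subgroup N G \<Longrightarrow> x \<in> carrier G \<Longrightarrow> cg N x x"
  by (simp add: cg_def subgroup.one_closed)

lemma cg_sym:
  assumes "subgroup N G" "x \<in> carrier G" "y \<in> carrier G" "cg N x y"
  shows "cg N y x"
  using subgroup.m_inv_closed[OF assms(1) assms(4)[unfolded cg_def]] assms(2,3)
  by (simp add: cg_def inv_mult_group)

lemma cg_trans:
  assumes "subgroup N G" "x \<in> carrier G" "y \<in> carrier G" "z \<in> carrier G" "cg N x y" "cg N y z"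
  shows "cg N x z"
proof -
  have "(inv x \<otimes> y) \<otimes> (inv y \<otimes> z) \<in> N"
    using subgroup.m_closed[OF assms(1)] assms(5,6) unfolding cg_def by simp
  moreover have "(inv x \<otimes> y) \<otimes> (inv y \<otimes> z) = inv x \<otimes> z"
    using assms(2-4) by (simp add: m_assoc) (simp flip: m_assoc)
  ultimately show ?thesis by (simp add: cg_def)
qed

lemma cg_mult:
  assumes "subgroup N G" "x \<in> carrier G" "y \<in> carrier G" "x' \<in> carrier G" "y' \<in> carrier G" "cg N x y" "cg N x' y'"
  shows "cg N (x \<otimes> x') (y \<otimes> y')"
proof -
  have "(inv x \<otimes> y) \<otimes> (inv x' \<otimes> y') \<in> N"
    using subgroup.m_closed[OF assms(1)] assms(6,7) unfolding cg_def by simp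
  moreover have "(inv x \<otimes> y) \<otimes> (inv x' \<otimes> y') = inv (x \<otimes> x') \<otimes> (y \<otimes> y')"
    using assms(2-5) by (simp add: inv_mult m_ac)
  ultimately show ?thesis by (simp add: cg_def)
qed

lemma cg_pow:
  assumes "subgroup N G" "x \<in> carrier G" "y \<in> carrier G" "cg N x y"
  shows "cg N (x [^] (k::int)) (y [^] k)"
proof -
  have "(inv x \<otimes> y) [^] k \<in> N" using subgroup_int_pow_closed[OF assms(1) assms(4)[unfolded cg_def]] .
  then show ?thesis using assms(2,3) by (simp add: cg_def int_pow_distrib int_pow_inv)
qed

lemma cg_closed:
  assumes "subgroup N G" "x \<in> carrier G" "y \<in> carrier G" "cg N x y" "x \<in> N"
  shows "y \<in> N"
proof -
  have "x \<otimes> (inv x \<otimes> y) \<in> N" using subgroup.m_closed[OF assms(1,5)] assms(4) unfolding cg_def by simp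
  then show ?thesis using assms(2,3) by (simp flip: m_assoc)
qed

lemma cg_mono: "N \<subseteq> M \<Longrightarrow> cg N x y \<Longrightarrow> cg M x y"
  unfolding cg_def by blast

lemma cg_pow_exponents:
  assumes "subgroup N G" "x \<in> carrier G" "x [^] m \<in> N" "(m::int) dvd a - b"
  shows "cg N (x [^] a) (x [^] b)"
proof -
  obtain c where c: "a - b = m * c" using assms(4) by blast
  have "b - a = m * (- c)" using c by simp
  moreover have "(x [^] m) [^] (- c) \<in> N" using subgroup_int_pow_closed[OF assms(1,3)] .
  ultimately have "x [^] (b - a) \<in> N" using assms(2) by (simp only: int_pow_pow)
  moreover have "x [^] (b - a) = inv (x [^] a) \<otimes> x [^] b"
    using assms(2) by (simp add: int_pow_diff m_comm)
  ultimately show ?thesis by (simp add: cg_def)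
qed

lemma in_cyc_iff_cg:
  assumes "x \<in> carrier G"
  shows "y \<in> cyc x \<longleftrightarrow> y \<in> carrier G \<and> (\<forall>N. opensub N \<longrightarrow> (\<exists>k::int. cg N (x [^] k) y))"
  unfolding cg_def by (rule in_cyc_iff_opensub[OF assms])

lemma p_elt_carrier: "p_elt p b \<Longrightarrow> b \<in> carrier G"
  by (simp add: p_elt_def)

lemma p_elt_pow_mono:
  assumes "subgroup N G" "b \<in> carrier G" "b [^] (int p ^ k) \<in> N" "k \<le> j"
  shows "b [^] (int p ^ j) \<in> N"
proof -
  have "(b [^] (int p ^ k)) [^] (int p ^ (j - k)) \<in> N" using subgroup_int_pow_closed[OF assms(1,3)] .
  then show ?thesis using assms(2,4) by (simp add: int_pow_pow flip: power_add)
qed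

lemma p_elt_cyc:
  assumes "p_elt p e" "b \<in> cyc e"
  shows "p_elt p b"
  unfolding p_elt_def
proof (intro conjI allI impI)
  have ec: "e \<in> carrier G" using assms(1) by (rule p_elt_carrier)
  show bc: "b \<in> carrier G" using assms(2) cyc_subset_carrier[OF ec] by blast
  fix N assume N: "opensub N"
  obtain k where k: "e [^] (int p ^ k) \<in> N" using assms(1) N unfolding p_elt_def by blast
  obtain i :: int where i: "cg N (e [^] i) b" using assms(2) N in_cyc_iff_cg[OF ec] by blast
  have "cg N ((e [^] i) [^] (int p ^ k)) (b [^] (int p ^ k))" using cg_pow[OF _ _ bc i] N ec by simp
  moreover have "(e [^] i) [^] (int p ^ k) = (e [^] (int p ^ k)) [^] i" using ec by (simp add: int_pow_pow mult.commute)
  moreover have "(e [^] (int p ^ k)) [^] i \<in> N" using subgroup_int_pow_closed[OF _ k] N by simp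
  ultimately have "b [^] (int p ^ k) \<in> N" using cg_closed[of N] N ec bc by (metis int_pow_closed)
  then show "\<exists>k::nat. b [^] (int p ^ k) \<in> N" by blast
qed

lemma subgroup_p_elts: "subgroup {b. p_elt p b} G"
proof (rule subgroupI)
  show "{b. p_elt p b} \<subseteq> carrier G" by (auto simp: p_elt_def)
  have "p_elt p \<one>" by (auto simp: p_elt_def subgroup.one_closed)
  then show "{b. p_elt p b} \<noteq> {}" by blast
  fix a assume a: "a \<in> {b. p_elt p b}"
  then have ac: "a \<in> carrier G" by (simp add: p_elt_def)
  have "inv a \<in> cyc a" using pow_in_cyc[OF ac, of "-1"] ac by (simp add: int_pow_neg)
  then show "inv a \<in> {b. p_elt p b}" using p_elt_cyc a by blast
  fix b assume b: "b \<in> {b. p_elt p b}"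
  then have bc: "b \<in> carrier G" by (simp add: p_elt_def)
  have "\<exists>k::nat. (a \<otimes> b) [^] (int p ^ k) \<in> N" if N: "opensub N" for N
  proof -
    obtain i j where ij: "a [^] (int p ^ i) \<in> N" "b [^] (int p ^ j) \<in> N"
      using a b N unfolding p_elt_def by blast
    have "a [^] (int p ^ (i + j)) \<in> N" using p_elt_pow_mono[OF _ ac ij(1)] N by simp
    moreover have "b [^] (int p ^ (i + j)) \<in> N" using p_elt_pow_mono[OF _ bc ij(2)] N by simp
    ultimately have "(a \<otimes> b) [^] (int p ^ (i + j)) \<in> N"
      using N ac bc by (simp add: int_pow_distrib subgroup.m_closed)
    then show ?thesis by blast
  qed
  then show "a \<otimes> b \<in> {b. p_elt p b}" using ac bc by (simp add: p_elt_def)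
qed

text \<open>The element \<open>e\<close> is a cluster point of powers of \<open>x\<close> whose
  exponents approximate the idempotent of the profinite integers that is 1 at \<open>p\<close> and 0
  at the other primes. The last conclusion records the trace of this exponent modulo each open
  subgroup.\<close>

lemma p_part_exists:
  assumes x: "x \<in> carrier G" "compactin T (cyc x)" and p: "Factorial_Ring.prime p"
  obtains e where "e \<in> cyc x" "p_elt p e"
    "\<And>N a. opensub N \<Longrightarrow> \<exists>t::int. int p ^ a dvd t - 1 \<and> cg N (x [^] t) e"
proof -
  have "\<exists>t::int. int p ^ k dvd t - 1 \<and> (\<forall>l\<in>{1..k}. coprime l p \<longrightarrow> int l dvd t)" for k :: nat
  proof -
    \<comment> \<open>A multiple of \<open>L\<close> that is 1 modulo \<open>p^k\<close> exists by
      Bezout, as \<open>L\<close> collects only numbers prime to \<open>p\<close>.\<close>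
    define L where "L = (\<Prod>l\<in>{l\<in>{1..k}. coprime l p}. int l)"
    have "coprime L (int p ^ k)"
      unfolding L_def by (intro prod_coprime_left) (simp add: coprime_power_right_iff)
    then obtain u v where uv: "u * L + v * int p ^ k = 1"
      by (metis bezout_int coprime_iff_gcd_eq_1)
    have "int p ^ k dvd u * L - 1"
    proof
      show "u * L - 1 = int p ^ k * (- v)" using uv by (simp add: algebra_simps)
    qed
    moreover have "int l dvd u * L" if "l \<in> {1..k}" "coprime l p" for l
      unfolding L_def by (intro dvd_mult dvd_prodI) (use that in auto)
    ultimately show ?thesis by blast
  qed
  then have "\<forall>k. \<exists>t::int. int p ^ k dvd t - 1 \<and> (\<forall>l\<in>{1..k}. coprime l p \<longrightarrow> int l dvd t)" by blast
  from choice[OF this] obtain t :: "nat \<Rightarrow> int" where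
    t: "\<forall>k. int p ^ k dvd t k - 1 \<and> (\<forall>l\<in>{1..k}. coprime l p \<longrightarrow> int l dvd t k)" by (rule exE)
  define Cs where "Cs k = cl ((\<lambda>j. x [^] t j) ` {k..})" for k
  have sub: "(\<lambda>j. x [^] t j) ` {k..} \<subseteq> carrier G" for k using x(1) by auto
  have "cyc x \<inter> \<Inter> (range Cs) \<noteq> {}"
  proof (rule compactin_fip[THEN iffD1, OF x(2), THEN conjunct2, rule_format], intro conjI ballI allI impI)
    fix C assume "C \<in> range Cs"
    then show "closedin T C" by (auto simp: Cs_def)
  next
    fix \<F> assume "finite \<F> \<and> \<F> \<subseteq> range Cs"
    then obtain B where B: "finite B" "\<F> = Cs ` B" by (metis finite_subset_image)
    define k where "k = Max (insert 0 B)"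
    have "x [^] t k \<in> Cs b" if "b \<in> B" for b
    proof -
      have "b \<le> k" unfolding k_def using B that by simp
      then have "x [^] t k \<in> (\<lambda>j. x [^] t j) ` {b..}" by auto
      then show ?thesis unfolding Cs_def using subsetD[OF closure_of_subset, of _ T] sub[of b] by simp
    qed
    then have "x [^] t k \<in> cyc x \<inter> \<Inter> \<F>" using B pow_in_cyc[OF x(1)] by auto
    then show "cyc x \<inter> \<Inter> \<F> \<noteq> {}" by blast
  qed
  then obtain e where e: "e \<in> cyc x" "\<And>k. e \<in> Cs k" by blast
  have ec: "e \<in> carrier G" using e(1) cyc_subset_carrier[OF x(1)] by blast
  have near: "\<exists>j\<ge>k. cg N (x [^] t j) e" if N: "opensub N" for N k
    using iffD1[OF in_closure_iff_opensub[OF ec sub[of k]] e(2)[of k, unfolded Cs_def], rule_format, OF N]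
    unfolding cg_def by auto
  have c: "\<exists>t::int. int p ^ a dvd t - 1 \<and> cg N (x [^] t) e" if N: "opensub N" for N a
  proof -
    obtain j where j: "j \<ge> a" "cg N (x [^] t j) e" using near[OF N] by blast
    have "int p ^ a dvd t j - 1" using t j(1) by (meson dvd_trans le_imp_power_dvd)
    with j show ?thesis by blast
  qed
  have "p_elt p e" unfolding p_elt_def
  proof (intro conjI allI impI ec)
    fix N assume N: "opensub N"
    obtain m :: int where m: "m > 0" "x [^] m \<in> N" using compactin_cyc_finite_order_mod[OF x] N by blast
    define a where "a = multiplicity (int p) m"
    obtain l where l: "m = int p ^ a * l" "\<not> int p dvd l"
      unfolding a_def using multiplicity_decompose'[of m "int p"] m(1) p by (metis less_irrefl not_prime_unit prime_int_nat_transfer of_nat_0_le_iff nat_int)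
    have l0: "l > 0" using m(1) l(1) p by (metis of_nat_0_le_iff zero_le_power zero_less_mult_pos zero_less_mult_iff linorder_not_less mult_nonneg_nonpos)
    have cop: "coprime (nat l) p"
    proof -
      have "\<not> p dvd nat l" using l(2) l0 by (metis int_dvd_int_iff int_nat_eq less_imp_le)
      then show ?thesis using p by (simp add: prime_imp_coprime coprime_commute)
    qed
    \<comment> \<open>Here \<open>l\<close> is the part prime to \<open>p\<close> of an exponent
      \<open>m\<close> with \<open>x [^] m \<in> N\<close>. From index \<open>l\<close> on, the
      exponents \<open>t j\<close> are divisible by \<open>l\<close>, so only the factor
      \<open>p^a\<close> remains to be supplied.\<close>
    obtain j where j: "j \<ge> nat l" "cg N (x [^] t j) e" using near[OF N] by blast
    have "nat l \<in> {1..j}" using j(1) l0 by simp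
    then have "int (nat l) dvd t j" using t cop by blast
    then have "l dvd t j" using l0 by simp
    then have "m dvd t j * int p ^ a - 0" unfolding l(1) by (simp add: mult.commute)
    from cg_pow_exponents[OF _ x(1) m(2) this] N
    have "cg N (x [^] (t j * int p ^ a)) \<one>" by simp
    then have "x [^] (t j * int p ^ a) \<in> N"
      using N cg_sym[of N "x [^] (t j * int p ^ a)" \<one>] cg_closed[of N \<one> "x [^] (t j * int p ^ a)"] x(1) subgroup.one_closed[of N G] by simp
    moreover have "cg N ((x [^] t j) [^] (int p ^ a)) (e [^] (int p ^ a))" using cg_pow[OF _ _ ec j(2)] N x(1) by simp
    ultimately have "e [^] (int p ^ a) \<in> N"
      using cg_closed[of N "x [^] (t j * int p ^ a)" "e [^] (int p ^ a)"] N x(1) ec by (simp add: int_pow_pow)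
    then show "\<exists>k::nat. e [^] (int p ^ k) \<in> N" by blast
  qed
  with e(1) show ?thesis using c by (rule that)
qed

text \<open>Modulo \<open>N\<close>, write \<open>b\<close> as \<open>d\<close> to the power
  \<open>i\<close> and \<open>e\<close> as \<open>d\<close> to the power \<open>t\<close>. Then
  \<open>e\<close> to the power \<open>i\<close> is \<open>b\<close> to the power \<open>t\<close>,
  which is \<open>b\<close> again because \<open>t\<close> is 1 modulo the p-power order of
  \<open>b\<close>.\<close>

lemma p_elt_in_cyc_p_part:
  assumes d: "d \<in> carrier G" and e: "e \<in> carrier G"
    and c: "\<And>N a. opensub N \<Longrightarrow> \<exists>t::int. int p ^ a dvd t - 1 \<and> cg N (d [^] t) e"
    and b: "b \<in> cyc d" "p_elt p b"
  shows "b \<in> cyc e"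
  unfolding in_cyc_iff_cg[OF e]
proof (intro conjI allI impI)
  show bc: "b \<in> carrier G" using b(2) by (rule p_elt_carrier)
  fix N assume N: "opensub N"
  then have sN: "subgroup N G" by simp
  obtain a where a: "b [^] (int p ^ a) \<in> N" using b(2) N unfolding p_elt_def by blast
  obtain i :: int where i: "cg N (d [^] i) b" using b(1) N in_cyc_iff_cg[OF d] by blast
  obtain t where t: "int p ^ a dvd t - 1" "cg N (d [^] t) e" using c[OF N] by blast
  have "cg N ((d [^] t) [^] i) (e [^] i)" using cg_pow[OF sN _ e t(2)] d by simp
  then have 1: "cg N (e [^] i) (d [^] (t * i))" using cg_sym[OF sN] d e by (simp add: int_pow_pow)
  have "cg N ((d [^] i) [^] t) (b [^] t)" using cg_pow[OF sN _ bc i] d by simp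
  then have 2: "cg N (d [^] (t * i)) (b [^] t)" using d by (simp add: int_pow_pow mult.commute)
  have 3: "cg N (b [^] t) b" using cg_pow_exponents[OF sN bc a t(1)] bc by simp
  have "cg N (e [^] i) b"
    using cg_trans[OF sN _ _ _ 1 cg_trans[OF sN _ _ _ 2 3]] d e bc by simp
  then show "\<exists>k::int. cg N (e [^] k) b" by blast
qed

text \<open>Modulo an open subgroup \<open>x\<close> has some finite order, and \<open>n\<close> is
  eventually 1 modulo it. This keeps the images in the quotient fixed when lifts are replaced by
  limits of their powers.\<close>

lemma limit_powers_self:
  assumes x: "x \<in> carrier G" "compactin T (cyc x)"
    and F: "\<And>q::int. q > 0 \<Longrightarrow> \<forall>\<^sub>F n in F. q dvd n - 1"
  shows "limitin T (\<lambda>n. x [^] (n::int)) x F"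
  unfolding limitin_def
proof (intro conjI allI impI)
  show "x \<in> topspace T" using x by simp
  fix U assume U: "openin T U \<and> x \<in> U"
  obtain N where N: "opensub N" "N \<subseteq> {w \<in> carrier G. x \<otimes> w \<in> U}"
    using small_subgroups[OF nbhd_translate[of U x]] U by blast
  obtain m :: int where m: "m > 0" "x [^] m \<in> N" using compactin_cyc_finite_order_mod[OF x] N by blast
  show "\<forall>\<^sub>F n in F. x [^] n \<in> U" using F[OF m(1)]
  proof (rule eventually_mono)
    fix n assume "m dvd n - 1"
    then obtain c where c: "n = 1 + m * c" by (metis add.commute diff_add_cancel dvdE)
    have "(x [^] m) [^] c \<in> N" using subgroup_int_pow_closed[OF _ m(2)] N by simp
    then have "x \<otimes> (x [^] m) [^] c \<in> U" using N(2) by blast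
    moreover have "x [^] n = x \<otimes> (x [^] m) [^] c" using x(1) c by (simp add: int_pow_mult int_pow_pow)
    ultimately show "x [^] n \<in> U" by simp
  qed
qed

end

context na_cgroup begin

lemma na_cgroup_subgroup:
  assumes "subgroup H G"
  shows "na_cgroup (G\<lparr>carrier := H\<rparr>) (subtopology T H)"
proof -
  interpret H: subgroup H G by fact
  interpret H': topgroup "G\<lparr>carrier := H\<rparr>" "subtopology T H" by (rule topgroup_subgroup[OF assms])
  show ?thesis
  proof (unfold_locales)
    show "Hausdorff_space (subtopology T H)" using Hausdorff by (rule Hausdorff_space_subtopology)
    fix U assume U: "openin (subtopology T H) U" "\<one>\<^bsub>G\<lparr>carrier := H\<rparr>\<^esub> \<in> U"
    then obtain U0 where U0: "openin T U0" "U = U0 \<inter> H" unfolding openin_subtopology by blast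
    then obtain N where N: "opensub N" "N \<subseteq> U0" using small_subgroups[of U0] U by auto
    have "subgroup (N \<inter> H) (G\<lparr>carrier := H\<rparr>)"
      using subgroup_incl[OF subgroups_Inter_pair assms] N assms by blast
    moreover have "openin (subtopology T H) (N \<inter> H)" using N unfolding openin_subtopology by blast
    ultimately show "\<exists>N. subgroup N (G\<lparr>carrier := H\<rparr>) \<and> openin (subtopology T H) N \<and> N \<subseteq> U"
      using N U0 by blast
  next
    show "\<And>x y. x \<in> carrier (G\<lparr>carrier := H\<rparr>) \<Longrightarrow> y \<in> carrier (G\<lparr>carrier := H\<rparr>) \<Longrightarrow>
        x \<otimes>\<^bsub>G\<lparr>carrier := H\<rparr>\<^esub> y = y \<otimes>\<^bsub>G\<lparr>carrier := H\<rparr>\<^esub> x"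
      using m_comm H.subset by auto
  qed
qed

lemma p_elt_subgroup:
  assumes H: "subgroup H G" and b: "b \<in> H"
  shows "na_cgroup.p_elt (G\<lparr>carrier := H\<rparr>) (subtopology T H) p b \<longleftrightarrow> p_elt p b"
proof -
  interpret H: subgroup H G by fact
  interpret H': na_cgroup "G\<lparr>carrier := H\<rparr>" "subtopology T H" by (rule na_cgroup_subgroup[OF H])
  have pw: "b [^]\<^bsub>G\<lparr>carrier := H\<rparr>\<^esub> (k::int) = b [^] k" for k by (rule int_pow_subgroup_eq[OF H b])
  have pH: "b [^] (k::int) \<in> H" for k using subgroup_int_pow_closed[OF H b] .
  have bc: "b \<in> carrier G" using b by simp
  show ?thesis
  proof
    assume L: "H'.p_elt p b"
    show "p_elt p b" unfolding p_elt_def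
    proof (intro conjI allI impI bc)
      fix N assume N: "opensub N"
      have "subgroup (N \<inter> H) (G\<lparr>carrier := H\<rparr>)"
        using subgroup_incl[OF subgroups_Inter_pair H] N H by blast
      moreover have "openin (subtopology T H) (N \<inter> H)" using N unfolding openin_subtopology by blast
      ultimately have "\<exists>k::nat. b [^]\<^bsub>G\<lparr>carrier := H\<rparr>\<^esub> (int p ^ k) \<in> N \<inter> H"
        using L unfolding H'.p_elt_def by blast
      then show "\<exists>k::nat. b [^] (int p ^ k) \<in> N" unfolding pw by blast
    qed
  next
    assume R: "p_elt p b"
    show "H'.p_elt p b" unfolding H'.p_elt_def pw
    proof (intro conjI allI impI)
      show "b \<in> carrier (G\<lparr>carrier := H\<rparr>)" using b by simp
      fix M assume M: "subgroup M (G\<lparr>carrier := H\<rparr>) \<and> openin (subtopology T H) M"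
      then obtain U0 where U0: "openin T U0" "M = U0 \<inter> H" unfolding openin_subtopology by blast
      moreover have "\<one> \<in> M" using M subgroup.one_closed[of M "G\<lparr>carrier := H\<rparr>"] by simp
      ultimately obtain N where N: "opensub N" "N \<subseteq> U0" using small_subgroups[of U0] by blast
      then obtain k :: nat where "b [^] (int p ^ k) \<in> N" using R unfolding p_elt_def by blast
      then show "\<exists>k::nat. b [^] (int p ^ k) \<in> M" using pH N U0 by blast
    qed
  qed
qed

text \<open>Since the powers of \<open>b\<close> are dense, the coset of \<open>b\<close> generates
  the quotient by any open subgroup, and the index is the order of that coset.\<close>

lemma index_prime_power_iff_p_elt:
  assumes b: "b \<in> carrier G" "carrier G = cyc b" and p: "Factorial_Ring.prime p"
  shows "(\<forall>N. N \<lhd> G \<and> openin T N \<longrightarrow> (\<exists>k. card (rcosets N) = p ^ k)) \<longleftrightarrow> p_elt p b"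
proof
  assume L: "\<forall>N. N \<lhd> G \<and> openin T N \<longrightarrow> (\<exists>k. card (rcosets N) = p ^ k)"
  show "p_elt p b" unfolding p_elt_def
  proof (intro conjI allI impI b(1))
    fix N assume N: "opensub N"
    then interpret N: normal N G using normal_iff_subgroup by simp
    obtain k where k: "card (rcosets N) = p ^ k" using L N N.normal_axioms by blast
    interpret M: group "G Mod N" by (rule N.factorgroup_is_group)
    have "order (G Mod N) = p ^ k" using k by (simp add: order_def FactGroup_def)
    moreover have bN: "N #> b \<in> carrier (G Mod N)" using b(1) by (simp add: carrier_FactGroup)
    ultimately have "(N #> b) [^]\<^bsub>G Mod N\<^esub> (p ^ k) = \<one>\<^bsub>G Mod N\<^esub>" using M.pow_order_eq_1[OF bN] by simp
    then have "N #> (b [^] (p ^ k)) = N" using N.FactGroup_pow[OF b(1)] by simp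
    then have "b [^] (p ^ k) \<in> N" using coset_join1[OF _ _ N.is_subgroup] b(1) by simp
    then have "b [^] (int (p ^ k)) \<in> N" by (simp only: int_pow_int)
    then show "\<exists>k::nat. b [^] (int p ^ k) \<in> N" by auto
  qed
next
  assume R: "p_elt p b"
  show "\<forall>N. N \<lhd> G \<and> openin T N \<longrightarrow> (\<exists>k. card (rcosets N) = p ^ k)"
  proof (intro allI impI)
    fix N assume N: "N \<lhd> G \<and> openin T N"
    then interpret N: normal N G by simp
    have Ns: "opensub N" using N N.is_subgroup by simp
    interpret M: group "G Mod N" by (rule N.factorgroup_is_group)
    obtain k where k: "b [^] (int p ^ k) \<in> N" using R Ns unfolding p_elt_def by blast
    have bN: "N #> b \<in> carrier (G Mod N)" using b(1) by (simp add: carrier_FactGroup)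
    have "carrier (G Mod N) \<subseteq> generate (G Mod N) {N #> b}"
    proof
      fix Y assume "Y \<in> carrier (G Mod N)"
      then obtain y where y: "y \<in> carrier G" "Y = N #> y" by (auto simp: carrier_FactGroup)
      then have "y \<in> cyc b" using b(2) by simp
      then obtain i :: int where i: "cg N (b [^] i) y" using Ns in_cyc_iff_cg[OF b(1)] by blast
      have "y \<otimes> inv (b [^] i) \<in> N" using i y(1) b(1) by (simp add: cg_def m_comm)
      then have "N #> (b [^] i) = N #> y"
        using y(1) b(1) N.is_subgroup by (metis int_pow_closed coset_join3 inv_closed coset_mult_inv1 coset_join2 m_closed N.subset)
      then have "Y = (N #> b) [^]\<^bsub>G Mod N\<^esub> i" using y(2) N.FactGroup_int_pow[OF b(1)] by simp
      then show "Y \<in> generate (G Mod N) {N #> b}" using M.generate_pow[OF bN] by blast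
    qed
    then have gen: "carrier (G Mod N) = generate (G Mod N) {N #> b}"
      using M.generate_incl[of "{N #> b}"] bN by blast
    have "(N #> b) [^]\<^bsub>G Mod N\<^esub> (p ^ k) = N #> (b [^] (p ^ k))" using N.FactGroup_pow[OF b(1)] by simp
    also have "b [^] (p ^ k) \<in> N" using k by (metis int_pow_int of_nat_power)
    then have "N #> (b [^] (p ^ k)) = N" using coset_join2[OF _ N.is_subgroup] b(1) by simp
    finally have "M.ord (N #> b) dvd p ^ k" using M.pow_eq_id[OF bN] by simp
    then obtain j where "M.ord (N #> b) = p ^ j" using divides_primepow[OF p] by (metis normalize_nat_def id_apply)
    then have "card (carrier (G Mod N)) = p ^ j" using M.generate_pow_card[OF bN] gen by simp
    then show "\<exists>k. card (rcosets N) = p ^ k" by (auto simp: FactGroup_def)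
  qed
qed

lemma pro_p_cyc_iff:
  assumes b: "b \<in> carrier G" "compactin T (cyc b)" and p: "Factorial_Ring.prime p"
  shows "pro_p_group (G\<lparr>carrier := cyc b\<rparr>) (subtopology T (cyc b)) p \<longleftrightarrow> p_elt p b"
proof -
  have H: "subgroup (cyc b) G" by (rule subgroup_cyc[OF b(1)])
  have bH: "b \<in> cyc b" by (rule self_in_cyc[OF b(1)])
  interpret H': na_cgroup "G\<lparr>carrier := cyc b\<rparr>" "subtopology T (cyc b)" by (rule na_cgroup_subgroup[OF H])
  have gsub: "generate G {b} \<subseteq> cyc b" using generate_subset_subgroup[OF H bH] .
  have "H'.cyc b = cyc b"
    unfolding generate_subgroup_eq[OF H bH] closure_of_subtopology using gsub by (simp add: Int_absorb1)
  then have "carrier (G\<lparr>carrier := cyc b\<rparr>) = H'.cyc b" by simp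
  from H'.index_prime_power_iff_p_elt[OF _ this p] bH
  have "(\<forall>N. N \<lhd> G\<lparr>carrier := cyc b\<rparr> \<and> openin (subtopology T (cyc b)) N \<longrightarrow>
      (\<exists>k. card (rcosets\<^bsub>G\<lparr>carrier := cyc b\<rparr>\<^esub> N) = p ^ k)) \<longleftrightarrow> p_elt p b"
    using p_elt_subgroup[OF H bH] by simp
  moreover have "topological_group (G\<lparr>carrier := cyc b\<rparr>) (subtopology T (cyc b))"
    using H'.topgroup_axioms topgroup_iff by blast
  moreover have "compact_space (subtopology T (cyc b))" using b(2) by (rule compact_space_subtopology)
  ultimately show ?thesis unfolding pro_p_group_def using H'.Hausdorff H'.totally_disconnected by simp
qed

lemma primary_component_eq:
  assumes "\<And>b. b \<in> carrier G \<Longrightarrow> compactin T (cyc b)" and p: "Factorial_Ring.prime p"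
  shows "primary_component G T p = {b. p_elt p b}"
  unfolding primary_component_def using pro_p_cyc_iff[OF _ _ p] assms(1) p_elt_carrier by blast

end

section \<open>Procyclic pro-\<open>p\<close> groups\<close>

lemma topspace_Zp_topology [simp]: "topspace (Zp_topology p) = Zp_carrier p"
  by (simp add: Zp_topology_def)

lemma Hausdorff_Zp_topology: "Hausdorff_space (Zp_topology p)"
  unfolding Zp_topology_def
  by (intro Hausdorff_space_subtopology) (simp add: Hausdorff_space_product_topology Hausdorff_space_discrete_topology)

lemma Zp_carrier_mod:
  assumes "z \<in> Zp_carrier p" "m \<le> n"
  shows "z n mod (int p ^ m) = z m"
  using assms(2)
proof (induction n rule: dec_induct)
  case base
  then show ?case using assms(1) unfolding Zp_carrier_def by simp
next
  case (step n)
  have "z (Suc n) mod (int p ^ n) = z n" using assms(1) unfolding Zp_carrier_def by blast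
  moreover have "int p ^ m dvd int p ^ n" using step by (simp add: le_imp_power_dvd)
  ultimately show ?case using step.IH by (metis mod_mod_cancel)
qed

lemma Zp_one_in: "p > 1 \<Longrightarrow> (\<lambda>n. 1 mod int p ^ n) \<in> Zp_carrier p"
  by (auto simp: Zp_carrier_def mod_mod_cancel)

text \<open>A basic open set restricts finitely many coordinates, and vanishing of the largest of
  them forces the earlier ones to vanish.\<close>

lemma Zp_nbhd_zero:
  assumes "openin (Zp_topology p) V" "(\<lambda>n. 0) \<in> V"
  obtains m where "\<And>z. z \<in> Zp_carrier p \<Longrightarrow> z m = 0 \<Longrightarrow> z \<in> V"
proof -
  obtain V0 where V0: "openin (product_topology (\<lambda>_. discrete_topology UNIV) UNIV) V0" "V = V0 \<inter> Zp_carrier p"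
    using assms(1) unfolding Zp_topology_def openin_subtopology by blast
  then obtain B where B: "(\<lambda>n. 0) \<in> (\<Pi>\<^sub>E i\<in>UNIV. B i)" "finite {i. B i \<noteq> UNIV}" "(\<Pi>\<^sub>E i\<in>UNIV. B i) \<subseteq> V0"
    using product_topology_open_contains_basis[OF V0(1), of "\<lambda>n. 0"] assms(2) by auto
  define m where "m = Max (insert 0 {i. B i \<noteq> UNIV})"
  show ?thesis
  proof (rule that[of m])
    fix z assume z: "z \<in> Zp_carrier p" "z m = 0"
    have "z i \<in> B i" for i
    proof (cases "B i = UNIV")
      case False
      then have "i \<le> m" unfolding m_def using B(2) by simp
      then have "z i = 0" using Zp_carrier_mod[OF z(1), of i m] z(2) by simp
      then show ?thesis using B(1) by auto
    qed simp
    then show "z \<in> V" using B(3) V0(2) z(1) by auto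
  qed
qed

lemma (in topgroup) cyc_pow_image:
  assumes "x \<in> carrier G" "y \<in> cyc x"
  shows "y [^] (k::int) \<in> cyc (x [^] k)"
proof -
  have xk: "x [^] k \<in> carrier G" using assms(1) by simp
  have "(\<lambda>z. z [^] k) ` cyc x \<subseteq> cl ((\<lambda>z. z [^] k) ` generate G {x})"
    using continuous_map_int_pow[OF continuous_map_id] by (intro continuous_map_image_closure_subset) simp
  also have "(\<lambda>z. z [^] k) ` generate G {x} \<subseteq> generate G {x [^] k}"
  proof
    fix z assume "z \<in> (\<lambda>z. z [^] k) ` generate G {x}"
    then obtain j :: int where "z = (x [^] j) [^] k" unfolding generate_eq[OF assms(1)] by blast
    then have "z = (x [^] k) [^] j" using assms(1) by (simp add: int_pow_pow mult.commute)
    then show "z \<in> generate G {x [^] k}" unfolding generate_eq[OF xk] by blast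
  qed
  finally (order_trans[OF _ closure_of_mono]) show ?thesis using assms(2) by blast
qed

context na_cgroup begin

text \<open>This makes the two alternatives uniform: either way the component lies in the closure of
  the powers of one of its elements. In the p-adic case this is the preimage of 1.\<close>

lemma primary_generator:
  assumes p: "Factorial_Ring.prime p"
    and pc: "finite_cyclic_p_group (G\<lparr>carrier := {b. p_elt p b}\<rparr>) p \<or>
      top_group_isomorphic (G\<lparr>carrier := {b. p_elt p b}\<rparr>) (subtopology T {b. p_elt p b}) (Zp p) (Zp_topology p)"
  obtains h where "p_elt p h" "\<And>b. p_elt p b \<Longrightarrow> b \<in> cyc h"
proof -
  define H where "H = {b. p_elt p b}"
  have H: "subgroup H G" unfolding H_def by (rule subgroup_p_elts)
  then interpret H: subgroup H G .
  have Hp: "b \<in> H \<longleftrightarrow> p_elt p b" for b by (simp add: H_def)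
  have p0: "p > 1" using p prime_gt_1_nat by blast
  have "\<exists>h\<in>H. \<forall>b\<in>H. b \<in> cyc h"
  using pc unfolding H_def[symmetric]
  proof
    assume "finite_cyclic_p_group (G\<lparr>carrier := H\<rparr>) p"
    then obtain g where g: "g \<in> H" "H = generate (G\<lparr>carrier := H\<rparr>) {g}"
      unfolding finite_cyclic_p_group_def by auto
    then have "H = generate G {g}" using generate_subgroup_eq[OF H g(1)] by simp
    then have "H \<subseteq> cyc g" using closure_of_subset[of "generate G {g}" T] H.subset by simp
    with g(1) show ?thesis by blast
  next
    assume "top_group_isomorphic (G\<lparr>carrier := H\<rparr>) (subtopology T H) (Zp p) (Zp_topology p)"
    then obtain f where f: "f \<in> iso (G\<lparr>carrier := H\<rparr>) (Zp p)" "homeomorphic_map (subtopology T H) (Zp_topology p) f"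
      unfolding top_group_isomorphic_def by blast
    have fm: "f (x \<otimes> y) = (\<lambda>n. (f x n + f y n) mod (int p ^ n))" if "x \<in> H" "y \<in> H" for x y
      using f(1) that by (simp add: iso_def hom_def Zp_def)
    have fb: "bij_betw f H (Zp_carrier p)" using f(1) by (simp add: iso_def Zp_def)
    have fin: "f x \<in> Zp_carrier p" if "x \<in> H" for x using fb that by (auto simp: bij_betw_def)
    have frange: "0 \<le> f x n" "f x n < int p ^ n" if "x \<in> H" for x n
      using fin[OF that] unfolding Zp_carrier_def by auto
    have f1: "f \<one> n = 0" for n
    proof -
      have "f \<one> n = (f \<one> n + f \<one> n) mod (int p ^ n)" using fun_cong[OF fm[of \<one> \<one>], of n] by simp
      then have "int p ^ n dvd f \<one> n"
        by (metis add_diff_cancel_right' dvd_minus_mod minus_mod_eq_mult_div dvd_triv_left)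
      then show ?thesis using frange[OF H.one_closed, of n] zdvd_not_zless[of "f \<one> n" "int p ^ n"] by (cases "f \<one> n = 0") auto
    qed
    \<comment> \<open>The reduction matters only at \<open>n = 0\<close>, where the modulus is 1 and
      the coordinate has to be 0.\<close>
    obtain h where h: "h \<in> H" "f h = (\<lambda>n. 1 mod int p ^ n)"
      using fb Zp_one_in[OF p0] by (metis (no_types, lifting) bij_betw_def imageE)
    have hc: "h \<in> carrier G" using h by simp
    have hk: "h [^] (k::nat) \<in> H" for k using subgroup_int_pow_closed[OF H h(1), of "int k"] by (simp only: int_pow_int)
    have fh: "f (h [^] (k::nat)) n = int k mod int p ^ n" for k n
    proof (induction k)
      case 0 then show ?case using f1 by simp
    next
      case (Suc k)
      have "f (h [^] Suc k) n = (f (h [^] k) n + f h n) mod int p ^ n" using fm[OF hk h(1)] by simp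
      also have "\<dots> = (int k + 1) mod int p ^ n" unfolding Suc.IH h(2) by (simp add: mod_add_eq)
      finally show ?case by (simp add: add.commute)
    qed
    have "x \<in> cyc h" if x: "x \<in> H" for x
      unfolding in_cyc_iff_cg[OF hc]
    proof (intro conjI allI impI)
      show xc: "x \<in> carrier G" using x by simp
      fix N assume N: "opensub N"
      have "openin (subtopology T H) (N \<inter> H)" using N unfolding openin_subtopology by blast
      then have op: "openin (Zp_topology p) (f ` (N \<inter> H))"
        using homeomorphic_imp_open_map[OF f(2)] unfolding open_map_def by blast
      have "f \<one> = (\<lambda>n. 0)" using f1 by blast
      then have zin: "(\<lambda>n. 0) \<in> f ` (N \<inter> H)" using N subgroup.one_closed[of N G] H.one_closed by (metis IntI imageI)
      obtain m where m: "\<And>z. z \<in> Zp_carrier p \<Longrightarrow> z m = 0 \<Longrightarrow> z \<in> f ` (N \<inter> H)"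
        using Zp_nbhd_zero[OF op zin] by blast
      \<comment> \<open>The natural number \<open>k\<close> agrees with the image of
        \<open>x\<close> in coordinate \<open>m\<close>. Hence the remaining factor \<open>y\<close>
        has coordinate 0 there and falls into \<open>N\<close>.\<close>
      define k where "k = nat (f x m)"
      define y where "y = inv (h [^] k) \<otimes> x"
      have y: "y \<in> H" unfolding y_def using hk x by simp
      have xy: "x = h [^] k \<otimes> y" unfolding y_def using hc xc by (simp flip: m_assoc)
      have "f x m = (f (h [^] k) m + f y m) mod int p ^ m" using fun_cong[OF fm[OF hk y]] xy by metis
      also have "f (h [^] k) m = f x m" unfolding fh k_def using frange[OF x, of m] by simp
      finally have "int p ^ m dvd f y m"
        using frange[OF x, of m] by (metis add_diff_cancel_left' mod_eq_dvd_iff mod_pos_pos_trivial)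
      then have "f y m = 0" using frange[OF y, of m] zdvd_not_zless[of "f y m" "int p ^ m"] by (cases "f y m = 0") auto
      then have "f y \<in> f ` (N \<inter> H)" using m fin[OF y] by blast
      then have "y \<in> N" using bij_betw_imp_inj_on[OF fb] y unfolding inj_on_def by blast
      then have "cg N (h [^] (int k)) x" unfolding cg_def y_def by (simp only: int_pow_int)
      then show "\<exists>k::int. cg N (h [^] k) x" by blast
    qed
    with h(1) show ?thesis by blast
  qed
  then show ?thesis using that Hp by blast
qed

text \<open>If some power \<open>e [^] (p^k)\<close> is trivial, the powers of \<open>e\<close> form
  a finite cyclic p-group, which is closed. Otherwise the closed subgroups \<open>E n\<close> have
  index \<open>p^n\<close> in \<open>cyc e\<close> and trivial intersection, and the classes of an
  element modulo all \<open>E n\<close> are the coordinates of a p-adic integer.\<close>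

lemma cyc_p_elt_cases:
  assumes e: "p_elt p e" "compactin T (cyc e)" and p: "Factorial_Ring.prime p"
  shows "finite_cyclic_p_group (G\<lparr>carrier := cyc e\<rparr>) p \<or>
      top_group_isomorphic (G\<lparr>carrier := cyc e\<rparr>) (subtopology T (cyc e)) (Zp p) (Zp_topology p)"
proof -
  have ec: "e \<in> carrier G" using e(1) by (rule p_elt_carrier)
  have H: "subgroup (cyc e) G" by (rule subgroup_cyc[OF ec])
  have eH: "e \<in> cyc e" by (rule self_in_cyc[OF ec])
  have p0: "p > 1" using p prime_gt_1_nat by blast
  show ?thesis
  proof (cases "\<exists>k::nat. e [^] (int p ^ k) = \<one>")
    case True
    then obtain k where k: "e [^] (int p ^ k) = \<one>" by blast
    then have "e [^] (p ^ k) = \<one>" by (metis int_pow_int of_nat_power)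
    then have dv: "ord e dvd p ^ k" using pow_eq_id[OF ec] by simp
    then obtain j where j: "ord e = p ^ j" using divides_primepow[OF p] by (metis normalize_nat_def id_apply)
    have card: "card (generate G {e}) = p ^ j" using generate_pow_card[OF ec] j by simp
    then have fin: "finite (generate G {e})" using p0 by (metis card.infinite power_not_zero not_one_less_zero)
    have gs: "generate G {e} \<subseteq> carrier G" using subgroup.subset[OF subgroup_generate[OF ec]] .
    have "cyc e = generate G {e}"
      using closure_of_closedin[of T "generate G {e}"] Hausdorff_imp_t1_space[OF Hausdorff] fin gs
      by (simp add: t1_space_closedin_finite)
    moreover have "generate (G\<lparr>carrier := cyc e\<rparr>) {e} = generate G {e}" by (rule generate_subgroup_eq[OF H eH])
    ultimately have "finite_cyclic_p_group (G\<lparr>carrier := cyc e\<rparr>) p"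
      unfolding finite_cyclic_p_group_def using fin card eH by auto
    then show ?thesis ..
  next
    case False
    define E where "E n = cyc (e [^] (int p ^ n))" for n :: nat
    have enc: "e [^] (i::int) \<in> carrier G" for i using ec by simp
    have Es: "subgroup (E n) G" for n unfolding E_def by (rule subgroup_cyc[OF enc])
    have Ecl: "closedin T (E n)" for n unfolding E_def by simp
    have Emono: "E n \<subseteq> E m" if "m \<le> n" for m n
    proof -
      have "e [^] (int p ^ n) = (e [^] (int p ^ m)) [^] (int p ^ (n - m))"
        using that ec by (simp add: int_pow_pow flip: power_add)
      then have "e [^] (int p ^ n) \<in> E m" unfolding E_def using pow_in_cyc[OF enc] by simp
      then show ?thesis unfolding E_def[of n] by (rule cyc_minimal[OF Es Ecl])
    qed
    have Ein: "e [^] i \<in> E n" if dv: "int p ^ n dvd i" for i n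
    proof -
      obtain c where "i = int p ^ n * c" using dv by blast
      then have "e [^] i = (e [^] (int p ^ n)) [^] c" using ec by (simp add: int_pow_pow)
      then show ?thesis unfolding E_def using pow_in_cyc[OF enc] by simp
    qed
    have Esub: "\<exists>n. E n \<subseteq> N" if N: "opensub N" for N
    proof -
      obtain n where "e [^] (int p ^ n) \<in> N" using e(1) N unfolding p_elt_def by blast
      then have "E n \<subseteq> N" unfolding E_def using cyc_minimal[of N] N open_subgroup_closed[of N] by simp
      then show ?thesis by blast
    qed
    have Eone: "z = \<one>" if "\<And>n. z \<in> E n" for z
    proof (rule eq_one_if_in_all_opensub)
      show "z \<in> carrier G" using that[of 0] subgroup.subset[OF Es] by blast
      show "z \<in> N" if "opensub N" for N using Esub[OF that] \<open>\<And>n. z \<in> E n\<close> by blast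
    qed
    \<comment> \<open>Otherwise \<open>y \<in> cyc (y [^] p)\<close> with
      \<open>y = e [^] (p^a)\<close>. Iterating, \<open>y\<close> lies in the closure generated by
      each of its powers with exponent \<open>p^k\<close>, hence in every \<open>E k\<close>, and
      would be trivial.\<close>
    have step: "e [^] (int p ^ a) \<notin> E (Suc a)" for a
    proof
      define y where "y = e [^] (int p ^ a)"
      assume "e [^] (int p ^ a) \<in> E (Suc a)"
      then have y1: "y \<in> cyc (y [^] int p)" unfolding y_def E_def using ec by (simp add: int_pow_pow mult.commute)
      have yc: "y \<in> carrier G" unfolding y_def using ec by simp
      have "y \<in> cyc (y [^] (int p ^ k))" for k
      proof (induction k)
        case 0 then show ?case using self_in_cyc[OF yc] yc by simp
      next
        case (Suc k)
        have "y [^] (int p ^ k) \<in> cyc ((y [^] int p) [^] (int p ^ k))"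
          by (rule cyc_pow_image[OF _ y1]) (use yc in simp)
        then have "y [^] (int p ^ k) \<in> cyc (y [^] (int p ^ Suc k))" using yc by (simp add: int_pow_pow)
        then have "cyc (y [^] (int p ^ k)) \<subseteq> cyc (y [^] (int p ^ Suc k))"
          by (rule cyc_minimal[OF subgroup_cyc[OF int_pow_closed[OF yc]] closedin_closure_of])
        with Suc show ?case by blast
      qed
      moreover have "y [^] (int p ^ k) \<in> E k" for k
        unfolding y_def using ec by (auto simp: int_pow_pow intro!: Ein)
      ultimately have "y \<in> E k" for k using cyc_minimal[OF Es Ecl] by blast
      then have "y = \<one>" by (rule Eone)
      then show False using False unfolding y_def by blast
    qed
    \<comment> \<open>If \<open>p^a\<close> with \<open>a < n\<close> is the exact power of
      \<open>p\<close> in \<open>i\<close>, Bezout combines \<open>e [^] i\<close> with a power in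
      \<open>E (Suc a)\<close> to place \<open>e [^] (p^a)\<close> there, contrary to
      \<open>step\<close>.\<close>
    have Edvd: "int p ^ n dvd i" if i: "e [^] i \<in> E n" for i n
    proof (rule ccontr)
      assume nd: "\<not> int p ^ n dvd i"
      then have i0: "i \<noteq> 0" by auto
      define a where "a = multiplicity (int p) i"
      have "\<not> is_unit (int p)" using p0 by simp
      then obtain u where u: "i = int p ^ a * u" "\<not> int p dvd u"
        unfolding a_def using multiplicity_decompose'[OF i0] by blast
      have "a < n" using nd u(1) by (metis dvd_mult2 le_imp_power_dvd not_less)
      have "coprime u (int p)" using u(2) p by (metis coprime_commute prime_imp_coprime prime_nat_int_transfer)
      then obtain v w where vw: "v * u + w * int p = 1" by (metis bezout_int coprime_iff_gcd_eq_1)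
      have "e [^] i \<in> E (Suc a)" using Emono[of "Suc a" n] \<open>a < n\<close> i by auto
      then have "(e [^] i) [^] v \<in> E (Suc a)" using subgroup_int_pow_closed[OF Es] by simp
      moreover have "e [^] (int p ^ Suc a * w) \<in> E (Suc a)" by (rule Ein) simp
      ultimately have "(e [^] i) [^] v \<otimes> e [^] (int p ^ Suc a * w) \<in> E (Suc a)"
        using subgroup.m_closed[OF Es] by simp
      moreover have "(e [^] i) [^] v \<otimes> e [^] (int p ^ Suc a * w) = e [^] (int p ^ a * (v * u + w * int p))"
        using ec by (simp add: int_pow_pow u(1) algebra_simps flip: int_pow_mult)
      ultimately show False using step[of a] vw by simp
    qed
    \<comment> \<open>The finitely many cosets involved are closed, so a union that contains all
      powers of \<open>e\<close> also contains their closure.\<close>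
    have Eex: "\<exists>i\<in>{0..<int p ^ n}. cg (E n) (e [^] i) x" if x: "x \<in> cyc e" for x n
    proof -
      define Ci where "Ci i = {y \<in> carrier G. inv (e [^] (i::int)) \<otimes> y \<in> E n}" for i
      have Cicl: "closedin T (Ci i)" for i unfolding Ci_def using closedin_translate[OF Ecl] ec by simp
      have "closedin T (\<Union>i\<in>{0..<int p ^ n}. Ci i)" using Cicl by (intro closedin_Union) auto
      moreover have "generate G {e} \<subseteq> (\<Union>i\<in>{0..<int p ^ n}. Ci i)"
      proof
        fix y assume "y \<in> generate G {e}"
        then obtain k :: int where k: "y = e [^] k" using generate_eq[OF ec] by auto
        have "inv (e [^] (k mod int p ^ n)) \<otimes> e [^] k = e [^] (k - k mod int p ^ n)"
          using ec by (simp add: int_pow_diff m_comm)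
        moreover have "e [^] (k - k mod int p ^ n) \<in> E n" by (rule Ein) simp
        ultimately have "y \<in> Ci (k mod int p ^ n)" unfolding Ci_def k using ec by simp
        moreover have "k mod int p ^ n \<in> {0..<int p ^ n}" using p0 by simp
        ultimately show "y \<in> (\<Union>i\<in>{0..<int p ^ n}. Ci i)" by blast
      qed
      ultimately have "cyc e \<subseteq> (\<Union>i\<in>{0..<int p ^ n}. Ci i)" by (intro closure_of_minimal)
      then show ?thesis using x unfolding Ci_def cg_def by blast
    qed
    have Euniq: "int p ^ n dvd i - j" if "x \<in> carrier G" "cg (E n) (e [^] i) x" "cg (E n) (e [^] j) x" for x i j n
    proof -
      have "cg (E n) (e [^] j) (e [^] i)"
        using cg_trans[OF Es enc that(1) enc that(3) cg_sym[OF Es enc that(1,2)]] .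
      moreover have "inv (e [^] j) \<otimes> e [^] i = e [^] (i - j)" using ec by (simp add: int_pow_diff m_comm)
      ultimately show ?thesis unfolding cg_def by (intro Edvd) simp
    qed
    have Hc: "x \<in> carrier G" if "x \<in> cyc e" for x using that cyc_subset_carrier[OF ec] by blast
    define f where "f x n = (THE i. i \<in> {0..<int p ^ n} \<and> cg (E n) (e [^] i) x)" for x and n :: nat
    have funi: "i = j" if "x \<in> carrier G" "i \<in> {0..<int p ^ n}" "j \<in> {0..<int p ^ n}"
       "cg (E n) (e [^] i) x" "cg (E n) (e [^] j) x" for x i j n
    proof -
      have "i mod int p ^ n = j mod int p ^ n" using Euniq[OF that(1,4,5)] by (simp add: mod_eq_dvd_iff)
      then show ?thesis using that(2,3) by simp
    qed
    have f: "f x n \<in> {0..<int p ^ n} \<and> cg (E n) (e [^] f x n) x" if x: "x \<in> cyc e" for x n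
    proof -
      obtain i where i: "i \<in> {0..<int p ^ n} \<and> cg (E n) (e [^] i) x" using Eex[OF x] by blast
      show ?thesis unfolding f_def
        by (rule theI[of _ i]) (use i funi[OF Hc[OF x]] in blast)+
    qed
    have feq: "f x n = i" if "x \<in> cyc e" "i \<in> {0..<int p ^ n}" "cg (E n) (e [^] i) x" for x i n
      using funi[OF Hc[OF that(1)], of "f x n" n i] f[OF that(1)] that by blast
    have feqm: "f x n = i mod int p ^ n" if "x \<in> cyc e" "cg (E n) (e [^] i) x" for x i n
    proof (rule feq[OF that(1)])
      show "i mod int p ^ n \<in> {0..<int p ^ n}" using p0 by simp
      have "inv (e [^] (i mod int p ^ n)) \<otimes> e [^] i = e [^] (i - i mod int p ^ n)"
        using ec by (simp add: int_pow_diff m_comm)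
      moreover have "e [^] (i - i mod int p ^ n) \<in> E n" by (rule Ein) simp
      ultimately have "cg (E n) (e [^] (i mod int p ^ n)) (e [^] i)" unfolding cg_def by simp
      from cg_trans[OF Es enc enc Hc[OF that(1)] this that(2)] show "cg (E n) (e [^] (i mod int p ^ n)) x" .
    qed
    have fZ: "f x \<in> Zp_carrier p" if x: "x \<in> cyc e" for x
      unfolding Zp_carrier_def
    proof (intro CollectI allI conjI)
      fix n
      show "0 \<le> f x n" "f x n < int p ^ n" using f[OF x, of n] by auto
      have "cg (E n) (e [^] f x (Suc n)) x" using f[OF x, of "Suc n"] cg_mono[OF Emono[of n "Suc n"]] by simp
      then show "f x (Suc n) mod int p ^ n = f x n" using feqm[OF x] by simp
    qed
    have fmult: "f (x \<otimes> y) n = (f x n + f y n) mod int p ^ n" if x: "x \<in> cyc e" and y: "y \<in> cyc e" for x y n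
    proof -
      have "cg (E n) (e [^] f x n \<otimes> e [^] f y n) (x \<otimes> y)"
        using cg_mult[OF Es enc Hc[OF x] enc Hc[OF y]] f[OF x] f[OF y] by blast
      then have "cg (E n) (e [^] (f x n + f y n)) (x \<otimes> y)" using ec by (simp add: int_pow_mult)
      then show ?thesis using feqm subgroup.m_closed[OF H x y] by blast
    qed
    have finj: "inj_on f (cyc e)"
    proof (rule inj_onI)
      fix x y assume x: "x \<in> cyc e" and y: "y \<in> cyc e" and eq: "f x = f y"
      have "inv x \<otimes> y \<in> E n" for n
        using cg_trans[OF Es Hc[OF x] enc Hc[OF y] cg_sym[OF Es enc Hc[OF x]], of n "f x n"] f[OF x, of n] f[OF y, of n] eq
        unfolding cg_def by simp
      then have "inv x \<otimes> y = \<one>" by (rule Eone)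
      then show "x = y" using Hc[OF x] Hc[OF y] by (metis inv_closed inv_equality inv_inv)
    qed
    have fsurj: "f ` cyc e = Zp_carrier p"
    proof
      show "f ` cyc e \<subseteq> Zp_carrier p" using fZ by blast
      show "Zp_carrier p \<subseteq> f ` cyc e"
      proof
        fix z assume z: "z \<in> Zp_carrier p"
        define Ci where "Ci n = {y \<in> carrier G. inv (e [^] z n) \<otimes> y \<in> E n}" for n
        have Cicl: "closedin T (Ci n)" for n unfolding Ci_def using closedin_translate[OF Ecl] ec by simp
        have "cyc e \<inter> \<Inter> (range Ci) \<noteq> {}"
        proof (rule compactin_fip[THEN iffD1, OF e(2), THEN conjunct2, rule_format], intro conjI ballI allI impI)
          fix C assume "C \<in> range Ci" then show "closedin T C" using Cicl by auto
        next
          fix \<F> assume "finite \<F> \<and> \<F> \<subseteq> range Ci"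
          then obtain B where B: "finite B" "\<F> = Ci ` B" by (metis finite_subset_image)
          define k where "k = Max (insert 0 B)"
          have "e [^] z k \<in> Ci b" if "b \<in> B" for b
          proof -
            have "b \<le> k" unfolding k_def using B that by simp
            then have "z k mod int p ^ b = z b" by (rule Zp_carrier_mod[OF z])
            then have "int p ^ b dvd z k - z b" by (metis minus_mod_eq_mult_div dvd_triv_left)
            then have "e [^] (z k - z b) \<in> E b" by (rule Ein)
            moreover have "inv (e [^] z b) \<otimes> e [^] z k = e [^] (z k - z b)" using ec by (simp add: int_pow_diff m_comm)
            ultimately show ?thesis unfolding Ci_def using ec by simp
          qed
          then have "e [^] z k \<in> cyc e \<inter> \<Inter> \<F>" using B pow_in_cyc[OF ec] by auto
          then show "cyc e \<inter> \<Inter> \<F> \<noteq> {}" by blast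
        qed
        then obtain x where x: "x \<in> cyc e" "\<And>n. x \<in> Ci n" by blast
        have "f x n = z n" for n
          by (rule feq[OF x(1)]) (use x(2)[of n] z in \<open>auto simp: Ci_def cg_def Zp_carrier_def\<close>)
        then show "z \<in> f ` cyc e" using x(1) by (metis ext image_eqI)
      qed
    qed
    have tH: "topspace (subtopology T (cyc e)) = cyc e" using cyc_subset_carrier[OF ec] by (simp add: Int_absorb1)
    have "continuous_map (subtopology T (cyc e)) (product_topology (\<lambda>_. discrete_topology UNIV) UNIV) f"
      unfolding continuous_map_componentwise_UNIV
    proof
      fix n
      \<comment> \<open>Only the values below \<open>p^n\<close> occur, so every preimage is a
        finite union of cosets of \<open>E n\<close>. Continuity is tested on closed sets because
        the \<open>E n\<close> were constructed as closed subgroups.\<close>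
      show "continuous_map (subtopology T (cyc e)) (discrete_topology UNIV) (\<lambda>x. f x n)"
        unfolding continuous_map_closedin
      proof (intro conjI allI impI)
        show "(\<lambda>x. f x n) \<in> topspace (subtopology T (cyc e)) \<rightarrow> topspace (discrete_topology UNIV)" by simp
        fix C :: "int set"
        define Ci where "Ci i = {y \<in> carrier G. inv (e [^] i) \<otimes> y \<in> E n}" for i :: int
        have Cicl: "closedin T (Ci i)" for i unfolding Ci_def using closedin_translate[OF Ecl] ec by simp
        have "closedin T (\<Union>i\<in>C \<inter> {0..<int p ^ n}. Ci i)" using Cicl by (intro closedin_Union) auto
        then have "closedin (subtopology T (cyc e)) (cyc e \<inter> (\<Union>i\<in>C \<inter> {0..<int p ^ n}. Ci i))"
          by (auto simp: closedin_subtopology)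
        moreover have "{x \<in> topspace (subtopology T (cyc e)). f x n \<in> C} = cyc e \<inter> (\<Union>i\<in>C \<inter> {0..<int p ^ n}. Ci i)"
        proof (rule Set.set_eqI)
          fix x
          show "x \<in> {x \<in> topspace (subtopology T (cyc e)). f x n \<in> C} \<longleftrightarrow> x \<in> cyc e \<inter> (\<Union>i\<in>C \<inter> {0..<int p ^ n}. Ci i)"
          proof (cases "x \<in> cyc e")
            case True
            have "f x n \<in> C \<longleftrightarrow> (\<exists>i\<in>C \<inter> {0..<int p ^ n}. cg (E n) (e [^] i) x)"
              using f[OF True, of n] feq[OF True, of _ n] by blast
            then show ?thesis using True Hc[OF True] unfolding tH Ci_def cg_def by auto
          qed (simp add: tH)
        qed
        ultimately show "closedin (subtopology T (cyc e)) {x \<in> topspace (subtopology T (cyc e)). f x n \<in> C}" by simp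
      qed
    qed
    then have "continuous_map (subtopology T (cyc e)) (Zp_topology p) f"
      unfolding Zp_topology_def using fZ tH by (intro continuous_map_into_subtopology) auto
    then have "homeomorphic_map (subtopology T (cyc e)) (Zp_topology p) f"
      by (rule continuous_imp_homeomorphic_map)
        (use e(2) Hausdorff_Zp_topology fsurj finj tH compact_space_subtopology in auto)
    moreover have "f \<in> iso (G\<lparr>carrier := cyc e\<rparr>) (Zp p)"
      unfolding iso_def hom_def bij_betw_def Zp_def using fZ fmult finj fsurj by (auto intro!: ext)
    ultimately show ?thesis unfolding top_group_isomorphic_def by blast
  qed
qed

end

section \<open>Generators of compact open subgroups\<close>

lemma (in group) order_mod_subgroup:
  assumes N: "subgroup N G" and x: "x \<in> carrier G" and m: "(m::int) > 0" "x [^] m \<in> N"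
  obtains n :: int where "n > 0" "\<And>j::int. x [^] j \<in> N \<longleftrightarrow> n dvd j"
proof -
  define n0 where "n0 = (LEAST n::nat. n > 0 \<and> x [^] int n \<in> N)"
  have ex: "nat m > 0 \<and> x [^] int (nat m) \<in> N" using m by simp
  have n0: "n0 > 0" "x [^] int n0 \<in> N" unfolding n0_def using LeastI[of "\<lambda>n. n > 0 \<and> x [^] int n \<in> N", OF ex] by auto
  have least: "n0 \<le> k" if "k > 0" "x [^] int k \<in> N" for k
    unfolding n0_def by (rule Least_le) (use that in simp)
  have mult: "x [^] (int n0 * c) \<in> N" for c
    using subgroup_int_pow_closed[OF N n0(2), of c] x by (simp add: int_pow_pow)
  show ?thesis
  proof (rule that[of "int n0"])
    show "int n0 > 0" using n0 by simp
    fix j :: int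
    show "x [^] j \<in> N \<longleftrightarrow> int n0 dvd j"
    proof
      assume j: "x [^] j \<in> N"
      define r where "r = j mod int n0"
      have r: "0 \<le> r" "r < int n0" unfolding r_def using n0 by auto
      have "x [^] (j - int n0 * (j div int n0)) \<in> N"
        using j mult x N by (simp add: int_pow_diff subgroup.m_closed subgroup.m_inv_closed)
      then have xr: "x [^] int (nat r) \<in> N" using r by (simp add: r_def minus_mult_div_eq_mod)
      have "r = 0" using least[OF _ xr] r by (cases "r = 0") auto
      then show "int n0 dvd j" by (simp add: r_def dvd_eq_mod_eq_0)
    next
      assume "int n0 dvd j"
      then show "x [^] j \<in> N" using mult by (auto elim!: dvdE)
    qed
  qed
qed

context na_cgroup begin

lemma coprime_pow_mem:
  assumes S: "subgroup S G" and x: "x \<in> carrier G" "x [^] (a::int) \<in> S" "x [^] (b::int) \<in> S" and ab: "coprime a b"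
  shows "x \<in> S"
proof -
  obtain u v where uv: "u * a + v * b = 1" using ab by (metis bezout_int coprime_iff_gcd_eq_1)
  have "(x [^] a) [^] u \<otimes> (x [^] b) [^] v \<in> S"
    using subgroup.m_closed[OF S] subgroup_int_pow_closed[OF S] x by simp
  moreover have "(x [^] a) [^] u \<otimes> (x [^] b) [^] v = x [^] (u * a + v * b)"
    using x(1) by (simp add: int_pow_pow int_pow_mult mult.commute)
  ultimately show ?thesis using uv x(1) by simp
qed

text \<open>Modulo \<open>N\<close> an element of finite order is assembled from its p-parts. With
  \<open>m = p^a * l\<close>, the power of \<open>x\<close> with exponent \<open>l\<close> has
  p-power order modulo \<open>N\<close> and is congruent to its own p-part, while the power with
  exponent \<open>p^a\<close> falls to the induction. Bezout recovers \<open>x\<close> from the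
  two.\<close>

lemma mem_of_p_elts_mem:
  assumes comp: "\<And>b. b \<in> carrier G \<Longrightarrow> compactin T (cyc b)"
    and W: "subgroup W G" "closedin T W" and N: "opensub N" and S: "subgroup S G" "N \<subseteq> S"
  shows "m > 0 \<Longrightarrow> (\<And>p e. Factorial_Ring.prime p \<Longrightarrow> p dvd m \<Longrightarrow> e \<in> W \<Longrightarrow> p_elt p e \<Longrightarrow> e \<in> S) \<Longrightarrow>
     x \<in> W \<Longrightarrow> x [^] int m \<in> N \<Longrightarrow> x \<in> S"
proof (induction m arbitrary: x rule: less_induct)
  case (less m)
  have xc: "x \<in> carrier G" using less.prems(3) subgroup.subset[OF W(1)] by blast
  show ?case
  proof (cases "m = 1")
    case True
    then show ?thesis using less.prems(4) S(2) xc by auto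
  next
    case False
    then obtain p where p: "Factorial_Ring.prime p" "p dvd m" using prime_factor_nat by blast
    define a where "a = multiplicity p m"
    have "\<not> is_unit p" using p(1) by auto
    then obtain l where l: "m = p ^ a * l" "\<not> p dvd l"
      unfolding a_def using multiplicity_decompose'[of m p] less.prems(1) by blast
    have "a > 0" using p(2) l by (cases a) auto
    have l0: "l > 0" using l(1) less.prems(1) by (cases l) auto
    have p1: "p > 1" using p(1) prime_gt_1_nat by blast
    have "1 < p ^ a" using p1 \<open>a > 0\<close> by (rule one_less_power)
    then have lm: "l < m" using l(1) l0 by simp
    have cop: "coprime l p" using prime_imp_coprime[OF p(1) l(2)] by (simp add: coprime_commute)
    define y where "y = x [^] int l"
    have yW: "y \<in> W" unfolding y_def using subgroup_int_pow_closed[OF W(1) less.prems(3)] .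
    have yc: "y \<in> carrier G" unfolding y_def using xc by simp
    have yN: "y [^] (int p ^ a) \<in> N" unfolding y_def using less.prems(4) xc l(1) by (simp add: int_pow_pow mult.commute)
    obtain e where e: "e \<in> cyc y" "p_elt p e" "\<And>N a. opensub N \<Longrightarrow> \<exists>t::int. int p ^ a dvd t - 1 \<and> cg N (y [^] t) e"
      using p_part_exists[OF yc comp[OF yc] p(1)] by blast
    have ec: "e \<in> carrier G" using e(2) by (rule p_elt_carrier)
    have "e \<in> W" using e(1) cyc_minimal[OF W yW] by blast
    then have eS: "e \<in> S" using less.prems(2)[OF p _ e(2)] by simp
    obtain t where t: "int p ^ a dvd t - 1" "cg N (y [^] t) e" using e(3)[OF N] by blast
    have sN: "subgroup N G" using N by simp
    have "cg N (y [^] t) y" using cg_pow_exponents[OF sN yc yN t(1)] yc by simp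
    then have "cg N e y"
      using cg_trans[OF sN ec _ yc cg_sym[OF sN _ ec t(2)]] yc by simp
    then have yS: "x [^] int l \<in> S" using cg_closed[OF S(1) ec yc cg_mono[OF S(2)] eS] unfolding y_def by simp
    have "x [^] (int p ^ a) \<in> W" using subgroup_int_pow_closed[OF W(1) less.prems(3)] .
    moreover have "(x [^] (int p ^ a)) [^] int l \<in> N" using less.prems(4) xc l(1) by (simp add: int_pow_pow)
    moreover have "e' \<in> S" if "Factorial_Ring.prime p'" "p' dvd l" "e' \<in> W" "p_elt p' e'" for p' e'
      using less.prems(2)[OF that(1) _ that(3,4)] that(2) l(1) by simp
    ultimately have "x [^] (int p ^ a) \<in> S" using less.IH[OF lm l0] by blast
    then show ?thesis using coprime_pow_mem[OF S(1) xc _ yS] cop by (simp add: coprime_commute)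
  qed
qed

lemma compact_exponent_mod:
  assumes comp: "\<And>b. b \<in> carrier G \<Longrightarrow> compactin T (cyc b)"
    and W: "compactin T W" and N: "opensub N"
  obtains m :: nat where "m > 0" "\<And>x. x \<in> W \<Longrightarrow> x [^] int m \<in> N"
proof -
  have sN: "subgroup N G" using N by simp
  have Wc: "W \<subseteq> carrier G" using compactin_subset_topspace[OF W] by simp
  define O' where "O' x = {y \<in> carrier G. inv x \<otimes> y \<in> N}" for x
  have "\<exists>\<F>. finite \<F> \<and> \<F> \<subseteq> O' ` W \<and> W \<subseteq> \<Union> \<F>"
  proof (rule compactinD[OF W])
    fix U assume "U \<in> O' ` W"
    then show "openin T U" unfolding O'_def using openin_translate N Wc by auto
  next
    have "x \<in> O' x" if "x \<in> W" for x unfolding O'_def using that Wc subgroup.one_closed[OF sN] by auto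
    then show "W \<subseteq> \<Union> (O' ` W)" by blast
  qed
  then obtain B where B: "finite B" "B \<subseteq> W" "W \<subseteq> \<Union> (O' ` B)" by (metis finite_subset_image)
  have "\<forall>b\<in>B. \<exists>m::nat. m > 0 \<and> b [^] int m \<in> N"
  proof
    fix b assume "b \<in> B"
    then have b: "b \<in> carrier G" using B Wc by blast
    obtain m :: int where m: "m > 0" "b [^] m \<in> N" using compactin_cyc_finite_order_mod[OF b comp[OF b]] N by blast
    then show "\<exists>m::nat. m > 0 \<and> b [^] int m \<in> N" by (intro exI[of _ "nat m"]) simp
  qed
  from bchoice[OF this] obtain f where f: "\<forall>b\<in>B. f b > 0 \<and> b [^] int (f b) \<in> N" by (rule exE)
  define m where "m = (\<Prod>b\<in>B. f b)"
  show ?thesis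
  proof (rule that[of m])
    show "m > 0" unfolding m_def using f by (simp add: prod_pos)
    fix x assume x: "x \<in> W"
    then obtain b where b: "b \<in> B" "cg N b x" using B(3) unfolding O'_def cg_def by blast
    have bc: "b \<in> carrier G" "x \<in> carrier G" using b B Wc x by auto
    have "f b dvd m" unfolding m_def using B(1) b(1) by (rule dvd_prodI)
    then obtain c where c: "m = f b * c" by blast
    have "(b [^] int (f b)) [^] int c \<in> N" using subgroup_int_pow_closed[OF sN] f b(1) by blast
    then have "b [^] int m \<in> N" using bc c by (simp add: int_pow_pow)
    moreover have "cg N (b [^] int m) (x [^] int m)" using cg_pow[OF sN bc b(2)] .
    ultimately show "x [^] int m \<in> N"
      using cg_closed[OF sN int_pow_closed[OF bc(1)] int_pow_closed[OF bc(2)]] by blast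
  qed
qed

lemma subgroup_cg_powers:
  assumes N: "subgroup N G" and w: "w \<in> carrier G"
  shows "subgroup {x \<in> carrier G. \<exists>k::int. cg N (w [^] k) x} G"
proof (rule subgroupI)
  show "{x \<in> carrier G. \<exists>k::int. cg N (w [^] k) x} \<subseteq> carrier G" by blast
  have "cg N (w [^] (0::int)) \<one>" using cg_refl[OF N] by simp
  then show "{x \<in> carrier G. \<exists>k::int. cg N (w [^] k) x} \<noteq> {}" by blast
  fix a assume "a \<in> {x \<in> carrier G. \<exists>k::int. cg N (w [^] k) x}"
  then obtain i :: int where a: "a \<in> carrier G" "cg N (w [^] i) a" by blast
  have "cg N ((w [^] i) [^] (-1::int)) (a [^] (-1::int))" using cg_pow[OF N _ a] w by simp
  then have "cg N (w [^] (- i)) (inv a)" using w a by (simp add: int_pow_pow int_pow_neg)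
  then show "inv a \<in> {x \<in> carrier G. \<exists>k::int. cg N (w [^] k) x}" using a by blast
  fix b assume "b \<in> {x \<in> carrier G. \<exists>k::int. cg N (w [^] k) x}"
  then obtain j :: int where b: "b \<in> carrier G" "cg N (w [^] j) b" by blast
  have "cg N (w [^] (i + j)) (a \<otimes> b)" using cg_mult[OF N _ a(1) _ b(1) a(2) b(2)] w by (simp add: int_pow_mult)
  then show "a \<otimes> b \<in> {x \<in> carrier G. \<exists>k::int. cg N (w [^] k) x}" using a b by blast
qed

end

section \<open>Periodic abelian groups with procyclic primary parts: generators and towers\<close>

locale procyclic_parts = na_cgroup +
  fixes h :: "nat \<Rightarrow> 'a"
  assumes comp: "\<And>b. b \<in> carrier G \<Longrightarrow> compactin T (cyc b)"
    and h_elt: "\<And>p. Factorial_Ring.prime p \<Longrightarrow> p_elt p (h p)"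
    and h_gen: "\<And>p b. Factorial_Ring.prime p \<Longrightarrow> p_elt p b \<Longrightarrow> b \<in> cyc (h p)"
begin

text \<open>Induction over the primes by the Chinese remainder theorem. The exponent
  \<open>M\<close> is carried along to know that the order of \<open>w\<close> modulo
  \<open>N\<close> is prime to the next prime, so that the product of \<open>w\<close> with a
  p-element still has both factors among its powers modulo \<open>N\<close>.\<close>

lemma generator_mod_finite_primes:
  assumes W: "opensub W" and N: "opensub N" "N \<subseteq> W" and F: "finite F"
  shows "(\<forall>p\<in>F. Factorial_Ring.prime p) \<Longrightarrow> \<exists>w\<in>W. \<exists>M::nat. M > 0 \<and> (\<forall>q. Factorial_Ring.prime q \<longrightarrow> q dvd M \<longrightarrow> q \<in> F) \<and>
    w [^] int M \<in> N \<and> (\<forall>p\<in>F. \<forall>x\<in>W. p_elt p x \<longrightarrow> (\<exists>k::int. cg N (w [^] k) x))"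
  using F
proof (induction F)
  case empty
  have "\<one> \<in> W" using W subgroup.one_closed by blast
  moreover have "\<one> \<in> N" using N subgroup.one_closed by blast
  moreover have "\<not> q dvd (1::nat)" if "Factorial_Ring.prime q" for q using that by auto
  ultimately show ?case by (intro bexI[of _ \<one>] exI[of _ "1::nat"]) auto
next
  case (insert p F)
  have sW: "subgroup W G" and sN: "subgroup N G" using W N by auto
  have p: "Factorial_Ring.prime p" using insert.prems by simp
  have "\<forall>p\<in>F. Factorial_Ring.prime p" using insert.prems by simp
  from insert.IH[OF this] obtain w and M :: nat where w: "w \<in> W" "M > 0" "\<And>q. Factorial_Ring.prime q \<Longrightarrow> q dvd M \<Longrightarrow> q \<in> F" "w [^] int M \<in> N"
    "\<And>p x. p \<in> F \<Longrightarrow> x \<in> W \<Longrightarrow> p_elt p x \<Longrightarrow> \<exists>k::int. cg N (w [^] k) x"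
    by blast
  have wc: "w \<in> carrier G" using w(1) subgroup.subset[OF sW] by blast
  have hc: "h p \<in> carrier G" using h_elt[OF p] p_elt_carrier by blast
  obtain m :: int where "m > 0" "h p [^] m \<in> W" using compactin_cyc_finite_order_mod[OF hc comp[OF hc] sW] W by blast
  \<comment> \<open>The powers of \<open>h p\<close> lying in \<open>W\<close> are those with
    exponent divisible by \<open>n\<close>. Since \<open>N \<subseteq> W\<close>, a p-element of
    \<open>W\<close> can only be congruent to such a power, so \<open>v\<close> generates the
    p-elements of \<open>W\<close> modulo \<open>N\<close>.\<close>
  then obtain n :: int where n: "n > 0" "\<And>j::int. h p [^] j \<in> W \<longleftrightarrow> n dvd j" using order_mod_subgroup[OF sW hc] by blast
  define v where "v = h p [^] n"
  have vW: "v \<in> W" unfolding v_def using n(2) by simp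
  have vc: "v \<in> carrier G" unfolding v_def using hc by simp
  have "p_elt p v" using p_elt_cyc[OF h_elt[OF p]] pow_in_cyc[OF hc] unfolding v_def by blast
  then obtain b where b: "v [^] (int p ^ b) \<in> N" using N unfolding p_elt_def by blast
  have vgen: "\<exists>k::int. cg N (v [^] k) x" if x: "x \<in> W" "p_elt p x" for x
  proof -
    have xc: "x \<in> carrier G" using x(2) p_elt_carrier by blast
    obtain i :: int where i: "cg N (h p [^] i) x" using h_gen[OF p x(2)] in_cyc_iff_cg[OF hc] N by blast
    have "cg W x (h p [^] i)" using cg_sym[OF sW _ xc cg_mono[OF N(2) i]] hc by simp
    then have "h p [^] i \<in> W" using cg_closed[OF sW xc _ _ x(1)] hc by simp
    then obtain c where "i = n * c" using n(2) by blast
    then have "h p [^] i = v [^] c" unfolding v_def using hc by (simp add: int_pow_pow)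
    then show ?thesis using i by metis
  qed
  have pM: "\<not> p dvd M" using w(3) p insert.hyps by blast
  have cop: "coprime (int M) (int p ^ b)"
  proof -
    have "coprime M (p ^ b)" using prime_imp_coprime[OF p pM] by (simp add: coprime_commute)
    then have "coprime (int M) (int (p ^ b))" by (simp only: coprime_int_iff)
    then show ?thesis by simp
  qed
  obtain s t where st: "s * int M + t * int p ^ b = 1" using cop by (metis bezout_int coprime_iff_gcd_eq_1)
  define w' where "w' = w \<otimes> v"
  have w'c: "w' \<in> carrier G" unfolding w'_def using wc vc by simp
  have triv: "cg N (y [^] (i * j)) \<one>" if "y \<in> carrier G" "y [^] i \<in> N" for y and i j :: int
    using cg_pow_exponents[OF sN that, of "i * j" 0] that(1) by simp
  \<comment> \<open>By the choice of \<open>s\<close> and \<open>t\<close>, the exponent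
    \<open>t * p^b\<close> is 1 modulo \<open>M\<close> and 0 modulo \<open>p^b\<close>, which
    isolates \<open>w\<close>; the exponent \<open>s * M\<close> isolates \<open>v\<close> in the
    same way.\<close>
  have 1: "cg N (w' [^] (t * int p ^ b)) w"
  proof -
    have "cg N (w [^] (t * int p ^ b)) (w [^] (1::int))"
    proof (rule cg_pow_exponents[OF sN wc w(4)])
      show "int M dvd t * int p ^ b - 1" using st by (metis add_diff_cancel_right' diff_add_cancel dvd_minus_iff dvd_triv_right minus_diff_eq)
    qed
    moreover have "cg N (v [^] (t * int p ^ b)) \<one>" using triv[OF vc b, of t] by (simp add: mult.commute)
    ultimately have "cg N (w [^] (t * int p ^ b) \<otimes> v [^] (t * int p ^ b)) (w \<otimes> \<one>)"
      using cg_mult[OF sN _ wc _ one_closed] wc vc by simp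
    then show ?thesis unfolding w'_def using wc vc by (simp add: int_pow_distrib)
  qed
  have 2: "cg N (w' [^] (s * int M)) v"
  proof -
    have "cg N (v [^] (s * int M)) (v [^] (1::int))"
    proof (rule cg_pow_exponents[OF sN vc b])
      show "int p ^ b dvd s * int M - 1" using st by (metis add_diff_cancel_left' diff_add_cancel dvd_minus_iff dvd_triv_right minus_diff_eq)
    qed
    moreover have "cg N (w [^] (s * int M)) \<one>" using triv[OF wc w(4), of s] by (simp add: mult.commute)
    ultimately have "cg N (w [^] (s * int M) \<otimes> v [^] (s * int M)) (\<one> \<otimes> v)"
      using cg_mult[OF sN _ one_closed _ vc] wc vc by simp
    then show ?thesis unfolding w'_def using wc vc by (simp add: int_pow_distrib)
  qed
  have lift: "\<exists>k::int. cg N (w' [^] k) x" if "cg N (w' [^] i) y" "cg N (y [^] (j::int)) x" "y \<in> carrier G" "x \<in> carrier G"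
    for x y and i j :: int
  proof -
    have "cg N ((w' [^] i) [^] j) (y [^] j)" using cg_pow[OF sN _ that(3,1)] w'c by simp
    then have "cg N (w' [^] (i * j)) x" using cg_trans[OF sN _ _ that(4) _ that(2)] w'c that(3) by (simp add: int_pow_pow)
    then show ?thesis by blast
  qed
  show ?case
  proof (intro bexI[of _ w'] exI[of _ "M * p ^ b"] conjI allI impI ballI)
    show "w' \<in> W" unfolding w'_def using subgroup.m_closed[OF sW w(1) vW] .
    show "0 < M * p ^ b" using w(2) p prime_gt_0_nat by simp
    show "q \<in> insert p F" if "Factorial_Ring.prime q" "q dvd M * p ^ b" for q
    proof -
      have "q dvd M \<or> q dvd p ^ b" using that by (simp add: prime_dvd_mult_iff)
      then show ?thesis
      proof
        assume "q dvd p ^ b"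
        then have "q = p" using that(1) p prime_dvd_power primes_dvd_imp_eq by blast
        then show ?thesis by simp
      qed (use w(3) that in blast)
    qed
    have "(w [^] int M) [^] (int p ^ b) \<otimes> (v [^] (int p ^ b)) [^] int M \<in> N"
      using subgroup.m_closed[OF sN] subgroup_int_pow_closed[OF sN] w(4) b by simp
    then show "w' [^] int (M * p ^ b) \<in> N" unfolding w'_def using wc vc
      by (simp add: int_pow_distrib int_pow_pow mult.commute)
    fix q x assume q: "q \<in> insert p F" "x \<in> W" "p_elt q x"
    have xc: "x \<in> carrier G" using q(3) p_elt_carrier by blast
    show "\<exists>k::int. cg N (w' [^] k) x"
    proof (cases "q = p")
      case True
      then obtain k :: int where "cg N (v [^] k) x" using vgen q by blast
      then show ?thesis using lift[OF 2 _ vc xc] by blast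
    next
      case False
      then obtain k :: int where "cg N (w [^] k) x" using w(5)[of q x] q by blast
      then show ?thesis using lift[OF 1 _ wc xc] by blast
    qed
  qed
qed

text \<open>A compact \<open>W\<close> has a finite exponent modulo \<open>N\<close>, so only
  finitely many primes matter. Once the subgroup of elements congruent to powers of \<open>w\<close>
  contains the p-elements for these primes, \<open>mem_of_p_elts_mem\<close> gives all of
  \<open>W\<close>.\<close>

lemma generator_mod:
  assumes W: "opensub W" "compactin T W" and N: "opensub N" "N \<subseteq> W"
  shows "\<exists>w\<in>W. \<forall>x\<in>W. \<exists>k::int. cg N (w [^] k) x"
proof -
  have sW: "subgroup W G" and sN: "subgroup N G" using W N by auto
  obtain m :: nat where m: "m > 0" "\<And>x. x \<in> W \<Longrightarrow> x [^] int m \<in> N"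
    using compact_exponent_mod[OF comp W(2) N(1)] by blast
  define F where "F = {p. Factorial_Ring.prime p \<and> p dvd m}"
  have finF: "finite F" unfolding F_def using m(1) by (auto intro: finite_subset[OF _ finite_divisors_nat[OF m(1)]])
  have "\<forall>p\<in>F. Factorial_Ring.prime p" unfolding F_def by blast
  from generator_mod_finite_primes[OF W(1) N finF this]
  obtain w where w: "w \<in> W" "\<forall>p\<in>F. \<forall>x\<in>W. p_elt p x \<longrightarrow> (\<exists>k::int. cg N (w [^] k) x)" by blast
  have wc: "w \<in> carrier G" using w(1) subgroup.subset[OF sW] by blast
  define S where "S = {x \<in> carrier G. \<exists>k::int. cg N (w [^] k) x}"
  have S: "subgroup S G" unfolding S_def by (rule subgroup_cg_powers[OF sN wc])
  have NS: "N \<subseteq> S"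
  proof
    fix x assume "x \<in> N"
    then have "x \<in> carrier G" "cg N (w [^] (0::int)) x" using subgroup.subset[OF sN] by (auto simp: cg_def)
    then show "x \<in> S" unfolding S_def by blast
  qed
  have "x \<in> S" if x: "x \<in> W" for x
  proof (rule mem_of_p_elts_mem[OF comp sW _ N(1) S NS m(1) _ x m(2)[OF x]])
    show "closedin T W" using W open_subgroup_closed by simp
    fix p e assume "Factorial_Ring.prime p" "p dvd m" "e \<in> W" "p_elt p e"
    then show "e \<in> S" using w(2) p_elt_carrier unfolding S_def F_def by blast
  qed
  then show ?thesis using w(1) unfolding S_def by blast
qed

definition gens :: "'a set \<Rightarrow> 'a set" where "gens W = {w \<in> W. W \<subseteq> cyc w}"

text \<open>For each \<open>N\<close> the condition depends only on the class of \<open>w\<close>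
  modulo \<open>N\<close>, and cosets of \<open>N\<close> are clopen. The family is kept arbitrary
  to cover both a single subgroup and all open subgroups of \<open>W\<close>.\<close>

lemma closedin_generators_mod:
  assumes W: "subgroup W G" "closedin T W" and I: "\<And>N. N \<in> \<N> \<Longrightarrow> opensub N"
  shows "closedin T {w \<in> W. \<forall>N\<in>\<N>. \<forall>x\<in>W. \<exists>k::int. cg N (w [^] k) x}"
proof -
  define Y where "Y = {w \<in> W. \<forall>N\<in>\<N>. \<forall>x\<in>W. \<exists>k::int. cg N (w [^] k) x}"
  have Wc: "W \<subseteq> carrier G" using subgroup.subset[OF W(1)] .
  have Yc: "Y \<subseteq> carrier G" unfolding Y_def using Wc by blast
  have "cl Y \<subseteq> Y"
  proof
    fix w assume w: "w \<in> cl Y"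
    have "cl Y \<subseteq> W" using W(2) by (intro closure_of_minimal) (auto simp: Y_def)
    then have wW: "w \<in> W" using w by blast
    then have wc: "w \<in> carrier G" using Wc by blast
    have "\<exists>k::int. cg N (w [^] k) x" if N: "N \<in> \<N>" and x: "x \<in> W" for N x
    proof -
      have sN: "subgroup N G" using I N by simp
      obtain s where s: "s \<in> Y" "inv s \<otimes> w \<in> N"
        using iffD1[OF in_closure_iff_opensub[OF wc Yc] w, rule_format, OF I[OF N]] by blast
      have sc: "s \<in> carrier G" using s(1) Yc by blast
      have xc: "x \<in> carrier G" using x Wc by blast
      obtain k :: int where k: "cg N (s [^] k) x" using s(1) N x unfolding Y_def by blast
      have "cg N w s" using cg_sym[OF sN sc wc] s(2) unfolding cg_def by blast
      then have "cg N (w [^] k) (s [^] k)" using cg_pow[OF sN wc sc] by blast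
      then have "cg N (w [^] k) x" using cg_trans[OF sN _ _ xc _ k] wc sc by simp
      then show ?thesis by blast
    qed
    then show "w \<in> Y" unfolding Y_def using wW by blast
  qed
  then show ?thesis using closure_of_subset_eq[of Y T] Yc unfolding Y_def by simp
qed

lemma gens_eq:
  assumes W: "opensub W"
  shows "gens W = {w \<in> W. \<forall>N\<in>{N. opensub N \<and> N \<subseteq> W}. \<forall>x\<in>W. \<exists>k::int. cg N (w [^] k) x}"
proof (rule Set.set_eqI)
  fix w
  have Wc: "W \<subseteq> carrier G" using W subgroup.subset by blast
  have "W \<subseteq> cyc w \<longleftrightarrow> (\<forall>N\<in>{N. opensub N \<and> N \<subseteq> W}. \<forall>x\<in>W. \<exists>k::int. cg N (w [^] k) x)" if w: "w \<in> W"
  proof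
    assume "W \<subseteq> cyc w"
    then show "\<forall>N\<in>{N. opensub N \<and> N \<subseteq> W}. \<forall>x\<in>W. \<exists>k::int. cg N (w [^] k) x"
      using in_cyc_iff_cg[OF subsetD[OF Wc w]] by blast
  next
    assume R: "\<forall>N\<in>{N. opensub N \<and> N \<subseteq> W}. \<forall>x\<in>W. \<exists>k::int. cg N (w [^] k) x"
    show "W \<subseteq> cyc w"
    proof
      fix x assume x: "x \<in> W"
      have "\<exists>k::int. cg N (w [^] k) x" if N: "opensub N" for N
      proof -
        have "opensub (N \<inter> W)" using opensub_Int[OF N W] .
        then obtain k :: int where "cg (N \<inter> W) (w [^] k) x" using R x by blast
        then show ?thesis unfolding cg_def by blast
      qed
      then show "x \<in> cyc w" using in_cyc_iff_cg[OF subsetD[OF Wc w]] x Wc by blast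
    qed
  qed
  then show "w \<in> gens W \<longleftrightarrow> w \<in> {w \<in> W. \<forall>N\<in>{N. opensub N \<and> N \<subseteq> W}. \<forall>x\<in>W. \<exists>k::int. cg N (w [^] k) x}"
    unfolding gens_def by blast
qed

lemma closedin_gens: "opensub W \<Longrightarrow> closedin T (gens W)"
  unfolding gens_eq by (rule closedin_generators_mod) (simp_all add: open_subgroup_closed)

text \<open>A topological generator is a common point of the closed sets of generators modulo each
  \<open>N\<close>. Finitely many of these sets meet, because a generator modulo the intersection of
  the subgroups lies in all of them.\<close>

lemma gens_nonempty:
  assumes W: "opensub W" "compactin T W"
  shows "gens W \<noteq> {}"
proof -
  define Gn where "Gn N = {w \<in> W. \<forall>M\<in>{N}. \<forall>x\<in>W. \<exists>k::int. cg M (w [^] k) x}" for N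
  have sW: "subgroup W G" using W by simp
  have "W \<inter> \<Inter> (Gn ` {N. opensub N \<and> N \<subseteq> W}) \<noteq> {}"
  proof (rule compactin_fip[THEN iffD1, OF W(2), THEN conjunct2, rule_format], intro conjI ballI allI impI)
    fix C assume "C \<in> Gn ` {N. opensub N \<and> N \<subseteq> W}"
    then obtain N where N: "opensub N" "C = Gn N" by blast
    show "closedin T C" unfolding N(2) Gn_def
      by (rule closedin_generators_mod[OF sW open_subgroup_closed[OF sW]]) (use W N in auto)
  next
    fix \<F> assume "finite \<F> \<and> \<F> \<subseteq> Gn ` {N. opensub N \<and> N \<subseteq> W}"
    then have "finite \<F>" "\<F> \<subseteq> Gn ` {N. opensub N \<and> N \<subseteq> W}" by auto
    from finite_subset_image[OF this] obtain B
      where B: "finite B" "B \<subseteq> {N. opensub N \<and> N \<subseteq> W}" "\<F> = Gn ` B" by blast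
    have "opensub (\<Inter> (insert W B))" using B(1,2)
    proof (induction B)
      case empty then show ?case using W by simp
    next
      case (insert N B)
      then have "opensub (N \<inter> \<Inter> (insert W B))" by (intro opensub_Int) auto
      moreover have "N \<inter> \<Inter> (insert W B) = \<Inter> (insert W (insert N B))" by blast
      ultimately show ?case by simp
    qed
    then obtain w where w: "w \<in> W" "\<forall>x\<in>W. \<exists>k::int. cg (\<Inter> (insert W B)) (w [^] k) x"
      using generator_mod[OF W, of "\<Inter> (insert W B)"] by auto
    have "w \<in> Gn N" if "N \<in> B" for N
    proof -
      have "\<Inter> (insert W B) \<subseteq> N" using that by blast
      then have "\<exists>k::int. cg N (w [^] k) x" if "x \<in> W" for x using w(2) that cg_mono by blast
      then show ?thesis unfolding Gn_def using w(1) by simp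
    qed
    then have "w \<in> W \<inter> \<Inter> \<F>" using w(1) B(3) by blast
    then show "W \<inter> \<Inter> \<F> \<noteq> {}" by blast
  qed
  then obtain w where w: "w \<in> W" "\<And>N. opensub N \<Longrightarrow> N \<subseteq> W \<Longrightarrow> w \<in> Gn N" by blast
  have "w \<in> gens W" unfolding gens_eq[OF W(1)] using w unfolding Gn_def by blast
  then show ?thesis by blast
qed

text \<open>Step \<open>k\<close> of the tower only matters for prime \<open>k\<close>; indexing by all naturals makes the index of step \<open>k\<close> a
  power of \<open>k\<close>, so that a \<open>p\<close>-primary component no longer grows after step \<open>p\<close>.\<close>

definition adj :: "nat \<Rightarrow> 'a" where "adj k = (if Factorial_Ring.prime k then h k else \<one>)"

text \<open>Each step multiplies by the cyclic group of \<open>adj k\<close>. As the previous stage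
  is open, this already adjoins the whole closure of that cyclic group.\<close>

primrec tower :: "'a set \<Rightarrow> nat \<Rightarrow> 'a set" where
  "tower U 0 = U"
| "tower U (Suc k) = {x \<in> carrier G. \<exists>i::int. cg (tower U k) (adj k [^] i) x}"

lemma adj_carrier: "adj k \<in> carrier G"
  unfolding adj_def using h_elt p_elt_carrier by auto

text \<open>Compactness holds because \<open>M\<close>, as an open subgroup, is closed, and it lies
  in the compact product of \<open>cyc (adj k)\<close> and \<open>N\<close>.\<close>

lemma tower_step:
  fixes k :: nat
  assumes N: "opensub N" "compactin T N"
  defines "M \<equiv> {x \<in> carrier G. \<exists>i::int. cg N (adj k [^] i) x}"
  shows "opensub M" "compactin T M" "N \<subseteq> M" "adj k \<in> M"
proof -
  have sN: "subgroup N G" using N by simp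
  have sM: "subgroup M G" unfolding M_def by (rule subgroup_cg_powers[OF sN adj_carrier])
  show NM: "N \<subseteq> M"
  proof
    fix x assume "x \<in> N"
    then have "x \<in> carrier G" "cg N (adj k [^] (0::int)) x" using subgroup.subset[OF sN] by (auto simp: cg_def)
    then show "x \<in> M" unfolding M_def by blast
  qed
  have "openin T M" using open_subgroupI[OF sM _ _ NM] N subgroup.one_closed[OF sN] by blast
  then show M: "opensub M" using sM by simp
  have "cg N (adj k [^] (1::int)) (adj k)" using cg_refl[OF sN adj_carrier] adj_carrier[of k] by simp
  then show "adj k \<in> M" unfolding M_def using adj_carrier by blast
  define K where "K = (\<lambda>(x, y). x \<otimes> y) ` (cyc (adj k) \<times> N)"
  have "compactin T K" unfolding K_def
    using comp[OF adj_carrier] N(2) cont_mult by (intro image_compactin) (auto simp: compactin_Times)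
  moreover have "M \<subseteq> K"
  proof
    fix x assume "x \<in> M"
    then obtain i :: int where i: "x \<in> carrier G" "inv (adj k [^] i) \<otimes> x \<in> N" unfolding M_def cg_def by blast
    have "x = adj k [^] i \<otimes> (inv (adj k [^] i) \<otimes> x)" using i(1) adj_carrier[of k] by (simp flip: m_assoc)
    moreover have "adj k [^] i \<in> cyc (adj k)" by (rule pow_in_cyc[OF adj_carrier])
    ultimately show "x \<in> K" unfolding K_def using i(2) by force
  qed
  ultimately show "compactin T M" using closed_compactin open_subgroup_closed M by blast
qed

lemma tower_compact_open:
  assumes "opensub U" "compactin T U"
  shows "opensub (tower U k) \<and> compactin T (tower U k)"
proof (induction k)
  case 0 then show ?case using assms by simp
next
  case (Suc k)
  then show ?case using tower_step(1,2)[of "tower U k" k] by simp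
qed

text \<open>The number \<open>m k\<close> is the order of \<open>adj k\<close> modulo
  \<open>tower U k\<close>: a power of \<open>k\<close> if \<open>k\<close> is prime, and 1
  otherwise. It is also the order of any topological generator of the next stage, as the quotient of
  the two stages is cyclic and generated by \<open>adj k\<close>.\<close>

lemma tower_exists:
  assumes U: "opensub U" "compactin T U"
  obtains m :: "nat \<Rightarrow> int" where
    "\<And>k p. Factorial_Ring.prime p \<Longrightarrow> p \<noteq> k \<Longrightarrow> coprime (m k) (int p)"
    "\<And>k x. x \<in> gens (tower U (Suc k)) \<Longrightarrow> x [^] m k \<in> gens (tower U k)"
    "\<And>k x j. x \<in> gens (tower U (Suc k)) \<Longrightarrow> x [^] j \<in> tower U k \<Longrightarrow> m k dvd j"
    "\<And>x. x \<in> carrier G \<Longrightarrow> \<exists>k. x \<in> tower U k"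
proof -
  have tw: "opensub (tower U k)" "compactin T (tower U k)" for k using tower_compact_open[OF U] by auto
  then have st: "subgroup (tower U k) G" for k by simp
  have twc: "x \<in> carrier G" if "x \<in> tower U k" for x k using that subgroup.subset[OF st] by blast
  have sub: "tower U k \<subseteq> tower U (Suc k)" for k using tower_step(3)[OF tw] by simp
  have adj: "adj k \<in> tower U (Suc k)" for k using tower_step(4)[OF tw] by simp
  have "\<forall>k. \<exists>n::int. n > 0 \<and> (\<forall>j::int. adj k [^] j \<in> tower U k \<longleftrightarrow> n dvd j)"
  proof
    fix k
    obtain m :: int where "m > 0" "adj k [^] m \<in> tower U k"
      using compactin_cyc_finite_order_mod[OF adj_carrier comp[OF adj_carrier] st] tw by blast
    then show "\<exists>n::int. n > 0 \<and> (\<forall>j::int. adj k [^] j \<in> tower U k \<longleftrightarrow> n dvd j)"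
      using order_mod_subgroup[OF st adj_carrier] by metis
  qed
  from choice[OF this] obtain m where m: "\<forall>k. m k > 0 \<and> (\<forall>j::int. adj k [^] j \<in> tower U k \<longleftrightarrow> m k dvd j)" by (rule exE)
  \<comment> \<open>A generator \<open>x\<close> has a power congruent to \<open>adj k\<close>, so
    an exponent that kills \<open>x\<close> modulo \<open>tower U k\<close> kills
    \<open>adj k\<close> too.\<close>
  have dv: "m k dvd j" if x: "x \<in> gens (tower U (Suc k))" "x [^] j \<in> tower U k" for k x j
  proof -
    have xt: "x \<in> tower U (Suc k)" "tower U (Suc k) \<subseteq> cyc x" using x(1) unfolding gens_def by auto
    have xc: "x \<in> carrier G" using twc xt(1) by blast
    have "adj k \<in> cyc x" using xt(2) adj by blast
    then obtain i :: int where i: "cg (tower U k) (x [^] i) (adj k)" using in_cyc_iff_cg[OF xc] tw by blast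
    have "cg (tower U k) ((x [^] i) [^] j) (adj k [^] j)" using cg_pow[OF st _ adj_carrier i] xc by simp
    moreover have "(x [^] j) [^] i \<in> tower U k" using subgroup_int_pow_closed[OF st x(2)] .
    then have "(x [^] i) [^] j \<in> tower U k" using xc by (simp add: int_pow_pow mult.commute)
    ultimately have "adj k [^] j \<in> tower U k"
      using cg_closed[OF st int_pow_closed[OF int_pow_closed[OF xc]] int_pow_closed[OF adj_carrier]] by blast
    then show ?thesis using m by blast
  qed
  show ?thesis
  proof (rule that[of m])
    show "coprime (m k) (int p)" if p: "Factorial_Ring.prime p" "p \<noteq> k" for k p
    proof (cases "Factorial_Ring.prime k")
      case True
      then obtain a where "adj k [^] (int k ^ a) \<in> tower U k"
        using h_elt[OF True] tw(1)[of k] unfolding p_elt_def adj_def by auto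
      then have "m k dvd int k ^ a" using m by blast
      moreover have "coprime (int k ^ a) (int p)"
      proof -
        have "coprime k p" using True p by (simp add: primes_coprime)
        then show ?thesis by simp
      qed
      ultimately show ?thesis by (rule coprime_divisors[OF _ dvd_refl])
    next
      case False
      then have "adj k [^] (1::int) \<in> tower U k" using subgroup.one_closed[OF st] by (simp add: adj_def)
      then have "m k dvd 1" using m by blast
      then show ?thesis using m by (metis coprime_1_left zdvd1_eq abs_of_pos)
    qed
    show "x [^] m k \<in> gens (tower U k)" if x: "x \<in> gens (tower U (Suc k))" for k x
    proof -
      have xt: "x \<in> tower U (Suc k)" "tower U (Suc k) \<subseteq> cyc x" using x unfolding gens_def by auto
      have xc: "x \<in> carrier G" using twc xt(1) by blast
      obtain i :: int where i: "cg (tower U k) (adj k [^] i) x" using xt(1) by auto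
      have "cg (tower U k) ((adj k [^] i) [^] m k) (x [^] m k)" using cg_pow[OF st _ xc i] adj_carrier by simp
      moreover have "adj k [^] (m k) \<in> tower U k" using m by simp
      then have "(adj k [^] m k) [^] i \<in> tower U k" by (rule subgroup_int_pow_closed[OF st])
      then have "(adj k [^] i) [^] m k \<in> tower U k" using adj_carrier[of k] by (simp add: int_pow_pow mult.commute)
      ultimately have 1: "x [^] m k \<in> tower U k"
        using cg_closed[OF st int_pow_closed[OF int_pow_closed[OF adj_carrier]] int_pow_closed[OF xc]] by blast
      have xmc: "x [^] m k \<in> carrier G" using xc by simp
      \<comment> \<open>Approximation modulo \<open>N \<inter> tower U k\<close>, rather than modulo
        \<open>N\<close> alone, forces the approximating powers of \<open>x\<close> into
        \<open>tower U k\<close>, where their exponents are multiples of \<open>m k\<close>.\<close>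
      have "y \<in> cyc (x [^] m k)" if y: "y \<in> tower U k" for y
        unfolding in_cyc_iff_cg[OF xmc]
      proof (intro conjI allI impI)
        show yc: "y \<in> carrier G" using twc y by blast
        fix N assume N: "opensub N"
        have N': "opensub (N \<inter> tower U k)" using opensub_Int[OF N tw(1)] .
        have "y \<in> cyc x" using y sub xt(2) by blast
        then obtain j :: int where j: "cg (N \<inter> tower U k) (x [^] j) y" using in_cyc_iff_cg[OF xc] N' by blast
        have "cg (tower U k) y (x [^] j)" using cg_sym[OF st int_pow_closed[OF xc] yc cg_mono[OF Int_lower2 j]] .
        then have "x [^] j \<in> tower U k" using cg_closed[OF st yc _ _ y] xc by simp
        then obtain c where "j = m k * c" using dv[OF x] by blast
        then have "cg N ((x [^] m k) [^] c) y" using j xc unfolding cg_def by (simp add: int_pow_pow)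
        then show "\<exists>c::int. cg N ((x [^] m k) [^] c) y" by blast
      qed
      then show ?thesis using 1 unfolding gens_def by blast
    qed
    show "m k dvd j" if "x \<in> gens (tower U (Suc k))" "x [^] j \<in> tower U k" for k x j using dv that by blast
    fix x assume x: "x \<in> carrier G"
    obtain M0 :: int where M0: "M0 > 0" "x [^] M0 \<in> U"
      using compactin_cyc_finite_order_mod[OF x comp[OF x]] U by blast
    define M where "M = nat M0"
    have M: "M > 0" "x [^] int M \<in> U" using M0 by (auto simp: M_def)
    have mono: "tower U i \<subseteq> tower U j" if "i \<le> j" for i j using lift_Suc_mono_le[of "tower U", OF sub that] .
    \<comment> \<open>Only primes dividing \<open>M\<close> matter. They are at most
      \<open>M\<close>, and the p-elements are absorbed at stage \<open>Suc p\<close>.\<close>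
    have "x \<in> tower U (Suc M)"
    proof (rule mem_of_p_elts_mem[OF comp subgroup_self _ U(1) st _ M(1) _ x M(2)])
      show "closedin T (carrier G)" using closedin_topspace[of T] by simp
      show "U \<subseteq> tower U (Suc M)" using mono[of 0 "Suc M"] by simp
      fix p e assume p: "Factorial_Ring.prime p" "p dvd M" "p_elt p e"
      have "p \<le> M" using p(2) M(1) by (rule dvd_imp_le)
      have ec: "e \<in> carrier G" using p(3) by (rule p_elt_carrier)
      have "e \<in> cyc (adj p)" using h_gen[OF p(1,3)] p(1) by (simp add: adj_def)
      then obtain i :: int where "cg (tower U p) (adj p [^] i) e" using in_cyc_iff_cg[OF adj_carrier] tw(1) by blast
      then have "e \<in> tower U (Suc p)" using ec by auto
      then show "e \<in> tower U (Suc M)" using mono[of "Suc p" "Suc M"] \<open>p \<le> M\<close> by blast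
    qed
    then show "\<exists>k. x \<in> tower U k" by blast
  qed
qed

end

section \<open>Lifting along a proper homomorphism\<close>

text \<open>Coherent sequences are the common points of the closed conditions \<open>E n\<close> on
  the compact product of the \<open>C k\<close>. Finitely many conditions are met by starting at a
  late stage and mapping down.\<close>

lemma compact_inverse_limit:
  fixes C :: "nat \<Rightarrow> 'a set"
  assumes H: "Hausdorff_space T" and C: "\<And>k. compactin T (C k)" "\<And>k. C k \<noteq> {}"
    and f: "\<And>k. continuous_map T T (f k)" "\<And>k x. x \<in> C (Suc k) \<Longrightarrow> f k x \<in> C k"
  shows "\<exists>x. (\<forall>k. x k \<in> C k) \<and> (\<forall>k. f k (x (Suc k)) = x k)"
proof -
  define P where "P = product_topology (\<lambda>_::nat. T) UNIV"
  have Ct: "C k \<subseteq> topspace T" for k using compactin_subset_topspace[OF C(1)] .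
  have K: "compactin P (PiE UNIV C)" unfolding P_def using C(1) by (simp add: compactin_PiE)
  define E where "E n = {x \<in> topspace P. f n (x (Suc n)) = x n}" for n
  have cl: "closedin P (E n)" for n unfolding E_def
  proof (rule closedin_continuous_maps_eq[OF H])
    have pr: "continuous_map P T (\<lambda>x. x k)" for k unfolding P_def by (rule continuous_map_product_projection) simp
    show "continuous_map P T (\<lambda>x. x n)" by (rule pr)
    show "continuous_map P T (\<lambda>x. f n (x (Suc n)))"
      using continuous_map_compose[OF pr f(1)] by (simp add: o_def)
  qed
  have "PiE UNIV C \<inter> \<Inter> (range E) \<noteq> {}"
  proof (rule compactin_fip[THEN iffD1, OF K, THEN conjunct2, rule_format], intro conjI ballI allI impI)
    fix Y assume "Y \<in> range E" then show "closedin P Y" using cl by auto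
  next
    fix \<F> assume "finite \<F> \<and> \<F> \<subseteq> range E"
    then have "finite \<F>" "\<F> \<subseteq> range E" by auto
    from finite_subset_image[OF this] obtain B where B: "finite B" "\<F> = E ` B" by blast
    define n where "n = Max (insert 0 B)"
    have Bn: "b \<le> n" if "b \<in> B" for b unfolding n_def using B that by simp
    obtain y where y: "y \<in> C (Suc n)" using C(2) by blast
    \<comment> \<open>The entry \<open>z i\<close> is the image of \<open>y\<close> at stage
      \<open>Suc n - i\<close>. Beyond stage \<open>Suc n\<close> no condition is left, so any
      points of the \<open>C k\<close> complete the sequence.\<close>
    define z where "z = rec_nat y (\<lambda>i. f (n - i))"
    have z0: "z 0 = y" and zS: "z (Suc i) = f (n - i) (z i)" for i by (auto simp: z_def)
    have zC: "i \<le> Suc n \<Longrightarrow> z i \<in> C (Suc n - i)" for i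
    proof (induction i)
      case 0 then show ?case using y z0 by simp
    next
      case (Suc i)
      then have "z i \<in> C (Suc (n - i))" by (simp add: Suc_diff_le)
      then show ?case using f(2) zS by simp
    qed
    define x where "x k = (if k \<le> Suc n then z (Suc n - k) else (SOME c. c \<in> C k))" for k
    have xC: "x k \<in> C k" for k
    proof (cases "k \<le> Suc n")
      case True
      then show ?thesis using zC[of "Suc n - k"] by (simp add: x_def)
    next
      case False
      have "(SOME c. c \<in> C k) \<in> C k" using C(2)[of k] by (simp add: some_in_eq)
      then show ?thesis using False by (simp add: x_def)
    qed
    have "f k (x (Suc k)) = x k" if "k \<le> n" for k
    proof -
      have "x k = z (Suc (n - k))" using that by (simp add: x_def Suc_diff_le)
      also have "\<dots> = f k (z (n - k))" using that zS[of "n - k"] by simp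
      also have "z (n - k) = x (Suc k)" using that by (simp add: x_def)
      finally show ?thesis by simp
    qed
    then have "x \<in> E b" if "b \<in> B" for b
      unfolding E_def P_def using Bn[OF that] xC Ct by auto
    then have "x \<in> PiE UNIV C \<inter> \<Inter> \<F>" using xC B by auto
    then show "PiE UNIV C \<inter> \<Inter> \<F> \<noteq> {}" by blast
  qed
  then obtain x where "x \<in> PiE UNIV C" "\<And>n. x \<in> E n" by blast
  then show ?thesis unfolding E_def by auto
qed

lemma (in topgroup) cyc_comm:
  assumes H: "Hausdorff_space T" and a: "a \<in> carrier G" and x: "x \<in> cyc a" and y: "y \<in> cyc a"
  shows "x \<otimes> y = y \<otimes> x"
proof -
  have cent: "cyc a \<subseteq> {z \<in> topspace T. z \<otimes> b = b \<otimes> z}" if b: "b \<in> carrier G" and ab: "a \<otimes> b = b \<otimes> a" for b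
  proof (rule cyc_minimal)
    have "continuous_map T T (\<lambda>z. z \<otimes> b)" "continuous_map T T (\<lambda>z. b \<otimes> z)"
      using b by (auto intro!: continuous_map_mult)
    then show "closedin T {z \<in> topspace T. z \<otimes> b = b \<otimes> z}" by (rule closedin_continuous_maps_eq[OF H])
    show "a \<in> {z \<in> topspace T. z \<otimes> b = b \<otimes> z}" using a ab by simp
    show "subgroup {z \<in> topspace T. z \<otimes> b = b \<otimes> z} G"
    proof (rule subgroupI)
      fix u assume "u \<in> {z \<in> topspace T. z \<otimes> b = b \<otimes> z}"
      then have u: "u \<in> carrier G" "u \<otimes> b = b \<otimes> u" by auto
      have "inv u \<otimes> b = b \<otimes> inv u" using u b by (metis inv_closed inv_solve_left inv_solve_right m_assoc m_closed)
      then show "inv u \<in> {z \<in> topspace T. z \<otimes> b = b \<otimes> z}" using u by simp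
      fix v assume "v \<in> {z \<in> topspace T. z \<otimes> b = b \<otimes> z}"
      then have v: "v \<in> carrier G" "v \<otimes> b = b \<otimes> v" by auto
      have "u \<otimes> v \<otimes> b = b \<otimes> (u \<otimes> v)" using u v b by (metis m_assoc)
      then show "u \<otimes> v \<in> {z \<in> topspace T. z \<otimes> b = b \<otimes> z}" using u v by simp
    qed (use b in auto)
  qed
  have xc: "x \<in> carrier G" "y \<in> carrier G" using x y cyc_subset_carrier[OF a] by auto
  have "y \<otimes> a = a \<otimes> y" using cent[OF a refl] y by blast
  then show ?thesis using cent[OF xc(2)] x by auto
qed

text \<open>The quotient by a compact normal subgroup enters only as a continuous surjective
  homomorphism under which compact sets have compact preimages. The sets \<open>gn k\<close> stand
  for the topological generators of the stages \<open>tw k\<close>, and inclusions between the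
  stages are recovered later from the lifts.\<close>

locale tower_lift = topgroup G T + Q: na_cgroup Q S
  for G :: "('a, 'b) monoid_scheme" (structure) and T :: "'a topology"
    and Q :: "('c, 'd) monoid_scheme" and S :: "'c topology" +
  fixes \<pi> :: "'a \<Rightarrow> 'c" and tw gn :: "nat \<Rightarrow> 'c set" and m :: "nat \<Rightarrow> int"
  assumes HT: "Hausdorff_space T" and lc: "locally_compact_space T"
    and hom: "\<pi> \<in> hom G Q" and surj: "\<pi> ` carrier G = carrier Q"
    and cont: "continuous_map T S \<pi>"
    and proper: "\<And>K. compactin S K \<Longrightarrow> compactin T {x \<in> carrier G. \<pi> x \<in> K}"
    and Qcomp: "\<And>b. b \<in> carrier Q \<Longrightarrow> compactin S (Q.cyc b)"
    and tw: "\<And>k. Q.opensub (tw k)" "\<And>k. compactin S (tw k)"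
    and gn: "\<And>k. closedin S (gn k)" "\<And>k. gn k \<noteq> {}" "\<And>k. gn k \<subseteq> tw k" "\<And>k w. w \<in> gn k \<Longrightarrow> tw k \<subseteq> Q.cyc w"
    and m_coprime: "\<And>k p. Factorial_Ring.prime p \<Longrightarrow> p \<noteq> k \<Longrightarrow> coprime (m k) (int p)"
    and m_pow: "\<And>k x. x \<in> gn (Suc k) \<Longrightarrow> x [^]\<^bsub>Q\<^esub> m k \<in> gn k"
    and m_dvd: "\<And>k x j. x \<in> gn (Suc k) \<Longrightarrow> x [^]\<^bsub>Q\<^esub> j \<in> tw k \<Longrightarrow> m k dvd j"
    and exhaust: "\<And>x. x \<in> carrier Q \<Longrightarrow> \<exists>k. x \<in> tw k"
begin

lemma group_hom_pi: "group_hom G Q \<pi>"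
  using hom by unfold_locales

lemma pi_pow: "x \<in> carrier G \<Longrightarrow> \<pi> (x [^] (k::int)) = \<pi> x [^]\<^bsub>Q\<^esub> k"
  by (rule group_hom.hom_int_pow[OF group_hom_pi])

lemma pi_carrier: "x \<in> carrier G \<Longrightarrow> \<pi> x \<in> carrier Q"
  using group_hom.hom_closed[OF group_hom_pi] .

definition Gs :: "nat \<Rightarrow> 'a set" where "Gs k = {x \<in> carrier G. \<pi> x \<in> tw k}"

lemma subgroup_Gs: "subgroup (Gs k) G"
proof (rule subgroupI)
  interpret pi: group_hom G Q \<pi> by (rule group_hom_pi)
  have st: "subgroup (tw k) Q" using tw by simp
  show "Gs k \<subseteq> carrier G" by (auto simp: Gs_def)
  have "\<one> \<in> Gs k" using subgroup.one_closed[OF st] by (simp add: Gs_def)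
  then show "Gs k \<noteq> {}" by blast
  show "inv a \<in> Gs k" if "a \<in> Gs k" for a using that subgroup.m_inv_closed[OF st] by (simp add: Gs_def)
  show "a \<otimes> b \<in> Gs k" if "a \<in> Gs k" "b \<in> Gs k" for a b
    using that subgroup.m_closed[OF st] by (simp add: Gs_def)
qed

lemma openin_Gs: "openin T (Gs k)"
  using openin_continuous_map_preimage[OF cont] tw unfolding Gs_def by simp

lemma closedin_Gs: "closedin T (Gs k)"
  using open_subgroup_closed[OF subgroup_Gs openin_Gs] .

lemma compactin_Gs: "compactin T (Gs k)"
  unfolding Gs_def by (rule proper[OF tw(2)])

lemma lifts_exist:
  obtains g where "\<And>k. g k \<in> carrier G" "\<And>k. \<pi> (g k) \<in> gn k" "\<And>k. g (Suc k) [^] m k = g k"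
proof -
  define C where "C k = {x \<in> carrier G. \<pi> x \<in> gn k}" for k
  have gnc: "gn k \<subseteq> carrier Q" for k using closedin_subset[OF gn(1)] by simp
  have "compactin S (gn k)" for k using closed_compactin[OF tw(2) gn(3) gn(1)] .
  then have C1: "compactin T (C k)" for k unfolding C_def by (rule proper)
  have C2: "C k \<noteq> {}" for k
  proof -
    obtain w where w: "w \<in> gn k" using gn(2)[of k] by blast
    then have "w \<in> \<pi> ` carrier G" using gnc unfolding surj by blast
    then obtain x where "x \<in> carrier G" "w = \<pi> x" by (rule imageE)
    with w show ?thesis unfolding C_def by blast
  qed
  have cp: "continuous_map T T (\<lambda>x. x [^] m k)" for k
    using continuous_map_int_pow[OF continuous_map_id] by simp
  have st: "x [^] m k \<in> C k" if "x \<in> C (Suc k)" for x k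
    using that m_pow pi_pow unfolding C_def by simp
  obtain x where x: "\<forall>k. x k \<in> C k" "\<forall>k. x (Suc k) [^] m k = x k"
    using compact_inverse_limit[of T C "\<lambda>k x. x [^] m k", OF HT C1 C2 cp st] by blast
  show ?thesis
    by (rule that[of x]) (use x in \<open>simp_all add: C_def\<close>)
qed

lemma compact_cyc_Gs:
  assumes "x \<in> Gs k"
  shows "compactin T (cyc x)" "cyc x \<subseteq> Gs k"
proof -
  show "cyc x \<subseteq> Gs k" by (rule cyc_minimal[OF subgroup_Gs closedin_Gs assms])
  then show "compactin T (cyc x)" using closed_compactin[OF compactin_Gs] by simp
qed

text \<open>Everything follows from uniqueness of limits: in \<open>Q\<close> the powers of
  \<open>\<pi> (g k)\<close> converge both to \<open>\<pi> (d k)\<close> and to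
  \<open>\<pi> (g k)\<close> itself, and in \<open>G\<close> the powers of \<open>g k\<close>
  converge both to \<open>d k\<close> and to the power of \<open>d (Suc k)\<close> with exponent
  \<open>m k\<close>.\<close>

lemma profinite_lifts_exist:
  obtains d where "\<And>k. d k \<in> carrier G" "\<And>k. \<pi> (d k) \<in> gn k" "\<And>k. d (Suc k) [^] m k = d k"
    "\<And>k U. openin T U \<Longrightarrow> \<one> \<in> U \<Longrightarrow> \<exists>n::int>0. \<forall>j::int. d k [^] (n * j) \<in> U"
proof -
  obtain g where g: "\<And>k. g k \<in> carrier G" "\<And>k. \<pi> (g k) \<in> gn k" "\<And>k. g (Suc k) [^] m k = g k"
    using lifts_exist by blast
  obtain F :: "int filter" where F: "F \<noteq> bot" "\<And>q::int. q > 0 \<Longrightarrow> \<forall>\<^sub>F n in F. q dvd n - 1"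
    "\<And>\<theta>::real. \<exists>c::rat. tendsto (\<lambda>n. cis (2 * pi * of_int n * \<theta>)) (cis (2 * pi * of_rat c)) F"
    using bohr_filter by blast
  have gG: "g k \<in> Gs k" for k using g gn(3) unfolding Gs_def by blast
  have "\<forall>k. \<exists>y. y \<in> cyc (g k) \<and> limitin T (\<lambda>n. g k [^] n) y F \<and>
      (\<forall>U. openin T U \<longrightarrow> \<one> \<in> U \<longrightarrow> (\<exists>n::int>0. \<forall>j::int. y [^] (n * j) \<in> U))"
  proof
    fix k
    obtain y where "y \<in> cyc (g k)" "limitin T (\<lambda>n. g k [^] n) y F"
      "\<And>U. openin T U \<Longrightarrow> \<one> \<in> U \<Longrightarrow> \<exists>n::int>0. \<forall>j::int. y [^] (n * j) \<in> U"
      using bohr_limit[OF g(1)[of k] compact_cyc_Gs(1)[OF gG[of k]] F(1,3)] by blast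
    then show "\<exists>y. y \<in> cyc (g k) \<and> limitin T (\<lambda>n. g k [^] n) y F \<and>
      (\<forall>U. openin T U \<longrightarrow> \<one> \<in> U \<longrightarrow> (\<exists>n::int>0. \<forall>j::int. y [^] (n * j) \<in> U))" by blast
  qed
  from choice[OF this] obtain d where d: "\<forall>k. d k \<in> cyc (g k) \<and> limitin T (\<lambda>n. g k [^] n) (d k) F \<and>
      (\<forall>U. openin T U \<longrightarrow> \<one> \<in> U \<longrightarrow> (\<exists>n::int>0. \<forall>j::int. d k [^] (n * j) \<in> U))" by (rule exE)
  have lim: "limitin T (\<lambda>n. g k [^] n) (d k) F" for k using d by blast
  show ?thesis
  proof (rule that[of d])
    show dc: "d k \<in> carrier G" for k using d cyc_subset_carrier[OF g(1)] by blast
    show "\<pi> (d k) \<in> gn k" for k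
    proof -
      have "limitin S (\<pi> \<circ> (\<lambda>n. g k [^] n)) (\<pi> (d k)) F" using continuous_map_limit[OF cont lim] .
      then have "limitin S (\<lambda>n. \<pi> (g k) [^]\<^bsub>Q\<^esub> n) (\<pi> (d k)) F" using g(1) by (simp add: o_def pi_pow)
      moreover have "\<pi> (g k) \<in> carrier Q" using g(1) pi_carrier by simp
      then have "limitin S (\<lambda>n. \<pi> (g k) [^]\<^bsub>Q\<^esub> n) (\<pi> (g k)) F"
        using Q.limit_powers_self[OF _ Qcomp F(2)] by blast
      ultimately have "\<pi> (d k) = \<pi> (g k)" using F(1) Q.Hausdorff by (rule limitin_Hausdorff_unique)
      then show ?thesis using g(2) by simp
    qed
    show "d (Suc k) [^] m k = d k" for k
    proof -
      have "limitin T ((\<lambda>x. x [^] m k) \<circ> (\<lambda>n. g (Suc k) [^] n)) (d (Suc k) [^] m k) F"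
        using continuous_map_limit[OF continuous_map_int_pow[OF continuous_map_id] lim] by simp
      moreover have "(\<lambda>x. x [^] m k) \<circ> (\<lambda>n. g (Suc k) [^] n) = (\<lambda>n::int. g k [^] n)"
      proof
        fix n :: int
        have "(g (Suc k) [^] n) [^] m k = (g (Suc k) [^] m k) [^] n" using g(1) by (simp add: int_pow_pow mult.commute)
        then show "((\<lambda>x. x [^] m k) \<circ> (\<lambda>n. g (Suc k) [^] n)) n = g k [^] n" using g(3) by simp
      qed
      ultimately have "limitin T (\<lambda>n. g k [^] n) (d (Suc k) [^] m k) F" by simp
      then show ?thesis using lim F(1) HT by (rule limitin_Hausdorff_unique)
    qed
    show "\<exists>n::int>0. \<forall>j::int. d k [^] (n * j) \<in> U" if "openin T U" "\<one> \<in> U" for k U using d that by blast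
  qed
qed

end

section \<open>The supplement generated by a coherent system of profinite lifts\<close>

locale tower_lifted = tower_lift +
  fixes d :: "nat \<Rightarrow> 'a"
  assumes d_carrier: "\<And>k. d k \<in> carrier G"
    and d_gn: "\<And>k. \<pi> (d k) \<in> gn k"
    and d_pow: "\<And>k. d (Suc k) [^] m k = d k"
    and d_small: "\<And>k U. openin T U \<Longrightarrow> \<one> \<in> U \<Longrightarrow> \<exists>n::int>0. \<forall>j::int. d k [^] (n * j) \<in> U"
begin

definition Hk :: "nat \<Rightarrow> 'a set" where "Hk k = cyc (d k)"

definition HH :: "'a set" where "HH = (\<Union>k. Hk k)"

lemma d_Gs: "d k \<in> Gs k"
  using d_carrier d_gn gn(3) unfolding Gs_def by blast

lemma Hk_subgroup: "subgroup (Hk k) G"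
  unfolding Hk_def by (rule subgroup_cyc[OF d_carrier])

lemma Hk_closed: "closedin T (Hk k)"
  unfolding Hk_def by simp

lemma Hk_compact: "compactin T (Hk k)"
  unfolding Hk_def by (rule compact_cyc_Gs(1)[OF d_Gs])

lemma Hk_Gs: "Hk k \<subseteq> Gs k"
  unfolding Hk_def by (rule compact_cyc_Gs(2)[OF d_Gs])

lemma Hk_Suc: "Hk k \<subseteq> Hk (Suc k)"
proof -
  have "d k \<in> Hk (Suc k)" using pow_in_cyc[OF d_carrier, of "Suc k" "m k"] d_pow unfolding Hk_def by simp
  then show ?thesis unfolding Hk_def[of k] by (rule cyc_minimal[OF Hk_subgroup Hk_closed])
qed

lemma Hk_mono: "i \<le> j \<Longrightarrow> Hk i \<subseteq> Hk j"
  using lift_Suc_mono_le[of Hk, OF Hk_Suc] .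

text \<open>Powers of \<open>d (Suc k)\<close> close to \<open>x\<close> lie in the open subgroup
  \<open>Gs k\<close>. Their images in \<open>Q\<close> lie in \<open>tw k\<close>, so their
  exponents are multiples of \<open>m k\<close> and they are powers of \<open>d k\<close>.\<close>

lemma Hk_Suc_Gs:
  assumes "x \<in> Hk (Suc k)" "x \<in> Gs k"
  shows "x \<in> Hk k"
  unfolding Hk_def in_cyc_iff[OF d_carrier]
proof (intro conjI allI impI)
  show xc: "x \<in> carrier G" using assms(2) unfolding Gs_def by blast
  fix U assume U: "openin T U \<and> \<one> \<in> U"
  have U': "openin T (U \<inter> Gs k)" "\<one> \<in> U \<inter> Gs k"
    using U openin_Gs openin_Int subgroup.one_closed[OF subgroup_Gs] by auto
  obtain u and j :: int where u: "u \<in> U \<inter> Gs k" "x \<otimes> u = d (Suc k) [^] j"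
    using iffD1[OF in_cyc_iff[OF d_carrier] assms(1)[unfolded Hk_def], THEN conjunct2, rule_format, OF conjI[OF U']] by blast
  have "x \<otimes> u \<in> Gs k" using subgroup.m_closed[OF subgroup_Gs assms(2)] u(1) by blast
  then have "\<pi> (d (Suc k)) [^]\<^bsub>Q\<^esub> j \<in> tw k" unfolding u(2) Gs_def using pi_pow[OF d_carrier] by simp
  then have "m k dvd j" by (rule m_dvd[OF d_gn])
  then obtain c where "j = m k * c" by blast
  then have "d (Suc k) [^] j = d k [^] c" using d_carrier[of "Suc k"] d_pow[of k] by (metis int_pow_pow)
  then have "x \<otimes> u = d k [^] c" using u(2) by simp
  then show "\<exists>u\<in>U. \<exists>k'::int. x \<otimes> u = d k [^] k'" using u(1) by blast
qed

lemma Hk_Gs_le: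
  assumes "k \<le> j" "x \<in> Hk j" "x \<in> Gs k"
  shows "x \<in> Hk k"
  using assms(1,2)
proof (induction j rule: dec_induct)
  case base then show ?case .
next
  case (step n)
  have st: "subgroup (tw k) Q" using tw by simp
  \<comment> \<open>That \<open>tw k\<close> lies in \<open>tw n\<close> is read off the lifts:
    \<open>d k\<close> belongs to \<open>Hk n\<close>, so its image lies in \<open>tw n\<close>, and
    this image generates \<open>tw k\<close>.\<close>
  have "x \<in> Gs n"
  proof -
    have "d k \<in> Gs n" using Hk_mono[OF step(1)] self_in_cyc[OF d_carrier, of k] Hk_Gs[of n] unfolding Hk_def by blast
    then have dk: "\<pi> (d k) \<in> tw n" unfolding Gs_def by simp
    have "Q.cyc (\<pi> (d k)) \<subseteq> tw n"
      using Q.cyc_minimal[OF _ _ dk] tw(1)[of n] Q.open_subgroup_closed[of "tw n"] by simp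
    then have "tw k \<subseteq> tw n" using gn(4)[OF d_gn] by blast
    then show ?thesis using assms(3) unfolding Gs_def by blast
  qed
  then show ?case using step.IH Hk_Suc_Gs[OF step.prems] by blast
qed

lemma HH_Gs: "x \<in> HH \<Longrightarrow> x \<in> Gs k \<Longrightarrow> x \<in> Hk k"
proof -
  assume x: "x \<in> HH" "x \<in> Gs k"
  then obtain j where "x \<in> Hk j" unfolding HH_def by blast
  then have "x \<in> Hk (max k j)" using Hk_mono[of j "max k j"] by auto
  then show "x \<in> Hk k" using Hk_Gs_le[of k "max k j"] x by simp
qed

lemma HH_subgroup: "subgroup HH G"
proof (rule subgroupI)
  show "HH \<subseteq> carrier G" unfolding HH_def using subgroup.subset[OF Hk_subgroup] by blast
  have "\<one> \<in> HH" unfolding HH_def using subgroup.one_closed[OF Hk_subgroup] by blast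
  then show "HH \<noteq> {}" by blast
  show "inv a \<in> HH" if "a \<in> HH" for a
    using that subgroup.m_inv_closed[OF Hk_subgroup] unfolding HH_def by blast
  show "a \<otimes> b \<in> HH" if ab: "a \<in> HH" "b \<in> HH" for a b
  proof -
    obtain i j where "a \<in> Hk i" "b \<in> Hk j" using ab unfolding HH_def by blast
    then have "a \<in> Hk (max i j)" "b \<in> Hk (max i j)" using Hk_mono[of i "max i j"] Hk_mono[of j "max i j"] by auto
    then have "a \<otimes> b \<in> Hk (max i j)" by (rule subgroup.m_closed[OF Hk_subgroup])
    then show ?thesis unfolding HH_def by blast
  qed
qed

lemma HH_carrier: "x \<in> HH \<Longrightarrow> x \<in> carrier G"
  using subgroup.subset[OF HH_subgroup] by blast

lemma HH_comm:
  assumes "a \<in> HH" "b \<in> HH"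
  shows "a \<otimes> b = b \<otimes> a"
proof -
  obtain i j where "a \<in> Hk i" "b \<in> Hk j" using assms unfolding HH_def by blast
  then have "a \<in> Hk (max i j)" "b \<in> Hk (max i j)" using Hk_mono[of i "max i j"] Hk_mono[of j "max i j"] by auto
  then show ?thesis unfolding Hk_def using cyc_comm[OF HT d_carrier] by blast
qed

text \<open>The subgroup meets the open subgroup \<open>Gs 0\<close> in the closed set
  \<open>Hk 0\<close>, and a locally closed subgroup is closed. A limit point \<open>x\<close> is
  moved into \<open>Gs 0\<close> by an element \<open>y\<close> of \<open>HH\<close> close to
  it.\<close>

lemma HH_closed: "closedin T HH"
proof -
  have Hc: "HH \<subseteq> carrier G" using HH_carrier by blast
  have "cl HH \<subseteq> HH"
  proof
    fix x assume x: "x \<in> cl HH"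
    then have xc: "x \<in> carrier G" using closure_of_subset_topspace[of T HH] by auto
    note near = iffD1[OF in_closure_of_iff[OF xc Hc] x, rule_format]
    obtain u where u: "u \<in> Gs 0" "x \<otimes> u \<in> HH"
      using near[OF conjI[OF openin_Gs subgroup.one_closed[OF subgroup_Gs]]] by blast
    define y where "y = x \<otimes> u"
    have uc: "u \<in> carrier G" using u(1) unfolding Gs_def by blast
    have yc: "y \<in> carrier G" unfolding y_def using xc uc by simp
    define v where "v = inv y \<otimes> x"
    have v: "v = inv u" unfolding v_def y_def using xc uc by (simp add: inv_mult_group m_assoc)
    have vG: "v \<in> Gs 0" unfolding v using subgroup.m_inv_closed[OF subgroup_Gs u(1)] .
    have vc: "v \<in> carrier G" using vG unfolding Gs_def by blast
    have "v \<in> cl (Hk 0)" unfolding in_closure_of_iff[OF vc subgroup.subset[OF Hk_subgroup]]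
    proof (intro allI impI)
      fix U assume U: "openin T U \<and> \<one> \<in> U"
      have U': "openin T (U \<inter> Gs 0)" "\<one> \<in> U \<inter> Gs 0"
        using U openin_Gs openin_Int subgroup.one_closed[OF subgroup_Gs] by auto
      obtain u' where u': "u' \<in> U \<inter> Gs 0" "x \<otimes> u' \<in> HH" using near[OF conjI[OF U']] by blast
      have u'c: "u' \<in> carrier G" using u'(1) unfolding Gs_def by blast
      have "inv y \<otimes> (x \<otimes> u') \<in> HH"
        using subgroup.m_closed[OF HH_subgroup subgroup.m_inv_closed[OF HH_subgroup]] u(2) u'(2) unfolding y_def by blast
      moreover have "inv y \<otimes> (x \<otimes> u') = v \<otimes> u'" unfolding v_def using xc yc u'c by (simp add: m_assoc)
      moreover have "v \<otimes> u' \<in> Gs 0" using subgroup.m_closed[OF subgroup_Gs vG] u'(1) by blast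
      ultimately have "v \<otimes> u' \<in> Hk 0" using HH_Gs by simp
      then show "\<exists>u\<in>U. v \<otimes> u \<in> Hk 0" using u'(1) by blast
    qed
    then have "v \<in> Hk 0" using closure_of_closedin[OF Hk_closed] by simp
    then have "v \<in> HH" unfolding HH_def by blast
    then have "y \<otimes> v \<in> HH" using subgroup.m_closed[OF HH_subgroup] u(2) unfolding y_def by blast
    moreover have "y \<otimes> v = x" unfolding v_def using xc yc by (simp flip: m_assoc)
    ultimately show "x \<in> HH" by simp
  qed
  then show ?thesis using closure_of_subset_eq[of HH T] Hc by simp
qed

abbreviation "GH \<equiv> G\<lparr>carrier := HH\<rparr>"
abbreviation "TH \<equiv> subtopology T HH"

text \<open>All powers of a suitable \<open>d 0 [^] n\<close> are small, hence so is the closure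
  \<open>N\<close> of the group they form. It is covered together with \<open>Hk 0\<close> by the
  \<open>n\<close> cosets of the powers of \<open>d 0\<close> below \<open>n\<close>, so
  \<open>N\<close> is a closed subgroup of finite index in \<open>Hk 0\<close>, which is open in
  \<open>HH\<close>.\<close>

lemma small_subgroup_HH:
  assumes U: "openin T U" "\<one> \<in> U"
  obtains N where "subgroup N G" "N \<subseteq> U" "N \<subseteq> HH" "openin TH N"
proof -
  obtain V where V: "openin T V" "\<one> \<in> V" "\<And>a b. a \<in> V \<Longrightarrow> b \<in> V \<Longrightarrow> a \<otimes> b \<in> U" "\<And>a. a \<in> V \<Longrightarrow> inv a \<in> V"
    using nbhd_mult_sym[OF U] by blast
  obtain n :: int where n: "n > 0" "\<forall>j::int. d 0 [^] (n * j) \<in> V" using d_small[OF V(1,2), of 0] by blast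
  define e where "e = d 0 [^] n"
  have ec: "e \<in> carrier G" unfolding e_def using d_carrier by simp
  have ej: "e [^] (j::int) = d 0 [^] (n * j)" for j unfolding e_def using d_carrier by (simp add: int_pow_pow)
  define N where "N = cyc e"
  have sN: "subgroup N G" unfolding N_def by (rule subgroup_cyc[OF ec])
  have NU: "N \<subseteq> U"
  proof
    fix x assume x: "x \<in> N"
    obtain u and j :: int where u: "u \<in> V" "x \<otimes> u = e [^] j"
      using iffD1[OF in_cyc_iff[OF ec] x[unfolded N_def], THEN conjunct2, rule_format, OF conjI[OF V(1,2)]] by blast
    have xc: "x \<in> carrier G" "u \<in> carrier G" using x subgroup.subset[OF sN] openin_carrier[OF V(1) u(1)] by auto
    have "(x \<otimes> u) \<otimes> inv u \<in> U" unfolding u(2) ej using n(2) u(1) V(3,4) by simp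
    then show "x \<in> U" using xc by (simp add: m_assoc)
  qed
  have NH0: "N \<subseteq> Hk 0"
    unfolding N_def by (rule cyc_minimal[OF Hk_subgroup Hk_closed])
      (use pow_in_cyc[OF d_carrier, of 0 n] in \<open>simp add: e_def Hk_def\<close>)
  then have NH: "N \<subseteq> HH" unfolding HH_def by blast
  define Ci where "Ci i = {y \<in> carrier G. inv (d 0 [^] (i::int)) \<otimes> y \<in> N}" for i
  have Ncl: "closedin T N" unfolding N_def by simp
  have Cicl: "closedin T (Ci i)" for i unfolding Ci_def using closedin_translate[OF Ncl] d_carrier by simp
  \<comment> \<open>The union of the cosets other than \<open>N\<close> is a finite union of closed
    sets; removing it from \<open>Gs 0\<close> exhibits \<open>N\<close> as relatively open.\<close>
  define R where "R = (\<Union>i\<in>{0..<n} \<inter> {i. d 0 [^] i \<notin> N}. Ci i)"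
  have Rcl: "closedin T R" unfolding R_def using Cicl by (intro closedin_Union) auto
  have NR: "N \<inter> R = {}"
  proof (rule ccontr)
    assume "N \<inter> R \<noteq> {}"
    then obtain y i where y: "y \<in> N" "d 0 [^] (i::int) \<notin> N" "inv (d 0 [^] i) \<otimes> y \<in> N" unfolding R_def Ci_def by blast
    have yc: "y \<in> carrier G" using y(1) subgroup.subset[OF sN] by blast
    have "y \<otimes> inv (inv (d 0 [^] i) \<otimes> y) \<in> N"
      using subgroup.m_closed[OF sN y(1) subgroup.m_inv_closed[OF sN y(3)]] .
    then have "d 0 [^] i \<in> N" using yc d_carrier by (simp add: inv_mult_group flip: m_assoc)
    with y(2) show False by simp
  qed
  have cover: "Hk 0 \<subseteq> (\<Union>i\<in>{0..<n}. Ci i)"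
    unfolding Hk_def
  proof (rule closure_of_minimal)
    show "closedin T (\<Union>i\<in>{0..<n}. Ci i)" using Cicl by (intro closedin_Union) auto
    show "generate G {d 0} \<subseteq> (\<Union>i\<in>{0..<n}. Ci i)"
    proof
      fix y assume "y \<in> generate G {d 0}"
      then obtain k :: int where k: "y = d 0 [^] k" using generate_eq[OF d_carrier] by auto
      have "inv (d 0 [^] (k mod n)) \<otimes> d 0 [^] k = d 0 [^] (- (k mod n) + k)"
        by (simp only: int_pow_mult[OF d_carrier] int_pow_neg[OF d_carrier])
      also have "- (k mod n) + k = n * (k div n)" by (simp add: minus_mod_eq_mult_div)
      also have "d 0 [^] (n * (k div n)) = e [^] (k div n)" by (simp add: ej)
      finally have "y \<in> Ci (k mod n)" unfolding Ci_def N_def k using pow_in_cyc[OF ec] d_carrier by simp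
      moreover have "k mod n \<in> {0..<n}" using n(1) by simp
      ultimately show "y \<in> (\<Union>i\<in>{0..<n}. Ci i)" by blast
    qed
  qed
  have "N = HH \<inter> (Gs 0 - R)"
  proof
    show "N \<subseteq> HH \<inter> (Gs 0 - R)" using NH NH0 Hk_Gs[of 0] NR by blast
    show "HH \<inter> (Gs 0 - R) \<subseteq> N"
    proof
      fix x assume x: "x \<in> HH \<inter> (Gs 0 - R)"
      then have "x \<in> Hk 0" using HH_Gs by blast
      then obtain i where i: "i \<in> {0..<n}" "x \<in> Ci i" using cover by blast
      then have iN: "d 0 [^] i \<in> N" using x unfolding R_def by blast
      have xi: "x \<in> carrier G" "inv (d 0 [^] i) \<otimes> x \<in> N" using i(2) unfolding Ci_def by auto
      have "d 0 [^] i \<otimes> (inv (d 0 [^] i) \<otimes> x) \<in> N" using subgroup.m_closed[OF sN iN xi(2)] .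
      then show "x \<in> N" using xi(1) d_carrier by (simp flip: m_assoc)
    qed
  qed
  moreover have "openin T (Gs 0 - R)" using openin_Gs Rcl by (rule openin_diff)
  ultimately have "openin TH N" unfolding openin_subtopology by blast
  then show ?thesis using that sN NU NH by blast
qed

lemma na_cgroup_HH: "na_cgroup GH TH"
proof -
  interpret H: topgroup GH TH by (rule topgroup_subgroup[OF HH_subgroup])
  show ?thesis
  proof unfold_locales
    show "Hausdorff_space TH" using HT by (rule Hausdorff_space_subtopology)
    fix U assume U: "openin TH U" "\<one>\<^bsub>GH\<^esub> \<in> U"
    then obtain U0 where U0: "openin T U0" "U = U0 \<inter> HH" unfolding openin_subtopology by blast
    then have "\<one> \<in> U0" using U(2) by simp
    then obtain N where N: "subgroup N G" "N \<subseteq> U0" "N \<subseteq> HH" "openin TH N" using small_subgroup_HH[OF U0(1)] by blast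
    have "subgroup N GH" using subgroup_incl[OF N(1) HH_subgroup N(3)] .
    then show "\<exists>N. subgroup N GH \<and> openin TH N \<and> N \<subseteq> U" using N U0(2) by blast
  next
    show "\<And>x y. x \<in> carrier GH \<Longrightarrow> y \<in> carrier GH \<Longrightarrow> x \<otimes>\<^bsub>GH\<^esub> y = y \<otimes>\<^bsub>GH\<^esub> x" using HH_comm by simp
  qed
qed

lemma cyc_HH:
  assumes "b \<in> HH"
  shows "TH closure_of generate GH {b} = cyc b"
proof -
  have "cyc b \<subseteq> HH" by (rule cyc_minimal[OF HH_subgroup HH_closed assms])
  moreover have "generate G {b} \<subseteq> HH" by (rule generate_subset_subgroup[OF HH_subgroup assms])
  ultimately show ?thesis
    unfolding generate_subgroup_eq[OF HH_subgroup assms] closure_of_subtopology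
    by (simp add: Int_absorb1)
qed

lemma compact_cyc_HH:
  assumes "b \<in> HH"
  shows "compactin TH (cyc b)"
proof -
  obtain k where "b \<in> Hk k" using assms unfolding HH_def by blast
  then have "b \<in> Gs k" using Hk_Gs by blast
  then have "compactin T (cyc b)" by (rule compact_cyc_Gs(1))
  moreover have "cyc b \<subseteq> HH" by (rule cyc_minimal[OF HH_subgroup HH_closed assms])
  ultimately show ?thesis by (rule compact_imp_compactin_subtopology)
qed

text \<open>The steps of the tower after step \<open>p\<close> have index prime to \<open>p\<close>,
  so all p-elements of \<open>HH\<close> lie in \<open>Hk (Suc p)\<close>. The primary component is
  then the closure of the powers of a single element, the p-part of
  \<open>d (Suc p)\<close>.\<close>

lemma Pi_procyclic_HH: "Pi_procyclic GH TH"
proof -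
  interpret H: na_cgroup GH TH by (rule na_cgroup_HH)
  have comp: "compactin TH (H.cyc b)" if "b \<in> carrier GH" for b
    using that compact_cyc_HH cyc_HH by simp
  have pw: "b [^]\<^bsub>GH\<^esub> (k::int) = b [^] k" if "b \<in> HH" for b k by (rule int_pow_subgroup_eq[OF HH_subgroup that])
  have "topological_group GH TH" using H.topgroup_axioms topgroup_iff by blast
  then have per: "periodic_group GH TH"
    unfolding periodic_group_def locally_compact_group_def
    using H.Hausdorff locally_compact_space_closed_subset[OF lc HH_closed] H.totally_disconnected comp by blast
  have "finite_cyclic_p_group (GH\<lparr>carrier := primary_component GH TH p\<rparr>) p \<or>
        top_group_isomorphic (GH\<lparr>carrier := primary_component GH TH p\<rparr>)
          (subtopology TH (primary_component GH TH p)) (Zp p) (Zp_topology p)"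
    if p: "Factorial_Ring.prime p" for p
  proof -
    define a where "a = d (Suc p)"
    have aH: "a \<in> HH" unfolding a_def HH_def using self_in_cyc[OF d_carrier] unfolding Hk_def by blast
    then have ac: "a \<in> carrier GH" by simp
    obtain e where e: "e \<in> H.cyc a" "H.p_elt p e"
      "\<And>N b. H.opensub N \<Longrightarrow> \<exists>t::int. int p ^ b dvd t - 1 \<and> H.cg N (a [^]\<^bsub>GH\<^esub> t) e"
      using H.p_part_exists[OF ac comp[OF ac] p] by blast
    have ec: "e \<in> carrier GH" using e(2) by (rule H.p_elt_carrier)
    have H0: "H.opensub (Hk 0)"
    proof
      have sub: "Hk 0 \<subseteq> HH" unfolding HH_def by blast
      show "subgroup (Hk 0) GH" using subgroup_incl[OF Hk_subgroup HH_subgroup sub] .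
      have "Hk 0 = HH \<inter> Gs 0" using sub Hk_Gs[of 0] HH_Gs by blast
      then show "openin TH (Hk 0)" unfolding openin_subtopology using openin_Gs by blast
    qed
    \<comment> \<open>Going down from \<open>Hk (Suc k)\<close>, the power of \<open>b\<close> with
      exponent \<open>m k\<close> lies in \<open>Hk k\<close>, and so does one with exponent a power
      of \<open>p\<close>, since \<open>Hk 0\<close> is open in \<open>HH\<close>. For
      \<open>k > p\<close> these exponents are coprime. The descent stops at \<open>Suc p\<close>
      because step \<open>p\<close> itself may have index divisible by \<open>p\<close>.\<close>
    have descend: "b \<in> Hk (Suc p)" if b: "H.p_elt p b" for b
    proof -
      have bH: "b \<in> HH" using H.p_elt_carrier[OF b] by simp
      then have bc: "b \<in> carrier G" by (rule HH_carrier)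
      obtain i where i: "b [^] (int p ^ i) \<in> Hk 0" using b H0 pw[OF bH] unfolding H.p_elt_def by auto
      obtain k0 where "b \<in> Hk k0" using bH unfolding HH_def by blast
      then have "b \<in> Hk (max k0 (Suc p))" using Hk_mono[of k0 "max k0 (Suc p)"] by auto
      moreover have "Suc p \<le> max k0 (Suc p)" by simp
      moreover have "Suc p \<le> k \<Longrightarrow> b \<in> Hk k \<Longrightarrow> b \<in> Hk (Suc p)" for k
      proof (induction k rule: dec_induct)
        case base then show ?case .
      next
        case (step k)
        have "b [^] m k \<in> cyc (d (Suc k) [^] m k)"
          using cyc_pow_image[OF d_carrier] step.prems unfolding Hk_def by blast
        then have bm: "b [^] m k \<in> Hk k" unfolding d_pow Hk_def .
        have bp: "b [^] (int p ^ i) \<in> Hk k" using i Hk_mono[of 0 k] by blast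
        have "p \<noteq> k" using step.hyps by simp
        then have "coprime (m k) (int p ^ i)" using m_coprime[OF p] by simp
        then obtain u v where uv: "u * m k + v * int p ^ i = 1" by (metis bezout_int coprime_iff_gcd_eq_1)
        have "(b [^] m k) [^] u \<otimes> (b [^] (int p ^ i)) [^] v \<in> Hk k"
          using subgroup.m_closed[OF Hk_subgroup subgroup_int_pow_closed[OF Hk_subgroup bm] subgroup_int_pow_closed[OF Hk_subgroup bp]] .
        moreover have "(b [^] m k) [^] u \<otimes> (b [^] (int p ^ i)) [^] v = b [^] (u * m k + v * int p ^ i)"
          using bc by (simp add: int_pow_pow int_pow_mult mult.commute)
        ultimately have "b \<in> Hk k" using uv bc by simp
        then show ?case using step.IH by blast
      qed
      ultimately show ?thesis by blast
    qed
    have "{b. H.p_elt p b} = H.cyc e"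
    proof
      show "{b. H.p_elt p b} \<subseteq> H.cyc e"
      proof
        fix b assume "b \<in> {b. H.p_elt p b}"
        then have b: "H.p_elt p b" by simp
        have "b \<in> H.cyc a" using descend[OF b] cyc_HH[OF aH] unfolding Hk_def a_def by simp
        then show "b \<in> H.cyc e" using H.p_elt_in_cyc_p_part[OF ac ec e(3) _ b] by blast
      qed
      show "H.cyc e \<subseteq> {b. H.p_elt p b}" using H.p_elt_cyc[OF e(2)] by blast
    qed
    then have "primary_component GH TH p = H.cyc e" using H.primary_component_eq[OF comp p] by simp
    then show ?thesis using H.cyc_p_elt_cases[OF e(2) comp[OF ec] p] by simp
  qed
  then show ?thesis unfolding Pi_procyclic_def using per H.comm_group_axioms by blast
qed

text \<open>The image of the compact group \<open>Hk k\<close> is a closed subgroup of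
  \<open>Q\<close> containing a topological generator of \<open>tw k\<close>, and the stages
  \<open>tw k\<close> exhaust \<open>Q\<close>.\<close>

lemma HH_supplement:
  assumes "x \<in> carrier G"
  shows "\<exists>y\<in>HH. \<pi> y = \<pi> x"
proof -
  interpret pi: group_hom G Q \<pi> by (rule group_hom_pi)
  obtain k where k: "\<pi> x \<in> tw k" using exhaust[OF pi_carrier[OF assms]] by blast
  have "compactin S (\<pi> ` Hk k)" by (rule image_compactin[OF Hk_compact cont])
  then have "closedin S (\<pi> ` Hk k)" by (rule compactin_imp_closedin[OF Q.Hausdorff])
  moreover have "subgroup (\<pi> ` Hk k) Q" using pi.subgroup_img_is_subgroup[OF Hk_subgroup] .
  moreover have "\<pi> (d k) \<in> \<pi> ` Hk k" using self_in_cyc[OF d_carrier] unfolding Hk_def by blast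
  ultimately have "Q.cyc (\<pi> (d k)) \<subseteq> \<pi> ` Hk k" by (intro Q.cyc_minimal)
  then have "\<pi> x \<in> \<pi> ` Hk k" using gn(4)[OF d_gn] k by blast
  then obtain y where "y \<in> Hk k" "\<pi> y = \<pi> x" by (metis imageE)
  then show ?thesis unfolding HH_def by blast
qed

end

lemma (in tower_lift) supplement_exists:
  "\<exists>H. subgroup H G \<and> closedin T H \<and> Pi_procyclic (G\<lparr>carrier := H\<rparr>) (subtopology T H) \<and>
    (\<forall>x\<in>carrier G. \<exists>y\<in>H. \<pi> y = \<pi> x)"
proof -
  obtain d where d: "\<And>k. d k \<in> carrier G" "\<And>k. \<pi> (d k) \<in> gn k" "\<And>k. d (Suc k) [^] m k = d k"
    "\<And>k U. openin T U \<Longrightarrow> \<one> \<in> U \<Longrightarrow> \<exists>n::int>0. \<forall>j::int. d k [^] (n * j) \<in> U"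
    using profinite_lifts_exist by blast
  interpret tower_lifted G T Q S \<pi> tw gn m d by unfold_locales (use d in auto)
  show ?thesis using HH_subgroup HH_closed Pi_procyclic_HH HH_supplement by blast
qed

section \<open>Quotients by compact normal subgroups\<close>

lemma openin_quotient_topology:
  "openin (quotient_topology T R f) U \<longleftrightarrow> U \<subseteq> R \<and> openin T {x \<in> topspace T. f x \<in> U}"
proof -
  have "istopology (\<lambda>U. U \<subseteq> R \<and> openin T {x \<in> topspace T. f x \<in> U})"
    unfolding istopology_def
  proof (intro conjI allI impI)
    fix U V assume U: "U \<subseteq> R \<and> openin T {x \<in> topspace T. f x \<in> U}" and V: "V \<subseteq> R \<and> openin T {x \<in> topspace T. f x \<in> V}"
    then show "U \<inter> V \<subseteq> R" by blast
    have "{x \<in> topspace T. f x \<in> U \<inter> V} = {x \<in> topspace T. f x \<in> U} \<inter> {x \<in> topspace T. f x \<in> V}" by blast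
    then show "openin T {x \<in> topspace T. f x \<in> U \<inter> V}" using U V by auto
  next
    fix \<K> assume K: "\<forall>K\<in>\<K>. K \<subseteq> R \<and> openin T {x \<in> topspace T. f x \<in> K}"
    then show "\<Union> \<K> \<subseteq> R" by blast
    have "{x \<in> topspace T. f x \<in> \<Union> \<K>} = (\<Union>K\<in>\<K>. {x \<in> topspace T. f x \<in> K})" by blast
    then show "openin T {x \<in> topspace T. f x \<in> \<Union> \<K>}" using K by auto
  qed
  then show ?thesis unfolding quotient_topology_def by simp
qed

context topgroup begin

lemma topspace_quotient_group:
  shows "topspace (quotient_group_topology G T A) = rcosets A"
proof -
  have "openin (quotient_group_topology G T A) (rcosets A)"
    unfolding quotient_group_topology_def openin_quotient_topology
  proof
    have "{x \<in> topspace T. A #> x \<in> rcosets A} = topspace T" by (auto simp: RCOSETS_def)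
    then show "openin T {x \<in> topspace T. A #> x \<in> rcosets A}" by simp
  qed simp
  moreover have "U \<subseteq> rcosets A" if "openin (quotient_group_topology G T A) U" for U
    using that unfolding quotient_group_topology_def openin_quotient_topology by blast
  ultimately show ?thesis by (metis openin_subset openin_topspace subset_antisym)
qed

lemma continuous_map_quotient_group:
  "continuous_map T (quotient_group_topology G T A) (\<lambda>x. A #> x)"
  unfolding continuous_map_def topspace_quotient_group
  unfolding quotient_group_topology_def openin_quotient_topology by (auto simp: RCOSETS_def)

text \<open>For closed \<open>C\<close> the points \<open>y\<close> with
  \<open>a \<otimes> y \<in> C\<close> for some \<open>a \<in> A\<close> form the projection of a
  closed set along the compact factor \<open>A\<close>, hence a closed set. Fibres are translates of
  \<open>A\<close>.\<close>

lemma proper_map_quotient_group: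
  assumes A: "subgroup A G" "compactin T A"
  shows "proper_map T (quotient_group_topology G T A) (\<lambda>x. A #> x)"
  unfolding proper_map_def
proof (intro conjI ballI)
  define S where "S = quotient_group_topology G T A"
  have Ac: "A \<subseteq> carrier G" using subgroup.subset[OF A(1)] .
  show "closed_map T (quotient_group_topology G T A) (\<lambda>x. A #> x)"
    unfolding closed_map_def S_def[symmetric]
  proof (intro allI impI)
    fix C assume C: "closedin T C"
    have Cc: "C \<subseteq> carrier G" using closedin_subset[OF C] by simp
    define Y where "Y = subtopology T A"
    have tY: "topspace Y = A" unfolding Y_def using Ac by (simp add: Int_absorb1)
    have cf: "continuous_map (prod_topology Y T) T fst"
      using continuous_map_fst[of Y T] unfolding Y_def by (rule continuous_map_into_fulltopology)
    have "continuous_map (prod_topology Y T) T (\<lambda>z. fst z \<otimes> snd z)"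
      by (rule continuous_map_mult[OF cf continuous_map_snd])
    from closedin_continuous_map_preimage[OF this C]
    have "closedin (prod_topology Y T) {z \<in> topspace (prod_topology Y T). fst z \<otimes> snd z \<in> C}" .
    moreover have "compact_space Y" unfolding Y_def using A(2) by (rule compact_space_subtopology)
    ultimately have cl: "closedin T (snd ` {z \<in> topspace (prod_topology Y T). fst z \<otimes> snd z \<in> C})"
      using Abstract_Topological_Spaces.closed_map_snd[of Y T] unfolding closed_map_def by blast
    have eq: "snd ` {z \<in> topspace (prod_topology Y T). fst z \<otimes> snd z \<in> C} = {y \<in> carrier G. \<exists>a\<in>A. a \<otimes> y \<in> C}"
      by (force simp: tY)
    have pre: "{y \<in> carrier G. A #> y \<in> (\<lambda>x. A #> x) ` C} = {y \<in> carrier G. \<exists>a\<in>A. a \<otimes> y \<in> C}"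
    proof (rule Set.set_eqI)
      fix y
      have "A #> y \<in> (\<lambda>x. A #> x) ` C \<longleftrightarrow> (\<exists>a\<in>A. a \<otimes> y \<in> C)" if y: "y \<in> carrier G"
      proof
        assume "A #> y \<in> (\<lambda>x. A #> x) ` C"
        then obtain c where c: "c \<in> C" "A #> y = A #> c" by blast
        then have "c \<in> A #> y" using rcos_self[of c A] Cc A(1) by auto
        then show "\<exists>a\<in>A. a \<otimes> y \<in> C" using c(1) unfolding r_coset_def by auto
      next
        assume "\<exists>a\<in>A. a \<otimes> y \<in> C"
        then obtain a where a: "a \<in> A" "a \<otimes> y \<in> C" by blast
        have "a \<otimes> y \<in> A #> y" using a(1) unfolding r_coset_def by auto
        then have "A #> y = A #> (a \<otimes> y)" by (rule repr_independence[OF _ y A(1)])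
        then show "A #> y \<in> (\<lambda>x. A #> x) ` C" using a(2) by blast
      qed
      then show "y \<in> {y \<in> carrier G. A #> y \<in> (\<lambda>x. A #> x) ` C} \<longleftrightarrow> y \<in> {y \<in> carrier G. \<exists>a\<in>A. a \<otimes> y \<in> C}" by blast
    qed
    have sub: "(\<lambda>x. A #> x) ` C \<subseteq> rcosets A" using Cc by (auto simp: RCOSETS_def)
    have "openin S (rcosets A - (\<lambda>x. A #> x) ` C)"
      unfolding S_def quotient_group_topology_def openin_quotient_topology
    proof
      have "{x \<in> topspace T. A #> x \<in> rcosets A - (\<lambda>x. A #> x) ` C}
          = topspace T - {y \<in> carrier G. A #> y \<in> (\<lambda>x. A #> x) ` C}" by (auto simp: RCOSETS_def)
      also have "openin T \<dots>" unfolding pre using cl unfolding eq by (rule openin_diff[OF openin_topspace])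
      finally show "openin T {x \<in> topspace T. A #> x \<in> rcosets A - (\<lambda>x. A #> x) ` C}" .
    qed blast
    then show "closedin S ((\<lambda>x. A #> x) ` C)"
      unfolding closedin_def using sub topspace_quotient_group unfolding S_def by simp
  qed
  fix y assume "y \<in> topspace (quotient_group_topology G T A)"
  then obtain x where x: "x \<in> carrier G" "y = A #> x" unfolding topspace_quotient_group RCOSETS_def by blast
  have "{z \<in> topspace T. A #> z = y} = (\<lambda>a. a \<otimes> x) ` A"
  proof
    show "{z \<in> topspace T. A #> z = y} \<subseteq> (\<lambda>a. a \<otimes> x) ` A"
    proof
      fix z assume "z \<in> {z \<in> topspace T. A #> z = y}"
      then have "z \<in> A #> x" using rcos_self[of z A] A(1) x(2) by auto
      then show "z \<in> (\<lambda>a. a \<otimes> x) ` A" unfolding r_coset_def by blast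
    qed
    show "(\<lambda>a. a \<otimes> x) ` A \<subseteq> {z \<in> topspace T. A #> z = y}"
    proof
      fix z assume "z \<in> (\<lambda>a. a \<otimes> x) ` A"
      then have z: "z \<in> A #> x" "z \<in> carrier G" using Ac x(1) unfolding r_coset_def by auto
      then show "z \<in> {z \<in> topspace T. A #> z = y}" using repr_independence[OF z(1) x(1) A(1)] x(2) by simp
    qed
  qed
  moreover have "compactin T ((\<lambda>a. a \<otimes> x) ` A)"
    using x(1) by (intro image_compactin[OF A(2)] continuous_map_mult) auto
  ultimately show "compactin T {z \<in> topspace T. A #> z = y}" by simp
qed

end

section \<open>Application to a compact normal subgroup and its quotient\<close>

theorem theorem4p5:
  fixes G :: "('a, 'b) monoid_scheme" and T :: "'a topology" and A :: "'a set"
  assumes "locally_compact_group G T"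
    and "A \<lhd> G" and "compactin T A"
    and "Pi_procyclic (G Mod A) (quotient_group_topology G T A)"
  shows "\<exists>H. subgroup H G \<and> closedin T H \<and>
           Pi_procyclic (G\<lparr>carrier := H\<rparr>) (subtopology T H) \<and>
           carrier G = A <#>\<^bsub>G\<^esub> H"
proof -
  interpret G: topgroup G T
    using assms(1) unfolding locally_compact_group_def topgroup_iff by blast
  have HT: "Hausdorff_space T" and lc: "locally_compact_space T"
    using assms(1) unfolding locally_compact_group_def by auto
  interpret A: normal A G by fact
  define S where "S = quotient_group_topology G T A"
  have per: "periodic_group (G Mod A) S" and cg: "comm_group (G Mod A)"
    and pc: "\<And>p::nat. Factorial_Ring.prime p \<Longrightarrow>
        finite_cyclic_p_group ((G Mod A)\<lparr>carrier := primary_component (G Mod A) S p\<rparr>) p \<or>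
        top_group_isomorphic ((G Mod A)\<lparr>carrier := primary_component (G Mod A) S p\<rparr>)
          (subtopology S (primary_component (G Mod A) S p)) (Zp p) (Zp_topology p)"
    using assms(4) unfolding Pi_procyclic_def S_def by auto
  have lcQ: "topological_group (G Mod A) S" "Hausdorff_space S" "locally_compact_space S" "totally_disconnected_space S"
    and compQ: "\<And>b. b \<in> carrier (G Mod A) \<Longrightarrow> compactin S (S closure_of (generate (G Mod A) {b}))"
    using per unfolding periodic_group_def locally_compact_group_def by auto
  have "topgroup (G Mod A) S" using lcQ(1) topgroup_iff by blast
  then interpret Q: na_cgroup "G Mod A" S
    by (intro na_cgroup.intro topgroup.na_groupI_td lcQ cg)
  have "\<forall>p. \<exists>h. Factorial_Ring.prime p \<longrightarrow> Q.p_elt p h \<and> (\<forall>b. Q.p_elt p b \<longrightarrow> b \<in> Q.cyc h)"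
  proof (intro allI)
    fix p :: nat
    show "\<exists>h. Factorial_Ring.prime p \<longrightarrow> Q.p_elt p h \<and> (\<forall>b. Q.p_elt p b \<longrightarrow> b \<in> Q.cyc h)"
    proof (cases "Factorial_Ring.prime p")
      case True
      have eq: "primary_component (G Mod A) S p = {b. Q.p_elt p b}" by (rule Q.primary_component_eq[OF compQ True])
      obtain h where "Q.p_elt p h" "\<And>b. Q.p_elt p b \<Longrightarrow> b \<in> Q.cyc h"
        using Q.primary_generator[OF True pc[OF True, unfolded eq]] by blast
      then show ?thesis by blast
    qed simp
  qed
  from choice[OF this] obtain h where
    h: "\<forall>p. Factorial_Ring.prime p \<longrightarrow> Q.p_elt p (h p) \<and> (\<forall>b. Q.p_elt p b \<longrightarrow> b \<in> Q.cyc (h p))" by (rule exE)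
  interpret P: procyclic_parts "G Mod A" S h
    by unfold_locales (use compQ h in auto)
  have oneQ: "openin S (carrier (G Mod A))" "\<one>\<^bsub>G Mod A\<^esub> \<in> carrier (G Mod A)" using Q.openin_carrier_self Q.one_closed by auto
  obtain U where U: "subgroup U (G Mod A)" "openin S U" "compactin S U"
    \<comment> \<open>Any compact open subgroup can start the tower, so the whole group serves as
      the neighbourhood of the identity.\<close>
    using Q.van_Dantzig[OF lcQ(3,2,4) oneQ] by blast
  have Uo: "Q.opensub U" using U by simp
  obtain m :: "nat \<Rightarrow> int" where m:
    "\<And>k p. Factorial_Ring.prime p \<Longrightarrow> p \<noteq> k \<Longrightarrow> coprime (m k) (int p)"
    "\<And>k x. x \<in> P.gens (P.tower U (Suc k)) \<Longrightarrow> x [^]\<^bsub>G Mod A\<^esub> m k \<in> P.gens (P.tower U k)"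
    "\<And>k x j. x \<in> P.gens (P.tower U (Suc k)) \<Longrightarrow> x [^]\<^bsub>G Mod A\<^esub> j \<in> P.tower U k \<Longrightarrow> m k dvd j"
    "\<And>x. x \<in> carrier (G Mod A) \<Longrightarrow> \<exists>k. x \<in> P.tower U k"
    using P.tower_exists[OF Uo U(3)] by blast
  have tw: "Q.opensub (P.tower U k)" "compactin S (P.tower U k)" for k
    using P.tower_compact_open[OF Uo U(3)] by auto
  interpret L: tower_lift G T "G Mod A" S "\<lambda>x. A #>\<^bsub>G\<^esub> x" "P.tower U" "\<lambda>k. P.gens (P.tower U k)" m
  proof unfold_locales
    show "Hausdorff_space T" "locally_compact_space T" by (fact HT, fact lc)
    show "(\<lambda>x. A #>\<^bsub>G\<^esub> x) \<in> hom G (G Mod A)" by (rule A.r_coset_hom_Mod)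
    show "(\<lambda>x. A #>\<^bsub>G\<^esub> x) ` carrier G = carrier (G Mod A)" by (simp add: carrier_FactGroup)
    show "continuous_map T S (\<lambda>x. A #>\<^bsub>G\<^esub> x)" unfolding S_def by (rule G.continuous_map_quotient_group)
    show "compactin T {x \<in> carrier G. A #>\<^bsub>G\<^esub> x \<in> K}" if "compactin S K" for K
      using compactin_proper_map_preimage[OF G.proper_map_quotient_group[OF A.is_subgroup assms(3)]] that unfolding S_def by simp
    show "compactin S (Q.cyc b)" if "b \<in> carrier (G Mod A)" for b using compQ that by blast
    show "subgroup (P.tower U k) (G Mod A) \<and> openin S (P.tower U k)" "compactin S (P.tower U k)" for k
      using tw[of k] by auto
    show "closedin S (P.gens (P.tower U k))" "P.gens (P.tower U k) \<noteq> {}" for k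
      using P.closedin_gens P.gens_nonempty tw by auto
    show "P.gens (P.tower U k) \<subseteq> P.tower U k" for k unfolding P.gens_def by blast
    show "P.tower U k \<subseteq> Q.cyc w" if "w \<in> P.gens (P.tower U k)" for k w using that unfolding P.gens_def by blast
  qed (use m in auto)
  obtain H where H: "subgroup H G" "closedin T H" "Pi_procyclic (G\<lparr>carrier := H\<rparr>) (subtopology T H)"
    "\<And>x. x \<in> carrier G \<Longrightarrow> \<exists>y\<in>H. A #>\<^bsub>G\<^esub> y = A #>\<^bsub>G\<^esub> x"
    using L.supplement_exists by blast
  have "carrier G = A <#>\<^bsub>G\<^esub> H"
  proof
    show "carrier G \<subseteq> A <#>\<^bsub>G\<^esub> H"
    proof
      fix x assume x: "x \<in> carrier G"
      then obtain y where y: "y \<in> H" "A #>\<^bsub>G\<^esub> y = A #>\<^bsub>G\<^esub> x" using H(4) by blast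
      then have "x \<in> A #>\<^bsub>G\<^esub> y" using G.rcos_self[OF x A.is_subgroup] by simp
      then show "x \<in> A <#>\<^bsub>G\<^esub> H" using y(1) unfolding r_coset_def set_mult_def by blast
    qed
    show "A <#>\<^bsub>G\<^esub> H \<subseteq> carrier G"
      using A.subset subgroup.subset[OF H(1)] unfolding set_mult_def by auto
  qed
  with H show ?thesis by blast
qed

end
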